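(* Let $n\ge 3$. There exists $\rho_0\in(0,1)$ (depending on $n$) such that for every $x\in\mathbf{B}^n$ with $\rho_0<|x|<1$ one has $$\mathcal{C}(x)=\mathcal{C}(x;\mathbf{n}_x),$$ and moreover, for such $x$ and $\ell\in\partial\mathbf{B}^n$, the equality $\mathcal{C}(x)=\mathcal{C}(x;\ell)$ holds only for $\ell=\pm\mathbf{n}_x$.
   Context: $\mathbf{B}^n=\{x\in\mathbf{R}^n:|x|<1\}$ is the open unit ball and $\partial\mathbf{B}^n$ the unit sphere. For $x\in\mathbf{B}^n$ and $\ell\in\partial\mathbf{B}^n$, $\mathcal{C}(x;\ell)$ denotes the smallest number such that $|\langle\nabla U(x),\ell\rangle|\le\mathcal{C}(x;\ell)\sup_{y\in\mathbf{B}^n}|U(y)|$ for all real-valued bounded harmonic functions $U$ in $\mathbf{B}^n$, and $\mathcal{C}(x)$ denotes the smallest number such that $|\nabla U(x)|\le\mathcal{C}(x)\sup_{y\in\mathbf{B}^n}|U(y)|$ for all such $U$. For $x\ne0$, $\mathbf{n}_x=x/|x|$ is the radial direction. *)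

theory Defs
  imports "HOL-Analysis.Analysis"
begin

definition partial :: "'n::finite \<Rightarrow> (real ^ 'n \<Rightarrow> real) \<Rightarrow> real ^ 'n \<Rightarrow> real" where
  "partial i f x = frechet_derivative f (at x) (axis i 1)"

definition grad :: "(real ^ 'n::finite \<Rightarrow> real) \<Rightarrow> real ^ 'n \<Rightarrow> real ^ 'n" where
  "grad f x = (\<chi> i. partial i f x)"

definition laplacian :: "(real ^ 'n::finite \<Rightarrow> real) \<Rightarrow> real ^ 'n \<Rightarrow> real" where
  "laplacian f x = (\<Sum>i\<in>UNIV. partial i (partial i f) x)"

text \<open>The functions are total, but for open \<open>S\<close> the following two notions depend only on the
  values of \<open>f\<close> on \<open>S\<close>.\<close>

definition C2_on :: "(real ^ 'n::finite) set \<Rightarrow> (real ^ 'n \<Rightarrow> real) \<Rightarrow> bool" where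
  "C2_on S f \<longleftrightarrow>
     (\<forall>x\<in>S. f differentiable (at x)) \<and>
     (\<forall>i. \<forall>x\<in>S. partial i f differentiable (at x)) \<and>
     (\<forall>i j. continuous_on S (partial j (partial i f)))"

definition harmonic_on :: "(real ^ 'n::finite) set \<Rightarrow> (real ^ 'n \<Rightarrow> real) \<Rightarrow> bool" where
  "harmonic_on S f \<longleftrightarrow> C2_on S f \<and> (\<forall>x\<in>S. laplacian f x = 0)"

definition bounded_harmonic :: "(real ^ 'n::finite \<Rightarrow> real) \<Rightarrow> bool" where
  "bounded_harmonic U \<longleftrightarrow> harmonic_on (ball 0 1) U \<and> bounded (U ` ball 0 1)"

definition sup_abs :: "(real ^ 'n::finite \<Rightarrow> real) \<Rightarrow> real" where
  "sup_abs U = (SUP y\<in>ball 0 1. \<bar>U y\<bar>)"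

definition dir_grad_const :: "real ^ 'n::finite \<Rightarrow> real ^ 'n \<Rightarrow> real" where
  "dir_grad_const x l =
     (LEAST C. \<forall>U. bounded_harmonic U \<longrightarrow> \<bar>grad U x \<bullet> l\<bar> \<le> C * sup_abs U)"

definition grad_const :: "real ^ 'n::finite \<Rightarrow> real" where
  "grad_const x =
     (LEAST C. \<forall>U. bounded_harmonic U \<longrightarrow> norm (grad U x) \<le> C * sup_abs U)"

lemma GDERIV_grad:
  assumes "f differentiable (at x)"
  shows "GDERIV f x :> grad f x"
proof -
  let ?D = "frechet_derivative f (at x)"
  have D: "(f has_derivative ?D) (at x)"
    using assms frechet_derivative_works by blast
  have "?D h = h \<bullet> grad f x" for h
  proof -
    have lin: "linear ?D"
      using D has_derivative_linear by blast
    have "?D h = ?D (\<Sum>i\<in>UNIV. (h $ i) *\<^sub>R axis i 1)"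
      using basis_expansion[of h] by (simp add: scalar_mult_eq_scaleR)
    also have "\<dots> = (\<Sum>i\<in>UNIV. h $ i * ?D (axis i 1))"
      by (simp add: linear_sum[OF lin] linear_scale[OF lin])
    finally show ?thesis
      by (simp add: inner_vec_def grad_def partial_def)
  qed
  then have "?D = (\<lambda>h. h \<bullet> grad f x)"
    by blast
  then show ?thesis
    using D by (simp add: gderiv_def)
qed

end

theory Submission
  imports Defs
begin

text \<open>
  By duality, \<open>dir_grad_const x l\<close> is the integral of the absolute value of \<open>l \<bullet> \<nabla>\<^sub>x P(x, z)\<close>, with
  \<open>P\<close> the Poisson kernel, over the unit sphere. This kernel is a power of
  \<open>\<bar>x - z\<bar>\<close> times an affine function of \<open>z\<close> whose zero hyperplane passes, for every \<open>l\<close>, through the same point \<open>\<tau>e\<close> of the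
  axis through \<open>e = x/\<bar>x\<bar>\<close>. The conformal automorphism of the sphere that acts on the Klein model by moving
  \<open>\<tau>e\<close> to the origin, followed by a linear stretch along \<open>e\<close>, turns the integral into a cosine transform
  \<open>\<integral> \<bar>w \<bullet> l\<bar> W(w) dw\<close> whose weight \<open>W\<close> depends on \<open>\<bar>w\<bar>\<close> and \<open>w \<bullet> e\<close> only. On each sphere
  \<open>W(w) + W(-w)\<close> is a strictly increasing function of \<open>\<bar>w \<bullet> e\<bar>\<close>, because \<open>W\<close> is log-convex
  in a suitable coordinate. The reflection swapping \<open>e\<close> and \<open>l\<close> then shows that the transform has its strict
  maximum at \<open>l = \<plusminus>e\<close>. The argument works for every \<open>x \<noteq> 0\<close> in the ball, so any \<open>\<rho>\<^sub>0\<close> will do.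

  The uniform measure of the sphere is replaced by integrals of functions that are homogeneous of
  degree \<open>-n\<close> over the shell \<open>1 \<le> \<bar>w\<bar> \<le> 2\<close>; no Jacobian is ever computed, because a measure on the sphere
  is uniform as soon as the Poisson kernel has a constant integral against it.
\<close>

subsection \<open>Integration on a spherical shell\<close>

text \<open>With \<rho> = |x|, the function |x - z|^2 = 1 + \<rho>^2 - 2 \<rho> (z . e) is affine in
  z on the unit sphere. Hence |x - z|^(n+2) times the gradient of P in its first variable agrees
  there with an affine vector field in z, whose single zero is \<tau>e. Pairing with l gives all
  hyperplanes at once, which explains the common point. After the boost the zero sits at the origin
  and the field is linear, with one eigenvalue on the axis and one on its complement. The stretch
  makes the two eigenvalues equal.

  A bounded harmonic function need not extend continuously to the sphere, and the transformed
  measure on the sphere is never computed. What is known about that measure is one identity: the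
  integral of J w * P(y, Z w) has the same value c for all y in the ball. By the maximum principle
  this already yields the Poisson formula for harmonic functions that are continuous up to the
  sphere. The constant c enters the sharp constants only as a common factor, so comparing directions
  never requires its value.\<close>

lemma nn_integral_lborel_translate:
  fixes f :: "'a::euclidean_space \<Rightarrow> ennreal"
  assumes [measurable]: "f \<in> borel_measurable borel"
  shows "(\<integral>\<^sup>+x. f (a + x) \<partial>lborel) = (\<integral>\<^sup>+x. f x \<partial>lborel)"
proof -
  have "(\<integral>\<^sup>+x. f x \<partial>lborel) = (\<integral>\<^sup>+x. f x \<partial>distr lborel borel ((+) a))"
    by (simp add: lborel_distr_plus)
  also have "\<dots> = (\<integral>\<^sup>+x. f (a + x) \<partial>lborel)"
    by (rule nn_integral_distr) auto
  finally show ?thesis by simp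
qed

lemma nn_integral_lborel_scale:
  fixes f :: "'a::euclidean_space \<Rightarrow> ennreal"
  assumes [measurable]: "f \<in> borel_measurable borel" and c: "c \<noteq> 0"
  shows "(\<integral>\<^sup>+x. f x \<partial>lborel) = ennreal (\<bar>c\<bar> ^ DIM('a)) * (\<integral>\<^sup>+x. f (c *\<^sub>R x) \<partial>lborel)"
proof -
  have "(\<integral>\<^sup>+x. f x \<partial>lborel)
      = (\<integral>\<^sup>+x. f x \<partial>density (distr lborel borel (\<lambda>x. 0 + c *\<^sub>R x)) (\<lambda>_. \<bar>c\<bar> ^ DIM('a)))"
    using lborel_affine[OF c, of "0::'a"] by simp
  also have "\<dots> = (\<integral>\<^sup>+x. ennreal (\<bar>c\<bar> ^ DIM('a)) * f (c *\<^sub>R x) \<partial>lborel)"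
    by (subst nn_integral_density) (simp_all add: nn_integral_distr)
  also have "\<dots> = ennreal (\<bar>c\<bar> ^ DIM('a)) * (\<integral>\<^sup>+x. f (c *\<^sub>R x) \<partial>lborel)"
    by (rule nn_integral_cmult) measurable
  finally show ?thesis .
qed

text \<open>The usual Fubini proof of the uniqueness of Haar measure, comparing both sides with the indicator of the
  unit ball. The change of variables theorems of HOL-Analysis need a well-ordered index type.\<close>

lemma nn_integral_lborel_linear:
  fixes T :: "'a::euclidean_space \<Rightarrow> 'a" and g :: "'a \<Rightarrow> ennreal"
  assumes lin: "linear T" and bij: "bij T" and [measurable]: "g \<in> borel_measurable borel"
  shows "emeasure lborel (T -` cball 0 1) * (\<integral>\<^sup>+x. g x \<partial>lborel)
       = emeasure lborel (cball (0::'a) 1) * (\<integral>\<^sup>+x. g (T x) \<partial>lborel)"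
proof -
  define f :: "'a \<Rightarrow> ennreal" where "f = indicator (cball 0 1)"
  have Tm[measurable]: "T \<in> borel_measurable borel"
    using lin by (intro borel_measurable_continuous_onI linear_continuous_on) (simp add: linear_conv_bounded_linear)
  have fm[measurable]: "f \<in> borel_measurable borel" unfolding f_def by (intro borel_measurable_indicator) simp
  have fsym: "f (- z) = f z" for z unfolding f_def by (simp add: indicator_def)
  \<comment> \<open>The double integral of f (T x) * g (y + T x) is evaluated in both orders.
    Shifting y by T x frees g from x. Shifting x by the preimage of y moves y from g into f, where
    the symmetry of the ball lets it be integrated out.\<close>
  have sh: "(\<integral>\<^sup>+x. f (T x) * g (y + T x) \<partial>lborel) = (\<integral>\<^sup>+x. f (T x - y) * g (T x) \<partial>lborel)" for y
  proof -
    obtain z where z: "T z = y" using bij by (metis bij_pointE)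
    have Tzx: "T (z + x) = y + T x" for x using lin z by (simp add: linear_add)
    have "(\<integral>\<^sup>+x. f (T x - y) * g (T x) \<partial>lborel) = (\<integral>\<^sup>+x. f (T (z + x) - y) * g (T (z + x)) \<partial>lborel)"
      by (rule nn_integral_lborel_translate[symmetric]) measurable
    then show ?thesis by (simp add: Tzx)
  qed
  have refl: "(\<integral>\<^sup>+y. f (a - y) \<partial>lborel) = (\<integral>\<^sup>+y. f y \<partial>lborel)" for a
  proof -
    have "(\<integral>\<^sup>+y. f (a - y) \<partial>lborel) = (\<integral>\<^sup>+y. f (- a + y) \<partial>lborel)"
      by (rule nn_integral_cong) (metis fsym minus_diff_eq uminus_add_conv_diff)
    then show ?thesis using nn_integral_lborel_translate[OF fm, of "-a"] by simp
  qed
  have "(\<integral>\<^sup>+x. f (T x) \<partial>lborel) * (\<integral>\<^sup>+y. g y \<partial>lborel)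
      = (\<integral>\<^sup>+x. f (T x) * (\<integral>\<^sup>+y. g y \<partial>lborel) \<partial>lborel)"
    by (rule nn_integral_multc[symmetric]) measurable
  also have "\<dots> = (\<integral>\<^sup>+x. \<integral>\<^sup>+y. f (T x) * g (y + T x) \<partial>lborel \<partial>lborel)"
  proof (rule nn_integral_cong)
    fix x
    have "(\<integral>\<^sup>+y. g y \<partial>lborel) = (\<integral>\<^sup>+y. g (y + T x) \<partial>lborel)"
      using nn_integral_lborel_translate[of g "T x"] by (simp add: add.commute)
    then show "f (T x) * (\<integral>\<^sup>+y. g y \<partial>lborel) = (\<integral>\<^sup>+y. f (T x) * g (y + T x) \<partial>lborel)"
      by (simp add: nn_integral_cmult)
  qed
  also have "\<dots> = (\<integral>\<^sup>+y. \<integral>\<^sup>+x. f (T x) * g (y + T x) \<partial>lborel \<partial>lborel)"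
    by (rule lborel_pair.Fubini') measurable
  also have "\<dots> = (\<integral>\<^sup>+y. \<integral>\<^sup>+x. f (T x - y) * g (T x) \<partial>lborel \<partial>lborel)"
    by (simp add: sh)
  also have "\<dots> = (\<integral>\<^sup>+x. \<integral>\<^sup>+y. f (T x - y) * g (T x) \<partial>lborel \<partial>lborel)"
    by (rule lborel_pair.Fubini') measurable
  also have "\<dots> = (\<integral>\<^sup>+x. (\<integral>\<^sup>+y. f y \<partial>lborel) * g (T x) \<partial>lborel)"
    by (rule nn_integral_cong) (simp add: nn_integral_multc refl)
  also have "\<dots> = (\<integral>\<^sup>+y. f y \<partial>lborel) * (\<integral>\<^sup>+x. g (T x) \<partial>lborel)"
    by (rule nn_integral_cmult) measurable
  finally have *: "(\<integral>\<^sup>+x. f (T x) \<partial>lborel) * (\<integral>\<^sup>+y. g y \<partial>lborel)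
      = (\<integral>\<^sup>+y. f y \<partial>lborel) * (\<integral>\<^sup>+x. g (T x) \<partial>lborel)" .
  have "(\<integral>\<^sup>+x. f (T x) \<partial>lborel) = (\<integral>\<^sup>+x. indicator (T -` cball 0 1) x \<partial>lborel)"
    unfolding f_def by (simp add: indicator_def)
  moreover have "T -` cball 0 1 \<in> sets borel"
    using measurable_sets[OF Tm, of "cball 0 1"] by simp
  ultimately show ?thesis using * by (simp add: f_def)
qed

lemma nn_integral_lborel_orthogonal:
  fixes T :: "'a::euclidean_space \<Rightarrow> 'a" and g :: "'a \<Rightarrow> ennreal"
  assumes orth: "orthogonal_transformation T" and g: "g \<in> borel_measurable borel"
  shows "(\<integral>\<^sup>+x. g (T x) \<partial>lborel) = (\<integral>\<^sup>+x. g x \<partial>lborel)"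
proof -
  have "T -` cball 0 1 = cball 0 1"
    using orth by (auto simp: orthogonal_transformation_norm)
  moreover have "0 < emeasure lborel (cball (0::'a) 1)"
    by (simp add: emeasure_cball)
  moreover have "emeasure lborel (cball (0::'a) 1) < \<infinity>"
    by (rule emeasure_lborel_cball_finite)
  ultimately show ?thesis
    using nn_integral_lborel_linear[OF orthogonal_transformation_linear[OF orth] orthogonal_transformation_bij[OF orth] g]
    by (auto simp: ennreal_mult_cancel_left)
qed

lemma nn_integral_inverse_dyadic:
  assumes "0 < a"
  shows "(\<integral>\<^sup>+t. ennreal (inverse t) * indicator {a..2*a} t \<partial>lborel) = ennreal (ln 2)"
proof -
  have "(\<integral>\<^sup>+t. ennreal (inverse t) * indicator {a..2*a} t \<partial>lborel) = ennreal (ln (2*a) - ln a)"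
    using assms by (intro nn_integral_FTC_Icc) (auto intro!: DERIV_ln)
  also have "ln (2*a) - ln a = ln 2" using assms by (simp add: ln_mult)
  finally show ?thesis .
qed

text \<open>Compact and bounded away from 0, so every function continuous off the origin is
  integrable on it. For densities homogeneous of degree -n its integral is ln 2 times the integral
  over the unit sphere.\<close>

definition shell :: "'a::euclidean_space set" where
  "shell = {z. 1 \<le> norm z \<and> norm z \<le> 2}"

text \<open>Insert \<open>1 = 1/(ln 2) \<integral> [1 \<le> t\<bar>z\<bar> \<le> 2] dt/t\<close>, substitute \<open>z \<mapsto> z/t\<close> and swap the integrals.\<close>

lemma nn_integral_homogeneous_gauge:
  fixes G :: "'a::euclidean_space \<Rightarrow> ennreal" and q :: "'a \<Rightarrow> real"
  assumes [measurable]: "G \<in> borel_measurable borel" "q \<in> borel_measurable borel"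
    and G: "\<And>t z. 0 < t \<Longrightarrow> G z = ennreal (t ^ DIM('a)) * G (t *\<^sub>R z)"
    and q: "\<And>t z. 0 < t \<Longrightarrow> q (t *\<^sub>R z) = t * q z" and qpos: "\<And>z. z \<noteq> 0 \<Longrightarrow> 0 < q z"
  shows "(\<integral>\<^sup>+z. G z * indicator {z. 1 \<le> q z \<and> q z \<le> 2} z \<partial>lborel) = (\<integral>\<^sup>+z. G z * indicator shell z \<partial>lborel)"
proof -
  define A where "A = {z. 1 \<le> q z \<and> q z \<le> 2}"
  have A[measurable]: "A \<in> sets borel" unfolding A_def by measurable
  have S[measurable]: "shell \<in> sets (borel :: 'a measure)" unfolding shell_def by measurable
  have q0: "q 0 = 0" using q[of 2 0] by simp
  define K :: "real \<Rightarrow> real \<Rightarrow> ennreal" where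
    "K t r = ennreal (inverse t) * (indicator {0<..} t * indicator {1..2} (t * r))" for t r
  have [measurable]: "(\<lambda>(t, r). K t r) \<in> borel_measurable (borel \<Otimes>\<^sub>M borel)"
    unfolding K_def by measurable
  have K1: "(\<integral>\<^sup>+t. K t r \<partial>lborel) = ennreal (ln 2)" if "0 < r" for r
  proof -
    have "0 < t \<and> 1 \<le> t * r \<and> t * r \<le> 2 \<longleftrightarrow> 1/r \<le> t \<and> t \<le> 2*(1/r)" for t
    proof -
      have "1/r \<le> t \<longleftrightarrow> 1 \<le> t * r" "t \<le> 2*(1/r) \<longleftrightarrow> t * r \<le> 2"
        using that by (simp_all add: field_simps)
      moreover have "0 < t" if "1/r \<le> t"
        using that \<open>0 < r\<close> by (meson less_le_trans zero_less_divide_1_iff)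
      ultimately show ?thesis by blast
    qed
    then have "K t r = ennreal (inverse t) * indicator {1/r..2*(1/r)} t" for t
      unfolding K_def by (simp add: indicator_def flip: of_bool_conj)
    then show ?thesis using nn_integral_inverse_dyadic[of "1/r"] that by simp
  qed
  define K' :: "real \<Rightarrow> real \<Rightarrow> ennreal" where
    "K' t r = ennreal (inverse t) * (indicator {0<..} t * indicator {1..2} (r / t))" for t r
  have [measurable]: "(\<lambda>(t, r). K' t r) \<in> borel_measurable (borel \<Otimes>\<^sub>M borel)"
    unfolding K'_def by measurable
  have K1': "(\<integral>\<^sup>+t. K' t r \<partial>lborel) = ennreal (ln 2)" if "0 < r" for r
  proof -
    have "0 < t \<and> 1 \<le> r / t \<and> r / t \<le> 2 \<longleftrightarrow> r/2 \<le> t \<and> t \<le> 2*(r/2)" for t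
    proof (cases "0 < t")
      case True
      then show ?thesis by (simp add: pos_le_divide_eq pos_divide_le_eq) linarith
    next
      case False
      then show ?thesis using that by linarith
    qed
    then have "K' t r = ennreal (inverse t) * indicator {r/2..2*(r/2)} t" for t
      unfolding K'_def by (simp add: indicator_def flip: of_bool_conj)
    then show ?thesis using nn_integral_inverse_dyadic[of "r/2"] that by simp
  qed
  have pos: "z \<in> A \<Longrightarrow> 0 < norm z" "z \<in> shell \<Longrightarrow> 0 < q z" for z
    using q0 qpos[of z] by (cases "z = 0"; auto simp: A_def shell_def)+
  have "ennreal (ln 2) * (\<integral>\<^sup>+z. G z * indicator A z \<partial>lborel)
      = (\<integral>\<^sup>+z. G z * indicator A z * ennreal (ln 2) \<partial>lborel)"
    by (subst nn_integral_multc) (auto simp: mult.commute)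
  also have "\<dots> = (\<integral>\<^sup>+z. \<integral>\<^sup>+t. G z * indicator A z * K t (norm z) \<partial>lborel \<partial>lborel)"
    using pos by (intro nn_integral_cong) (auto simp: nn_integral_cmult K1 indicator_def)
  also have "\<dots> = (\<integral>\<^sup>+t. \<integral>\<^sup>+z. G z * indicator A z * K t (norm z) \<partial>lborel \<partial>lborel)"
    by (rule lborel_pair.Fubini') measurable
  also have "\<dots> = (\<integral>\<^sup>+t. \<integral>\<^sup>+z. G z * indicator shell z * K' t (q z) \<partial>lborel \<partial>lborel)"
  proof (rule nn_integral_cong)
    \<comment> \<open>Replacing z by t z exchanges the two windows: 1 <= t |z| <= 2 says that t z
      lies in the shell, and z in A says that q (t z) / t lies in [1, 2]. The Jacobian t^n is
      absorbed by the homogeneity of G.\<close>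
    fix t :: real
    show "(\<integral>\<^sup>+z. G z * indicator A z * K t (norm z) \<partial>lborel) = (\<integral>\<^sup>+z. G z * indicator shell z * K' t (q z) \<partial>lborel)"
    proof (cases "0 < t")
      case True
      have "(\<integral>\<^sup>+z. G z * indicator shell z * K' t (q z) \<partial>lborel)
          = ennreal (\<bar>t\<bar> ^ DIM('a)) * (\<integral>\<^sup>+z. G (t *\<^sub>R z) * indicator shell (t *\<^sub>R z) * K' t (q (t *\<^sub>R z)) \<partial>lborel)"
        using True by (intro nn_integral_lborel_scale) auto
      also have "\<dots> = (\<integral>\<^sup>+z. ennreal (t ^ DIM('a)) * (G (t *\<^sub>R z) * indicator shell (t *\<^sub>R z) * K' t (q (t *\<^sub>R z))) \<partial>lborel)"
        using True by (subst nn_integral_cmult) auto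
      also have "\<dots> = (\<integral>\<^sup>+z. G z * indicator A z * K t (norm z) \<partial>lborel)"
        using True by (intro nn_integral_cong, subst (2) G[OF True])
          (auto simp: K_def K'_def q[OF True] A_def shell_def indicator_def mult.assoc)
      finally show ?thesis by simp
    qed (auto simp: K_def K'_def)
  qed
  also have "\<dots> = (\<integral>\<^sup>+z. \<integral>\<^sup>+t. G z * indicator shell z * K' t (q z) \<partial>lborel \<partial>lborel)"
    by (rule lborel_pair.Fubini') measurable
  also have "\<dots> = (\<integral>\<^sup>+z. G z * indicator shell z * ennreal (ln 2) \<partial>lborel)"
    using pos by (intro nn_integral_cong) (auto simp: nn_integral_cmult K1' indicator_def)
  also have "\<dots> = ennreal (ln 2) * (\<integral>\<^sup>+z. G z * indicator shell z \<partial>lborel)"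
    by (subst nn_integral_multc) (auto simp: mult.commute)
  finally show ?thesis
    by (simp add: ennreal_mult_cancel_left A_def)
qed

subsection \<open>The maximum principle\<close>

lemma partial_eq:
  assumes "(f has_derivative (\<lambda>h. h \<bullet> g)) (at x)"
  shows "partial i f x = g $ i"
  using frechet_derivative_at[OF assms] unfolding partial_def
  by (metis inner_axis inner_commute inner_real_def mult.right_neutral)

lemma grad_eq:
  assumes "(f has_derivative (\<lambda>h. h \<bullet> g)) (at x)"
  shows "grad f x = g"
  by (simp add: grad_def partial_eq[OF assms] vec_eq_iff)

text \<open>\<open>partial i f\<close> is a total function about which only the values on S are
  known. Openness of S allows it to be replaced locally by the given component of g and then
  differentiated again.\<close>

lemma
  fixes f :: "real ^ 'n::finite \<Rightarrow> real"
  assumes S: "open S"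
    and f: "\<And>x. x \<in> S \<Longrightarrow> (f has_derivative (\<lambda>h. h \<bullet> g x)) (at x)"
    and g: "\<And>i x. x \<in> S \<Longrightarrow> ((\<lambda>x. g x $ i) has_derivative (\<lambda>h. h \<bullet> H i x)) (at x)"
    and H: "\<And>i. continuous_on S (H i)"
  shows C2_onI: "C2_on S f"
    and laplacian_eq: "x \<in> S \<Longrightarrow> laplacian f x = (\<Sum>i\<in>UNIV. H i x $ i)"
proof -
  have p1: "x \<in> S \<Longrightarrow> partial i f x = g x $ i" for x i
    by (rule partial_eq[OF f])
  have d2: "(partial i f has_derivative (\<lambda>h. h \<bullet> H i x)) (at x)" if "x \<in> S" for x i
    by (rule has_derivative_transform_within_open[OF g[OF that] S that]) (simp add: p1)
  have p2: "x \<in> S \<Longrightarrow> partial j (partial i f) x = H i x $ j" for x i j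
    by (rule partial_eq[OF d2])
  have "continuous_on S (partial j (partial i f))" for i j
  proof -
    have "continuous_on S (\<lambda>x. H i x $ j)"
      by (intro continuous_intros H)
    then show ?thesis
      by (subst continuous_on_cong[OF refl p2])
  qed
  then show "C2_on S f"
    unfolding C2_on_def using f d2 differentiableI by blast
  show "x \<in> S \<Longrightarrow> laplacian f x = (\<Sum>i\<in>UNIV. H i x $ i)"
    by (simp add: laplacian_def p2)
qed

lemma
  fixes f :: "real ^ 'n::finite \<Rightarrow> real"
  assumes f: "C2_on S f" and x: "x \<in> S"
  shows C2_on_has_derivative: "(f has_derivative (\<lambda>h. h \<bullet> grad f x)) (at x)"
    and C2_on_partial_has_derivative: "(partial i f has_derivative (\<lambda>h. h \<bullet> grad (partial i f) x)) (at x)"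
    and C2_on_grad_has_derivative: "((\<lambda>x. grad f x $ i) has_derivative (\<lambda>h. h \<bullet> grad (partial i f) x)) (at x)"
proof -
  show "(f has_derivative (\<lambda>h. h \<bullet> grad f x)) (at x)"
    and *: "(partial i f has_derivative (\<lambda>h. h \<bullet> grad (partial i f) x)) (at x)"
    using f x GDERIV_grad[of f x] GDERIV_grad[of "partial i f" x] unfolding C2_on_def gderiv_def by auto
  show "((\<lambda>x. grad f x $ i) has_derivative (\<lambda>h. h \<bullet> grad (partial i f) x)) (at x)"
    using * by (simp add: grad_def)
qed

lemma C2_on_imp_continuous_on:
  assumes "C2_on S f"
  shows "continuous_on S f"
  using assms by (meson C2_on_def continuous_at_imp_continuous_on differentiable_imp_continuous_within)

lemma C2_on_imp_continuous_on_partial: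
  assumes "C2_on S f"
  shows "continuous_on S (partial i f)"
  using assms by (meson C2_on_def continuous_at_imp_continuous_on differentiable_imp_continuous_within)

lemma second_derivative_test_local_max:
  fixes f f' :: "real \<Rightarrow> real"
  assumes d: "0 < d" and f: "\<And>t. \<bar>t\<bar> < d \<Longrightarrow> (f has_real_derivative f' t) (at t)"
    and f': "(f' has_real_derivative c) (at 0)" and max: "\<And>t. \<bar>t\<bar> < d \<Longrightarrow> f t \<le> f 0"
  shows "c \<le> 0"
proof (rule ccontr)
  assume "\<not> c \<le> 0"
  then obtain e where e: "e > 0" "\<And>h. 0 < h \<Longrightarrow> h < e \<Longrightarrow> f' 0 < f' (0 + h)"
    using DERIV_pos_inc_right[OF f'] by (metis not_le)
  have f0: "f' 0 = 0"
    by (rule DERIV_local_max[OF f d]) (use d max in auto)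
  define h where "h = min d e / 2"
  have h: "0 < h" "h < d" "h < e" using d e(1) by (auto simp: h_def min_def)
  obtain z where z: "0 < z" "z < h" "f h - f 0 = (h - 0) * f' z"
    using MVT2[OF h(1), of f f'] f h by (smt (verit))
  have "0 < f' z" using e(2)[of z] z h f0 by simp
  then have "0 < f h - f 0" using z h by simp
  then show False using max[of h] h by simp
qed

text \<open>Adding a positive multiple of |z|^2 makes the Laplacian strictly positive. At an
  interior maximum every pure second derivative is nonpositive, so the perturbed function has its
  maximum over the closed ball on the sphere.\<close>

lemma harmonic_max_principle:
  fixes v :: "real ^ 'n::finite \<Rightarrow> real"
  assumes v: "harmonic_on (ball 0 1) v" and r: "r < 1"
    and bd: "\<And>y. norm y = r \<Longrightarrow> v y \<le> M" and y: "norm y \<le> r"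
  shows "v y \<le> M"
proof (rule ccontr)
  assume "\<not> v y \<le> M"
  then have gt: "M < v y" by simp
  have C2: "C2_on (ball 0 1) v" and lap: "\<And>x. x \<in> ball 0 1 \<Longrightarrow> laplacian v x = 0"
    using v by (auto simp: harmonic_on_def)
  \<comment> \<open>Half of the supposed excess of v y over M. Since |z| <= 1, the perturbation
    raises the boundary values to at most M + \<epsilon>, still below v y, so the maximum of w is
    forced into the interior.\<close>
  define \<epsilon> where "\<epsilon> = (v y - M) / 2"
  have \<epsilon>: "0 < \<epsilon>" using gt by (simp add: \<epsilon>_def)
  define w where "w z = v z + \<epsilon> * (z \<bullet> z)" for z
  have sub: "cball 0 r \<subseteq> ball (0::real^'n) 1" using r by auto
  have "continuous_on (cball 0 r) w"
    unfolding w_def using C2_on_imp_continuous_on[OF C2] sub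
    by (intro continuous_intros) (rule continuous_on_subset)
  moreover have "cball (0::real^'n) r \<noteq> {}" using order_trans[OF norm_ge_zero y] by auto
  ultimately obtain z where z: "z \<in> cball 0 r" and zmax: "\<And>u. u \<in> cball 0 r \<Longrightarrow> w u \<le> w z"
    using continuous_attains_sup[OF compact_cball] by metis
  have "norm z \<noteq> r"
  proof
    assume nz: "norm z = r"
    have "z \<bullet> z \<le> 1" using nz r y norm_ge_zero[of z] by (simp add: dot_square_norm power_le_one)
    then have "w z \<le> M + \<epsilon>" unfolding w_def using bd[OF nz] \<epsilon> by (intro add_mono) (auto simp: mult_left_le)
    also have "\<dots> < v y" using gt by (simp add: \<epsilon>_def field_simps)
    also have "\<dots> \<le> w y" unfolding w_def using \<epsilon> by simp
    finally show False using zmax[of y] y by simp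
  qed
  then have zr: "norm z < r" using z by simp
  define d where "d = r - norm z"
  have d: "0 < d" using zr by (simp add: d_def)
  have le: "partial i (partial i v) z + 2 * \<epsilon> \<le> 0" for i
  proof (rule second_derivative_test_local_max[OF d])
    let ?p = "\<lambda>t. z + t *\<^sub>R axis i (1::real)"
    have p_in: "?p t \<in> ball 0 r" if "\<bar>t\<bar> < d" for t
      using norm_triangle_ineq[of z "t *\<^sub>R axis i 1"] that by (simp add: d_def)
    then have p_in1: "?p t \<in> ball 0 1" if "\<bar>t\<bar> < d" for t
      using that r by fastforce
    have zi: "z \<bullet> axis i 1 = z $ i" by (simp add: inner_axis)
    have axi: "axis i (1::real) \<bullet> axis i 1 = (1::real)" by (simp add: inner_axis_axis)
    have pp: "?p t \<bullet> ?p t = z \<bullet> z + 2 * t * z $ i + t * t" for t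
      using zi axi by (simp add: inner_add inner_commute[of "axis i 1" z] distrib_left)
    have dp: "(?p has_vector_derivative axis i 1) (at t)" for t
      by (auto intro!: derivative_eq_intros)
    show "((\<lambda>t. w (?p t)) has_real_derivative (partial i v (?p t) + 2 * \<epsilon> * (z $ i + t))) (at t)"
      if "\<bar>t\<bar> < d" for t
    proof -
      have "((v \<circ> ?p) has_derivative ((\<lambda>h. h \<bullet> grad v (?p t)) \<circ> (\<lambda>s. s *\<^sub>R axis i 1))) (at t)"
        by (rule diff_chain_at) (use dp C2_on_has_derivative[OF C2 p_in1[OF that]] in \<open>auto simp: has_vector_derivative_def\<close>)
      then have "((\<lambda>t. v (?p t)) has_real_derivative partial i v (?p t)) (at t)"
        by (simp add: has_field_derivative_def o_def grad_def inner_axis' mult.commute[of _ "partial _ _ _"] mult_commute_abs)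
      then show ?thesis
        unfolding w_def pp by (auto intro!: derivative_eq_intros simp: algebra_simps)
    qed
    have "((partial i v \<circ> ?p) has_derivative ((\<lambda>h. h \<bullet> grad (partial i v) (?p 0)) \<circ> (\<lambda>s. s *\<^sub>R axis i 1))) (at 0)"
      by (rule diff_chain_at) (use dp C2_on_partial_has_derivative[OF C2 p_in1[of 0]] d in \<open>auto simp: has_vector_derivative_def\<close>)
    then have "((\<lambda>t. partial i v (?p t)) has_real_derivative partial i (partial i v) z) (at 0)"
      by (simp add: has_field_derivative_def o_def grad_def inner_axis' mult_commute_abs)
    then show "((\<lambda>t. partial i v (?p t) + 2 * \<epsilon> * (z $ i + t)) has_real_derivative partial i (partial i v) z + 2 * \<epsilon>) (at 0)"
      by (auto intro!: derivative_eq_intros)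
    show "w (?p t) \<le> w (?p 0)" if "\<bar>t\<bar> < d" for t
      using zmax[of "?p t"] p_in[OF that] by auto
  qed
  have "0 = laplacian v z" using lap z sub by auto
  also have "\<dots> = (\<Sum>i\<in>UNIV. partial i (partial i v) z)" by (simp add: laplacian_def)
  also have "\<dots> < 0"
  proof -
    have "(\<Sum>i\<in>UNIV. partial i (partial i v) z) < (\<Sum>i\<in>(UNIV::'n set). 0)"
      by (rule sum_strict_mono) (use le \<epsilon> in \<open>auto simp: add_nonneg_pos intro: le_less_trans\<close>,
          smt (verit) le \<epsilon>)
    then show ?thesis by simp
  qed
  finally show False by simp
qed

text \<open>The boundary condition is a one-sided limit that is uniform near the sphere, so no
  continuous extension to the closed ball is required. Applied to a difference of harmonic functions
  and to its negative, it shows that the difference vanishes.\<close>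

lemma harmonic_eq_0:
  fixes v :: "real ^ 'n::finite \<Rightarrow> real"
  assumes v: "harmonic_on (ball 0 1) v"
    and bd: "\<And>\<epsilon>. 0 < \<epsilon> \<Longrightarrow> \<exists>r<1. \<forall>y. r < norm y \<and> norm y < 1 \<longrightarrow> v y \<le> \<epsilon>" and y: "norm y < 1"
  shows "v y \<le> 0"
proof (rule field_le_epsilon)
  fix \<epsilon> :: real assume "0 < \<epsilon>"
  then obtain r where r: "r < 1" "\<And>y. r < norm y \<Longrightarrow> norm y < 1 \<Longrightarrow> v y \<le> \<epsilon>" using bd by blast
  define r' where "r' = (max r (norm y) + 1) / 2"
  have r': "r < r'" "norm y \<le> r'" "r' < 1" using r(1) y by (auto simp: r'_def max_def field_simps)
  show "v y \<le> 0 + \<epsilon>"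
    using harmonic_max_principle[OF v r'(3) _ r'(2), of \<epsilon>] r(2) r' by auto
qed

section \<open>Continuity and differentiation of integrals with a compact parameter set\<close>

lemma uniform_on_compact_parameter:
  fixes g :: "'a::euclidean_space \<Rightarrow> 'b::euclidean_space \<Rightarrow> 'c::metric_space"
  assumes B: "open B" and S: "compact S" and g: "continuous_on (B \<times> S) (\<lambda>(y, z). g y z)"
    and y0: "y0 \<in> B" and \<epsilon>: "0 < \<epsilon>"
  obtains d where "0 < d" "ball y0 d \<subseteq> B" "\<And>y z. y \<in> ball y0 d \<Longrightarrow> z \<in> S \<Longrightarrow> dist (g y z) (g y0 z) < \<epsilon>"
proof -
  obtain r where r: "0 < r" "cball y0 r \<subseteq> B"
    using B y0 open_contains_cball by blast
  have "uniformly_continuous_on (cball y0 r \<times> S) (\<lambda>(y, z). g y z)"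
    using r by (intro compact_uniformly_continuous continuous_on_subset[OF g] compact_Times S) auto
  then obtain d where d: "0 < d" and u: "\<And>p p'. p \<in> cball y0 r \<times> S \<Longrightarrow> p' \<in> cball y0 r \<times> S \<Longrightarrow> dist p' p < d \<Longrightarrow>
      dist ((\<lambda>(y, z). g y z) p') ((\<lambda>(y, z). g y z) p) < \<epsilon>"
    unfolding uniformly_continuous_on_def using \<epsilon> by metis
  show thesis
  proof
    show "0 < min d r" using d r by simp
    show "ball y0 (min d r) \<subseteq> B" using r by auto
    show "dist (g y z) (g y0 z) < \<epsilon>" if "y \<in> ball y0 (min d r)" "z \<in> S" for y z
      using u[of "(y0, z)" "(y, z)"] that r by (auto simp: dist_Pair_Pair dist_commute)
  qed
qed

text \<open>Instead of a measure on S there is a measure space M with a map Z into S and an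
  integrable density k. The uniform measure and its transforms under stretch and boost then differ
  only in Z and k, and no image measure on the sphere has to be constructed.\<close>

context
  fixes M :: "'w::euclidean_space measure" and Z :: "'w \<Rightarrow> 'b::euclidean_space" and S :: "'b set" and k :: "'w \<Rightarrow> real"
  assumes S: "compact S" and Z[measurable]: "Z \<in> borel_measurable M"
    and ZS: "\<And>w. w \<in> space M \<Longrightarrow> Z w \<in> S" and k: "integrable M k"
begin

lemma integrable_compact_parameter:
  fixes g :: "'b \<Rightarrow> 'c::euclidean_space"
  assumes g: "continuous_on S g"
  shows "integrable M (\<lambda>w. k w *\<^sub>R g (Z w))"
proof -
  obtain C where C: "\<And>z. z \<in> S \<Longrightarrow> norm (g z) \<le> C"
    using compact_imp_bounded[OF compact_continuous_image[OF g S]] by (auto simp: bounded_iff)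
  have [measurable]: "(\<lambda>z. indicator S z *\<^sub>R g z) \<in> borel_measurable borel"
    by (intro borel_measurable_continuous_on_indicator g borel_compact S)
  have "(\<lambda>w. indicator S (Z w) *\<^sub>R g (Z w)) \<in> borel_measurable M"
    by measurable
  then have [measurable]: "(\<lambda>w. g (Z w)) \<in> borel_measurable M"
    by (rule measurable_cong[THEN iffD1, rotated]) (simp add: ZS)
  have [measurable]: "k \<in> borel_measurable M" using k by simp
  show ?thesis
  proof (rule Bochner_Integration.integrable_bound)
    show "integrable M (\<lambda>w. C * k w)" using k by simp
    show "AE w in M. norm (k w *\<^sub>R g (Z w)) \<le> norm (C * k w)"
    proof (rule AE_I2)
      fix w assume "w \<in> space M"
      then have "norm (g (Z w)) \<le> \<bar>C\<bar>" using C[OF ZS] by (meson abs_ge_self order_trans)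
      then show "norm (k w *\<^sub>R g (Z w)) \<le> norm (C * k w)"
        using mult_right_mono[of "norm (g (Z w))" "\<bar>C\<bar>" "\<bar>k w\<bar>"] by (simp add: abs_mult mult.commute)
    qed
  qed measurable
qed

lemma continuous_on_parametric_integral:
  fixes g :: "'a::euclidean_space \<Rightarrow> 'b \<Rightarrow> 'c::euclidean_space"
  assumes B: "open B" and g: "continuous_on (B \<times> S) (\<lambda>(y, z). g y z)"
  shows "continuous_on B (\<lambda>y. \<integral>w. k w *\<^sub>R g y (Z w) \<partial>M)"
proof (rule continuous_at_imp_continuous_on, rule ballI, subst continuous_at, rule tendstoI)
  fix y0 and \<epsilon> :: real assume y0: "y0 \<in> B" and \<epsilon>: "0 < \<epsilon>"
  have gS: "continuous_on S (g y)" if "y \<in> B" for y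
    by (rule continuous_on_compose2[OF g, of _ "\<lambda>z. (y, z)", simplified]) (use that in \<open>auto intro!: continuous_intros\<close>)
  define I where "I = (\<integral>w. \<bar>k w\<bar> \<partial>M)"
  have I: "0 \<le> I" unfolding I_def by simp
  define e where "e = \<epsilon> / (2 * (I + 1))"
  have e: "0 < e" "e * I < \<epsilon>" using \<epsilon> I by (auto simp: e_def field_simps add_nonneg_pos)
  obtain d where d: "0 < d" "ball y0 d \<subseteq> B"
      and gd: "\<And>y z. y \<in> ball y0 d \<Longrightarrow> z \<in> S \<Longrightarrow> dist (g y z) (g y0 z) < e"
    using uniform_on_compact_parameter[OF B S g y0 e(1)] by metis
  have "dist (\<integral>w. k w *\<^sub>R g y (Z w) \<partial>M) (\<integral>w. k w *\<^sub>R g y0 (Z w) \<partial>M) < \<epsilon>" if y: "y \<in> ball y0 d" for y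
  proof -
    have yB: "y \<in> B" using y d by auto
    have "dist (\<integral>w. k w *\<^sub>R g y (Z w) \<partial>M) (\<integral>w. k w *\<^sub>R g y0 (Z w) \<partial>M)
        = norm (\<integral>w. k w *\<^sub>R g y (Z w) - k w *\<^sub>R g y0 (Z w) \<partial>M)"
      by (simp add: dist_norm Bochner_Integration.integral_diff integrable_compact_parameter gS yB y0)
    also have "\<dots> \<le> (\<integral>w. e * \<bar>k w\<bar> \<partial>M)"
    proof (rule Bochner_Integration.integral_norm_bound_integral)
      show "norm (k w *\<^sub>R g y (Z w) - k w *\<^sub>R g y0 (Z w)) \<le> e * \<bar>k w\<bar>" if "w \<in> space M" for w
        using gd[OF y ZS[OF that]] by (simp add: dist_norm mult.commute[of e] mult_left_mono flip: scaleR_diff_right)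
    qed (use k in \<open>auto intro!: Bochner_Integration.integrable_diff integrable_compact_parameter gS yB y0\<close>)
    also have "\<dots> = e * I" unfolding I_def by simp
    finally show ?thesis using e by simp
  qed
  then show "\<forall>\<^sub>F y in at y0. dist (\<integral>w. k w *\<^sub>R g y (Z w) \<partial>M) (\<integral>w. k w *\<^sub>R g y0 (Z w) \<partial>M) < \<epsilon>"
    using d(1) by (auto simp: eventually_at dist_commute)
qed

lemma has_derivative_parametric_integral:
  fixes f :: "'a::euclidean_space \<Rightarrow> 'b \<Rightarrow> real" and F :: "'a \<Rightarrow> 'b \<Rightarrow> 'a"
  assumes B: "open B" and f: "continuous_on (B \<times> S) (\<lambda>(y, z). f y z)" and F: "continuous_on (B \<times> S) (\<lambda>(y, z). F y z)"
    and der: "\<And>y z. y \<in> B \<Longrightarrow> z \<in> S \<Longrightarrow> ((\<lambda>y. f y z) has_derivative (\<lambda>h. h \<bullet> F y z)) (at y)"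
    and y0: "y0 \<in> B"
  shows "((\<lambda>y. \<integral>w. k w * f y (Z w) \<partial>M) has_derivative (\<lambda>h. h \<bullet> (\<integral>w. k w *\<^sub>R F y0 (Z w) \<partial>M))) (at y0)"
  unfolding has_derivative_within_alt
proof (intro conjI allI impI)
  show "bounded_linear (\<lambda>h. h \<bullet> (\<integral>w. k w *\<^sub>R F y0 (Z w) \<partial>M))" by (rule bounded_linear_inner_left)
  fix \<epsilon> :: real assume \<epsilon>: "0 < \<epsilon>"
  have fS: "continuous_on S (f y)" if "y \<in> B" for y
    by (rule continuous_on_compose2[OF f, of _ "\<lambda>z. (y, z)", simplified]) (use that in \<open>auto intro!: continuous_intros\<close>)
  have FS: "continuous_on S (F y)" if "y \<in> B" for y
    by (rule continuous_on_compose2[OF F, of _ "\<lambda>z. (y, z)", simplified]) (use that in \<open>auto intro!: continuous_intros\<close>)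
  define I where "I = (\<integral>w. \<bar>k w\<bar> \<partial>M)"
  have I: "0 \<le> I" unfolding I_def by simp
  define e where "e = \<epsilon> / (I + 1)"
  have e: "0 < e" "e * I \<le> \<epsilon>" using \<epsilon> I by (auto simp: e_def field_simps add_pos_nonneg)
  obtain d where d: "0 < d" "ball y0 d \<subseteq> B"
      and Fd: "\<And>y z. y \<in> ball y0 d \<Longrightarrow> z \<in> S \<Longrightarrow> dist (F y z) (F y0 z) < e"
    using uniform_on_compact_parameter[OF B S F y0 e(1)] by metis
  have if1: "integrable M (\<lambda>w. k w * f y (Z w))" if "y \<in> B" for y
    using integrable_compact_parameter[OF fS[OF that]] by simp
  have iF: "integrable M (\<lambda>w. k w *\<^sub>R F y0 (Z w))"
    by (rule integrable_compact_parameter[OF FS[OF y0]])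
  show "\<exists>d>0. \<forall>y\<in>UNIV. norm (y - y0) < d \<longrightarrow>
      norm ((\<integral>w. k w * f y (Z w) \<partial>M) - (\<integral>w. k w * f y0 (Z w) \<partial>M) - (y - y0) \<bullet> (\<integral>w. k w *\<^sub>R F y0 (Z w) \<partial>M)) \<le> \<epsilon> * norm (y - y0)"
  proof (intro exI[of _ d] conjI ballI impI d(1))
    fix y assume "norm (y - y0) < d"
    then have y: "y \<in> ball y0 d" by (simp add: dist_norm norm_minus_commute)
    then have yB: "y \<in> B" using d by auto
    \<comment> \<open>The mean value inequality on the segment from y0 to y bounds the linearization
      error by a constant that is the same for all z in S, so the bound can be integrated against
      |k|.\<close>
    have pt: "norm (f y z - f y0 z - (y - y0) \<bullet> F y0 z) \<le> norm (y - y0) * e" if z: "z \<in> S" for z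
    proof (rule differentiable_bound_linearization[where S = "ball y0 d" and f' = "\<lambda>y h. h \<bullet> F y z"])
      show "y0 + t *\<^sub>R (y - y0) \<in> ball y0 d" if "t \<in> {0..1}" for t
      proof -
        have "norm (t *\<^sub>R (y - y0)) \<le> norm (y - y0)" using that by (simp add: mult_left_le_one_le)
        then show ?thesis using y by (simp add: dist_norm norm_minus_commute)
      qed
      show "((\<lambda>y. f y z) has_derivative (\<lambda>h. h \<bullet> F x z)) (at x within ball y0 d)" if "x \<in> ball y0 d" for x
        using der that z d by (blast intro: has_derivative_at_withinI)
      show "onorm ((\<lambda>h. h \<bullet> F x z) - (\<lambda>h. h \<bullet> F y0 z)) \<le> e" if "x \<in> ball y0 d" for x
      proof (rule onorm_bound)
        fix h
        have "norm (h \<bullet> (F x z - F y0 z)) \<le> norm h * norm (F x z - F y0 z)"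
          by (simp add: Cauchy_Schwarz_ineq2)
        also have "\<dots> \<le> norm h * e" using Fd[OF that z] by (intro mult_left_mono) (auto simp: dist_norm)
        finally show "norm (((\<lambda>h. h \<bullet> F x z) - (\<lambda>h. h \<bullet> F y0 z)) h) \<le> e * norm h"
          by (simp add: inner_diff_right mult.commute)
      qed (use e in simp)
      show "y0 \<in> ball y0 d" using d by simp
    qed
    have "(y - y0) \<bullet> (\<integral>w. k w *\<^sub>R F y0 (Z w) \<partial>M) = (\<integral>w. (y - y0) \<bullet> (k w *\<^sub>R F y0 (Z w)) \<partial>M)"
      by (rule integral_inner_right[symmetric]) (use iF in simp)
    then have "(\<integral>w. k w * f y (Z w) \<partial>M) - (\<integral>w. k w * f y0 (Z w) \<partial>M) - (y - y0) \<bullet> (\<integral>w. k w *\<^sub>R F y0 (Z w) \<partial>M)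
        = (\<integral>w. k w * f y (Z w) - k w * f y0 (Z w) - (y - y0) \<bullet> (k w *\<^sub>R F y0 (Z w)) \<partial>M)"
      by (simp only:) (subst Bochner_Integration.integral_diff; (intro Bochner_Integration.integrable_diff if1 yB y0 integrable_inner_right iF)?;
         simp add: Bochner_Integration.integral_diff if1 yB y0)
    also have "norm \<dots> \<le> (\<integral>w. (norm (y - y0) * e) * \<bar>k w\<bar> \<partial>M)"
    proof (rule Bochner_Integration.integral_norm_bound_integral)
      show "integrable M (\<lambda>w. k w * f y (Z w) - k w * f y0 (Z w) - (y - y0) \<bullet> (k w *\<^sub>R F y0 (Z w)))"
        by (intro Bochner_Integration.integrable_diff if1 yB y0 integrable_inner_right iF)
      show "norm (k w * f y (Z w) - k w * f y0 (Z w) - (y - y0) \<bullet> (k w *\<^sub>R F y0 (Z w))) \<le> (norm (y - y0) * e) * \<bar>k w\<bar>"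
        if "w \<in> space M" for w
      proof -
        have "k w * f y (Z w) - k w * f y0 (Z w) - (y - y0) \<bullet> (k w *\<^sub>R F y0 (Z w))
           = k w * (f y (Z w) - f y0 (Z w) - (y - y0) \<bullet> F y0 (Z w))" by (simp add: algebra_simps)
        then show ?thesis using mult_right_mono[OF pt[OF ZS[OF that]], of "\<bar>k w\<bar>"]
          by (simp add: abs_mult mult.commute)
      qed
    qed (use k in auto)
    also have "\<dots> = norm (y - y0) * (e * I)" unfolding I_def by simp
    also have "\<dots> \<le> norm (y - y0) * \<epsilon>" using e by (intro mult_left_mono) auto
    finally show "norm ((\<integral>w. k w * f y (Z w) \<partial>M) - (\<integral>w. k w * f y0 (Z w) \<partial>M) - (y - y0) \<bullet> (\<integral>w. k w *\<^sub>R F y0 (Z w) \<partial>M)) \<le> \<epsilon> * norm (y - y0)"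
      by (simp add: mult.commute)
  qed
qed

end

section \<open>Powers of the distance and the fundamental solution\<close>

lemma has_derivative_dist_powr:
  fixes y z :: "'a::real_inner"
  assumes "y \<noteq> z"
  shows "((\<lambda>y. ((y - z) \<bullet> (y - z)) powr b) has_derivative (\<lambda>h. h \<bullet> ((2 * b * ((y - z) \<bullet> (y - z)) powr (b - 1)) *\<^sub>R (y - z)))) (at y)"
proof -
  have pos: "0 < (y - z) \<bullet> (y - z)" using assms by simp
  have "((\<lambda>y. (y - z) \<bullet> (y - z)) has_derivative (\<lambda>h. 2 * (h \<bullet> (y - z)))) (at y)"
    by (auto intro!: derivative_eq_intros simp: inner_commute)
  moreover have "((\<lambda>t. t powr b) has_derivative (\<lambda>h. b * ((y - z) \<bullet> (y - z)) powr (b - 1) * h)) (at ((y - z) \<bullet> (y - z)))"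
    using has_real_derivative_powr[OF pos, of b] by (simp add: has_field_derivative_def)
  ultimately have "(((\<lambda>t. t powr b) \<circ> (\<lambda>y. (y - z) \<bullet> (y - z))) has_derivative
      ((\<lambda>h. b * ((y - z) \<bullet> (y - z)) powr (b - 1) * h) \<circ> (\<lambda>h. 2 * (h \<bullet> (y - z))))) (at y)"
    by (rule diff_chain_at)
  then show ?thesis by (simp add: o_def mult_ac)
qed

lemma has_derivative_vec_nth_inner: "((\<lambda>y. y $ i - c) has_derivative (\<lambda>h. h \<bullet> axis i 1)) (at y)"
  by (auto intro!: derivative_eq_intros bounded_linear_imp_has_derivative bounded_linear_vec_nth simp: inner_axis)

lemma has_derivative_inner_mult:
  fixes f g :: "'a::real_inner \<Rightarrow> real"
  assumes "(f has_derivative (\<lambda>h. h \<bullet> u)) (at y)" "(g has_derivative (\<lambda>h. h \<bullet> v)) (at y)"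
  shows "((\<lambda>y. f y * g y) has_derivative (\<lambda>h. h \<bullet> (g y *\<^sub>R u + f y *\<^sub>R v))) (at y)"
  using has_derivative_mult[OF assms] by (simp add: inner_add_right algebra_simps)

lemma has_derivative_inner_cmult:
  fixes f :: "'a::real_inner \<Rightarrow> real"
  assumes "(f has_derivative (\<lambda>h. h \<bullet> u)) (at y)"
  shows "((\<lambda>y. c * f y) has_derivative (\<lambda>h. h \<bullet> (c *\<^sub>R u))) (at y)"
  using has_derivative_mult_right[OF assms, of c] by simp

lemma has_derivative_inner_add:
  fixes f g :: "'a::real_inner \<Rightarrow> real"
  assumes "(f has_derivative (\<lambda>h. h \<bullet> u)) (at y)" "(g has_derivative (\<lambda>h. h \<bullet> v)) (at y)"
  shows "((\<lambda>y. f y + g y) has_derivative (\<lambda>h. h \<bullet> (u + v))) (at y)"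
  using has_derivative_add[OF assms] by (simp add: inner_add_right)

text \<open>The function is |y - z|^(2-n), for n >= 3 a multiple of the Newtonian kernel with pole
  z. With exponent b of the squared distance, the Laplacian carries the factor n + 2 (b - 1), which
  vanishes for b = 1 - n/2.\<close>

lemma harmonic_on_dist_powr:
  fixes z :: "real ^ 'n::finite"
  assumes S: "open S" and z: "z \<notin> S"
  shows "harmonic_on S (\<lambda>y. ((y - z) \<bullet> (y - z)) powr (1 - CARD('n) / 2))"
proof -
  define b where "b = 1 - real CARD('n) / 2"
  define q where "q y = (y - z) \<bullet> (y - z)" for y
  define g where "g y = (2 * b * q y powr (b - 1)) *\<^sub>R (y - z)" for y
  define H where "H i y = (y $ i - z $ i) *\<^sub>R (2 * b) *\<^sub>R (2 * (b - 1) * q y powr (b - 1 - 1)) *\<^sub>R (y - z)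
      + (2 * b * q y powr (b - 1)) *\<^sub>R axis i 1" for i y
  have ne: "y \<noteq> z" "q y \<noteq> 0" "0 < q y" if "y \<in> S" for y using that z by (auto simp: q_def)
  have q: "((\<lambda>y. q y powr c) has_derivative (\<lambda>h. h \<bullet> ((2 * c * q y powr (c - 1)) *\<^sub>R (y - z)))) (at y)" if "y \<in> S" for y c
    unfolding q_def by (rule has_derivative_dist_powr[OF ne(1)[OF that]])
  have f: "((\<lambda>y. q y powr b) has_derivative (\<lambda>h. h \<bullet> g y)) (at y)" if "y \<in> S" for y
    unfolding g_def by (rule q[OF that])
  have gi: "((\<lambda>y. g y $ i) has_derivative (\<lambda>h. h \<bullet> H i y)) (at y)" if "y \<in> S" for y i
    unfolding g_def H_def vector_scaleR_component vector_minus_component real_scaleR_def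
    by (intro has_derivative_inner_mult has_derivative_inner_cmult has_derivative_vec_nth_inner q that)
  have Hc: "continuous_on S (H i)" for i
    unfolding H_def q_def using ne by (intro continuous_intros) (auto simp: q_def)
  have "C2_on S (\<lambda>y. q y powr b)"
    by (rule C2_onI[OF S f gi Hc])
  moreover have "laplacian (\<lambda>y. q y powr b) y = 0" if y: "y \<in> S" for y
  proof -
    have "laplacian (\<lambda>y. q y powr b) y = (\<Sum>i\<in>UNIV. H i y $ i)"
      by (rule laplacian_eq[OF S f gi Hc y])
    also have "\<dots> = (\<Sum>i\<in>UNIV. 2 * b * q y powr (b - 1) + 2 * b * (2 * (b - 1) * q y powr (b - 1 - 1)) * ((y - z) $ i * (y - z) $ i))"
      unfolding H_def by (intro sum.cong) (auto simp: axis_def algebra_simps)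
    also have "\<dots> = CARD('n) * (2 * b * q y powr (b - 1)) + 2 * b * (2 * (b - 1) * q y powr (b - 1 - 1)) * q y"
      by (simp add: sum.distrib q_def inner_vec_def flip: sum_distrib_left)
    also have "\<dots> = 2 * b * (q y powr (b - 1)) * (CARD('n) + 2 * (b - 1))"
      using ne(3)[OF y] powr_add[of "q y" "b - 1 - 1" 1] by (simp add: algebra_simps)
    also have "\<dots> = 0" unfolding b_def by simp
    finally show ?thesis .
  qed
  ultimately show ?thesis unfolding harmonic_on_def q_def b_def by blast
qed

subsection \<open>The Poisson kernel\<close>

text \<open>The classical kernel (1 - |y|^2) / |y - z|^n without the factor given by the area of the
  sphere. That factor is absorbed into the constant c of the integral identities.\<close>

definition poisson :: "real ^ 'n::finite \<Rightarrow> real ^ 'n \<Rightarrow> real" where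
  "poisson y z = (1 - y \<bullet> y) * ((y - z) \<bullet> (y - z)) powr (- (CARD('n) / 2))"

text \<open>Left in the shape produced by the product rule and
  \<open>has_derivative_dist_powr\<close>, so that the derivative follows from the rules without
  simplification.\<close>

definition poisson_grad :: "real ^ 'n::finite \<Rightarrow> real ^ 'n \<Rightarrow> real ^ 'n" where
  "poisson_grad y z = ((y - z) \<bullet> (y - z)) powr (- (CARD('n) / 2)) *\<^sub>R (- 2 *\<^sub>R y)
     + (1 - y \<bullet> y) *\<^sub>R (2 * (- (CARD('n) / 2)) * ((y - z) \<bullet> (y - z)) powr (- (CARD('n) / 2) - 1)) *\<^sub>R (y - z)"

lemma ball_sphere_neq: "y \<in> ball 0 1 \<Longrightarrow> z \<in> sphere 0 1 \<Longrightarrow> y \<noteq> z" for y :: "'a::real_normed_vector"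
  by auto

lemma dist_ball_sphere_neq_0:
  "p \<in> ball 0 1 \<times> sphere 0 1 \<Longrightarrow> (fst p - snd p) \<bullet> (fst p - snd p) \<noteq> 0" for p :: "'a::real_inner \<times> 'a"
  by (auto simp: ball_sphere_neq)

lemma has_derivative_one_minus_inner_self:
  "((\<lambda>y. 1 - y \<bullet> y) has_derivative (\<lambda>h. h \<bullet> (- 2 *\<^sub>R y))) (at (y::'a::real_inner))"
  by (auto intro!: derivative_eq_intros simp: inner_commute)

lemma poisson_has_derivative:
  assumes "y \<in> ball 0 1" "z \<in> sphere 0 1"
  shows "((\<lambda>y. poisson y z) has_derivative (\<lambda>h. h \<bullet> poisson_grad y z)) (at y)"
  unfolding poisson_def poisson_grad_def
  by (intro has_derivative_inner_mult has_derivative_one_minus_inner_self has_derivative_dist_powr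
      ball_sphere_neq[OF assms])

lemma poisson_nonneg: "y \<in> ball 0 1 \<Longrightarrow> 0 \<le> poisson y z"
  unfolding poisson_def
  by (intro mult_nonneg_nonneg) (auto simp: dot_square_norm power_le_one)

lemma continuous_on_poisson: "continuous_on (ball 0 1 \<times> sphere 0 1) (\<lambda>(y, z). poisson y z)"
  unfolding poisson_def split_beta by (intro continuous_intros ballI disjI1 dist_ball_sphere_neq_0)

lemma continuous_on_poisson_grad: "continuous_on (ball 0 1 \<times> sphere 0 1) (\<lambda>(y, z). poisson_grad y z)"
  unfolding poisson_grad_def split_beta by (intro continuous_intros ballI disjI1 dist_ball_sphere_neq_0)

text \<open>\<open>H i y z\<close> is the i-th row of the Hessian of the kernel in y, and the last
  clause says that its trace, the Laplacian, is zero. The explicit rows stay hidden because later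
  arguments use only these three facts.\<close>

lemma poisson_second_derivative:
  obtains H :: "'n::finite \<Rightarrow> real ^ 'n \<Rightarrow> real ^ 'n \<Rightarrow> real ^ 'n"
  where "\<And>i y z. y \<in> ball 0 1 \<Longrightarrow> z \<in> sphere 0 1 \<Longrightarrow>
      ((\<lambda>y. poisson_grad y z $ i) has_derivative (\<lambda>h. h \<bullet> H i y z)) (at y)"
    and "\<And>i. continuous_on (ball 0 1 \<times> sphere 0 1) (\<lambda>(y, z). H i y z)"
    and "\<And>y z. y \<in> ball 0 1 \<Longrightarrow> z \<in> sphere 0 1 \<Longrightarrow> (\<Sum>i\<in>UNIV. H i y z $ i) = 0"
proof -
  define b where "b = - (real CARD('n) / 2)"
  define q :: "real^'n \<Rightarrow> real^'n \<Rightarrow> real" where "q y z = (y - z) \<bullet> (y - z)" for y z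
  define Q where "Q c y z = (2 * c * q y z powr (c - 1)) *\<^sub>R (y - z)" for c y z
  define H where "H i y z = ((- 2 * y $ i) *\<^sub>R Q b y z + q y z powr b *\<^sub>R (- 2) *\<^sub>R axis i 1)
     + ((2 * b * q y z powr (b - 1) * (y $ i - z $ i)) *\<^sub>R (- 2 *\<^sub>R y)
        + (1 - y \<bullet> y) *\<^sub>R ((y $ i - z $ i) *\<^sub>R (2 * b) *\<^sub>R Q (b - 1) y z + (2 * b * q y z powr (b - 1)) *\<^sub>R axis i 1))" for i y z
  have ne: "y \<noteq> z" "q y z \<noteq> 0" "0 < q y z" if "y \<in> ball 0 1" "z \<in> sphere 0 1" for y z
    using ball_sphere_neq[OF that] by (auto simp: q_def)
  have q: "((\<lambda>y. q y z powr c) has_derivative (\<lambda>h. h \<bullet> Q c y z)) (at y)" if "y \<in> ball 0 1" "z \<in> sphere 0 1" for y z c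
    unfolding q_def Q_def by (rule has_derivative_dist_powr[OF ne(1)[OF that]])
  have nth: "((\<lambda>y::real^'n. y $ i) has_derivative (\<lambda>h. h \<bullet> axis i 1)) (at y)" for i y
    using has_derivative_vec_nth_inner[of i 0 y] by simp
  show thesis
  proof
    show "((\<lambda>y. poisson_grad y z $ i) has_derivative (\<lambda>h. h \<bullet> H i y z)) (at y)"
      if "y \<in> ball 0 1" "z \<in> sphere 0 1" for i y z
    proof -
      have "((\<lambda>y. q y z powr b * (- 2 * y $ i)) has_derivative
          (\<lambda>h. h \<bullet> ((- 2 * y $ i) *\<^sub>R Q b y z + q y z powr b *\<^sub>R (- 2) *\<^sub>R axis i 1))) (at y)"
        by (rule has_derivative_inner_mult[OF q[OF that] has_derivative_inner_cmult[OF nth]])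
      moreover have "((\<lambda>y. (2 * b) * q y z powr (b - 1) * (y $ i - z $ i)) has_derivative
          (\<lambda>h. h \<bullet> ((y $ i - z $ i) *\<^sub>R (2 * b) *\<^sub>R Q (b - 1) y z + (2 * b * q y z powr (b - 1)) *\<^sub>R axis i 1))) (at y)"
        by (rule has_derivative_inner_mult[OF has_derivative_inner_cmult[OF q[OF that]] has_derivative_vec_nth_inner])
      ultimately have "((\<lambda>y. q y z powr b * (- 2 * y $ i) + (1 - y \<bullet> y) * ((2 * b) * q y z powr (b - 1) * (y $ i - z $ i)))
          has_derivative (\<lambda>h. h \<bullet> H i y z)) (at y)"
        unfolding H_def
        by (rule has_derivative_inner_add[OF _ has_derivative_inner_mult[OF has_derivative_one_minus_inner_self]])
      moreover have "poisson_grad y z $ i = q y z powr b * (- 2 * y $ i) + (1 - y \<bullet> y) * ((2 * b) * q y z powr (b - 1) * (y $ i - z $ i))" for y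
        by (simp only: poisson_grad_def b_def q_def vector_scaleR_component vector_minus_component vector_add_component real_scaleR_def)
      ultimately show ?thesis by (simp only:)
    qed
    show "continuous_on (ball 0 1 \<times> sphere 0 1) (\<lambda>(y, z). H i y z)" for i
      unfolding H_def Q_def q_def split_beta by (intro continuous_intros ballI disjI1 dist_ball_sphere_neq_0)
    show "(\<Sum>i\<in>UNIV. H i y z $ i) = 0" if yz: "y \<in> ball 0 1" "z \<in> sphere 0 1" for y z
    proof -
      have zz: "z \<bullet> z = 1" using yz(2) by (simp add: dot_square_norm)
      define A where "A = q y z powr (b - 1)"
      have qA: "q y z powr b = q y z * A" "A = q y z * q y z powr (b - 1 - 1)"
        using ne(3)[OF yz] powr_add[of "q y z" "b - 1" 1] powr_add[of "q y z" "b - 1 - 1" 1]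
        by (simp_all add: A_def mult.commute)
      have "H i y z $ i = - 8 * b * A * (y $ i * (y - z) $ i) - 2 * (q y z * A)
          + (1 - y \<bullet> y) * (4 * b * (b - 1) * q y z powr (b - 1 - 1)) * ((y - z) $ i * (y - z) $ i) + (1 - y \<bullet> y) * (2 * b * A)" for i
        unfolding H_def Q_def A_def[symmetric] qA(1) by (simp add: axis_def algebra_simps)
      then have "(\<Sum>i\<in>UNIV. H i y z $ i) = - 8 * b * A * (y \<bullet> (y - z)) - CARD('n) * (2 * (q y z * A))
          + (1 - y \<bullet> y) * (4 * b * (b - 1) * q y z powr (b - 1 - 1)) * q y z + CARD('n) * ((1 - y \<bullet> y) * (2 * b * A))"
        by (simp add: sum.distrib sum_subtractf sum_negf q_def inner_vec_def flip: sum_distrib_left)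
      also have "\<dots> = - 8 * b * A * (y \<bullet> (y - z)) + 2 * b * (2 * (q y z * A))
          + (1 - y \<bullet> y) * (4 * b * (b - 1)) * A - 2 * b * ((1 - y \<bullet> y) * (2 * b * A))"
        by (subst (3) qA(2)) (simp add: b_def)
      also have "\<dots> = - 4 * b * A * (2 * (y \<bullet> (y - z)) - q y z + (1 - y \<bullet> y))"
        by (simp add: algebra_simps)
      \<comment> \<open>The bracket expands to 1 - |z|^2, so the Laplacian vanishes because z lies
        on the unit sphere.\<close>
      also have "2 * (y \<bullet> (y - z)) - q y z + (1 - y \<bullet> y) = 0"
        unfolding q_def using zz by (simp add: algebra_simps inner_commute)
      finally show ?thesis by simp
    qed
  qed
qed

lemma
  fixes M :: "'w::euclidean_space measure" and Z :: "'w \<Rightarrow> real ^ 'n::finite"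
  assumes Z: "Z \<in> borel_measurable M" "\<And>w. w \<in> space M \<Longrightarrow> Z w \<in> sphere 0 1" and k: "integrable M k"
  shows harmonic_on_poisson_integral: "harmonic_on (ball 0 1) (\<lambda>y. \<integral>w. k w * poisson y (Z w) \<partial>M)"
    and grad_poisson_integral: "y \<in> ball 0 1 \<Longrightarrow>
      grad (\<lambda>y. \<integral>w. k w * poisson y (Z w) \<partial>M) y = (\<integral>w. k w *\<^sub>R poisson_grad y (Z w) \<partial>M)"
proof -
  let ?B = "ball (0::real^'n) 1" and ?S = "sphere (0::real^'n) 1"
  let ?U = "\<lambda>y. \<integral>w. k w * poisson y (Z w) \<partial>M"
  obtain H :: "'n \<Rightarrow> real^'n \<Rightarrow> real^'n \<Rightarrow> real^'n"
    where H: "\<And>i y z. y \<in> ?B \<Longrightarrow> z \<in> ?S \<Longrightarrow> ((\<lambda>y. poisson_grad y z $ i) has_derivative (\<lambda>h. h \<bullet> H i y z)) (at y)"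
      and Hc: "\<And>i. continuous_on (?B \<times> ?S) (\<lambda>(y, z). H i y z)"
      and H0: "\<And>y z. y \<in> ?B \<Longrightarrow> z \<in> ?S \<Longrightarrow> (\<Sum>i\<in>UNIV. H i y z $ i) = 0"
    by (rule poisson_second_derivative) (rule that; assumption)
  note par = compact_sphere Z k
  have slice: "continuous_on ?S (g y)" if "continuous_on (?B \<times> ?S) (\<lambda>(y, z). g y z)" "y \<in> ?B"
    for g :: "real^'n \<Rightarrow> real^'n \<Rightarrow> real^'n" and y
    by (rule continuous_on_compose2[OF that(1), of _ "\<lambda>z. (y, z)", simplified]) (use that in \<open>auto intro!: continuous_intros\<close>)
  have comp: "(\<integral>w. k w *\<^sub>R g (Z w) \<partial>M) $ i = (\<integral>w. k w * g (Z w) $ i \<partial>M)"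
    if "continuous_on ?S g" for g :: "real^'n \<Rightarrow> real^'n" and i
    using integral_bounded_linear[OF bounded_linear_vec_nth integrable_compact_parameter[OF par that]] by simp
  have d1: "(?U has_derivative (\<lambda>h. h \<bullet> (\<integral>w. k w *\<^sub>R poisson_grad y (Z w) \<partial>M))) (at y)" if "y \<in> ?B" for y
    by (rule has_derivative_parametric_integral[OF par open_ball continuous_on_poisson continuous_on_poisson_grad
        poisson_has_derivative that])
  have d2: "((\<lambda>y. (\<integral>w. k w *\<^sub>R poisson_grad y (Z w) \<partial>M) $ i) has_derivative (\<lambda>h. h \<bullet> (\<integral>w. k w *\<^sub>R H i y (Z w) \<partial>M))) (at y)"
    if y: "y \<in> ?B" for i y
  proof (rule has_derivative_transform_within_open[OF _ open_ball y])
    have "continuous_on (?B \<times> ?S) (\<lambda>(y, z). poisson_grad y z $ i)"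
      using continuous_on_component[OF continuous_on_poisson_grad, of i] by (simp add: split_beta)
    then show "((\<lambda>y. \<integral>w. k w * poisson_grad y (Z w) $ i \<partial>M) has_derivative (\<lambda>h. h \<bullet> (\<integral>w. k w *\<^sub>R H i y (Z w) \<partial>M))) (at y)"
      by (intro has_derivative_parametric_integral[where f = "\<lambda>y z. poisson_grad y z $ i" and F = "H i", OF par open_ball _ Hc H y])
    show "(\<integral>w. k w * poisson_grad y (Z w) $ i \<partial>M) = (\<integral>w. k w *\<^sub>R poisson_grad y (Z w) \<partial>M) $ i" if "y \<in> ?B" for y
      by (rule comp[symmetric, OF slice[OF continuous_on_poisson_grad that]])
  qed
  have c2: "continuous_on ?B (\<lambda>y. \<integral>w. k w *\<^sub>R H i y (Z w) \<partial>M)" for i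
    by (rule continuous_on_parametric_integral[OF par open_ball Hc])
  have "laplacian ?U y = 0" if y: "y \<in> ?B" for y
  proof -
    have "laplacian ?U y = (\<Sum>i\<in>UNIV. (\<integral>w. k w *\<^sub>R H i y (Z w) \<partial>M) $ i)"
      by (rule laplacian_eq[OF open_ball d1 d2 c2 y])
    also have "\<dots> = (\<Sum>i\<in>UNIV. \<integral>w. k w * H i y (Z w) $ i \<partial>M)"
      by (simp add: comp slice[OF Hc y])
    also have "\<dots> = (\<integral>w. (\<Sum>i\<in>UNIV. k w * H i y (Z w) $ i) \<partial>M)"
    proof (rule Bochner_Integration.integral_sum[symmetric])
      fix i
      show "integrable M (\<lambda>w. k w * H i y (Z w) $ i)"
        using integrable_bounded_linear[OF bounded_linear_vec_nth integrable_compact_parameter[OF par slice[OF Hc y]]] by simp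
    qed
    also have "\<dots> = (\<integral>w. 0 \<partial>M)"
      by (rule Bochner_Integration.integral_cong[OF refl]) (simp add: H0[OF y Z(2)] flip: sum_distrib_left)
    finally show ?thesis by simp
  qed
  then show "harmonic_on ?B ?U"
    unfolding harmonic_on_def using C2_onI[OF open_ball d1 d2 c2] by blast
  show "y \<in> ?B \<Longrightarrow> grad ?U y = (\<integral>w. k w *\<^sub>R poisson_grad y (Z w) \<partial>M)"
    by (rule grad_eq[OF d1])
qed

lemma harmonic_on_linear_combination:
  fixes f g :: "real ^ 'n::finite \<Rightarrow> real"
  assumes S: "open S" and f: "harmonic_on S f" and g: "harmonic_on S g"
  shows "harmonic_on S (\<lambda>x. a * f x + b * g x)"
proof -
  have C: "C2_on S f" "C2_on S g" using f g by (auto simp: harmonic_on_def)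
  let ?h = "\<lambda>x. a * f x + b * g x"
  let ?D = "\<lambda>x. a *\<^sub>R grad f x + b *\<^sub>R grad g x"
  let ?H = "\<lambda>i x. a *\<^sub>R grad (partial i f) x + b *\<^sub>R grad (partial i g) x"
  have d1: "(?h has_derivative (\<lambda>h. h \<bullet> ?D x)) (at x)" if "x \<in> S" for x
    by (intro has_derivative_inner_add has_derivative_inner_cmult C2_on_has_derivative[OF C(1) that] C2_on_has_derivative[OF C(2) that])
  have d2: "((\<lambda>x. ?D x $ i) has_derivative (\<lambda>h. h \<bullet> ?H i x)) (at x)" if "x \<in> S" for x i
    unfolding vector_add_component vector_scaleR_component real_scaleR_def
    by (intro has_derivative_inner_add has_derivative_inner_cmult C2_on_grad_has_derivative[OF C(1) that] C2_on_grad_has_derivative[OF C(2) that])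
  have "continuous_on S (grad (partial i f))" "continuous_on S (grad (partial i g))" for i
    using C unfolding C2_on_def grad_def by (auto intro!: continuous_intros)
  then have c2: "continuous_on S (?H i)" for i
    by (intro continuous_intros)
  have "laplacian ?h x = 0" if x: "x \<in> S" for x
  proof -
    have "laplacian ?h x = a * laplacian f x + b * laplacian g x"
      by (subst laplacian_eq[OF S d1 d2 c2 x]) (simp_all add: laplacian_def grad_def sum.distrib sum_distrib_left)
    then show ?thesis using f g x by (simp add: harmonic_on_def)
  qed
  then show ?thesis unfolding harmonic_on_def using C2_onI[OF S d1 d2 c2] by blast
qed

text \<open>The hypothesis \<open>norm\<close> makes J an approximate identity: for y near the
  sphere, points Z w close to y see almost the value U y, and elsewhere the factor 1 - |y|^2 makes
  the kernel small. Hence the integral minus c U is harmonic with limit 0 at the sphere, and it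
  vanishes. Nothing else about the distribution of Z is used.\<close>

lemma poisson_representation:
  fixes M :: "'w::euclidean_space measure" and Z :: "'w \<Rightarrow> real ^ 'n::finite" and U :: "real ^ 'n \<Rightarrow> real"
  assumes Z: "Z \<in> borel_measurable M" "\<And>w. w \<in> space M \<Longrightarrow> Z w \<in> sphere 0 1"
    and J: "integrable M J" "\<And>w. w \<in> space M \<Longrightarrow> 0 \<le> J w"
    and norm: "\<And>y. y \<in> ball 0 1 \<Longrightarrow> (\<integral>w. J w * poisson y (Z w) \<partial>M) = c"
    and U: "harmonic_on (ball 0 1) U" "continuous_on (cball 0 1) U" and y: "y \<in> ball 0 1"
  shows "(\<integral>w. J w * U (Z w) * poisson y (Z w) \<partial>M) = c * U y"
proof -
  let ?B = "ball (0::real^'n) 1" and ?S = "sphere (0::real^'n) 1"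
  define V where "V y = (\<integral>w. J w * U (Z w) * poisson y (Z w) \<partial>M)" for y
  have US: "continuous_on ?S U" by (rule continuous_on_subset[OF U(2)]) auto
  have JU: "integrable M (\<lambda>w. J w * U (Z w))"
    using integrable_compact_parameter[OF compact_sphere Z J(1) US] by simp
  have PS: "continuous_on ?S (poisson y)" if "y \<in> ?B" for y
    by (rule continuous_on_compose2[OF continuous_on_poisson, of _ "\<lambda>z. (y, z)", simplified]) (use that in \<open>auto intro!: continuous_intros\<close>)
  have iJUP: "integrable M (\<lambda>w. J w * U (Z w) * poisson y (Z w))" if "y \<in> ?B" for y
    using integrable_compact_parameter[OF compact_sphere Z JU PS[OF that]] by simp
  have iJP: "integrable M (\<lambda>w. J w * poisson y (Z w))" if "y \<in> ?B" for y
    using integrable_compact_parameter[OF compact_sphere Z J(1) PS[OF that]] by simp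
  have Vh: "harmonic_on ?B V"
    unfolding V_def by (rule harmonic_on_poisson_integral[OF Z JU])
  have c0: "0 \<le> c"
    using J(2) poisson_nonneg[of 0] by (subst norm[of 0, symmetric]) (auto intro!: Bochner_Integration.integral_nonneg mult_nonneg_nonneg)
  define I where "I = (\<integral>w. J w \<partial>M)"
  have I0: "0 \<le> I" unfolding I_def using J(2) by (intro Bochner_Integration.integral_nonneg)
  obtain K where K: "\<And>y. y \<in> cball 0 1 \<Longrightarrow> \<bar>U y\<bar> \<le> K" "0 \<le> K"
  proof -
    obtain K where "\<forall>v\<in>U ` cball 0 1. norm v \<le> K"
      using compact_imp_bounded[OF compact_continuous_image[OF U(2) compact_cball]] unfolding bounded_iff by blast
    then have "\<And>y. y \<in> cball 0 1 \<Longrightarrow> norm (U y) \<le> K" by blast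
    then show thesis using that[of "\<bar>K\<bar>"] by (metis abs_ge_self abs_ge_zero order_trans real_norm_def)
  qed
  have bound: "\<exists>r<1. \<forall>y. r < norm y \<and> norm y < 1 \<longrightarrow> \<bar>V y - c * U y\<bar> \<le> \<epsilon>" if \<epsilon>: "0 < \<epsilon>" for \<epsilon>
  proof -
    define \<eta> where "\<eta> = \<epsilon> / (2 * (c + 1))"
    have \<eta>: "0 < \<eta>" "\<eta> * c \<le> \<epsilon> / 2" using \<epsilon> c0 by (auto simp: \<eta>_def field_simps)
    have "uniformly_continuous_on (cball 0 1) U"
      by (rule compact_uniformly_continuous[OF U(2) compact_cball])
    then obtain d where d: "0 < d" and Ud: "\<And>y z. y \<in> cball 0 1 \<Longrightarrow> z \<in> cball 0 1 \<Longrightarrow> dist z y < d \<Longrightarrow> \<bar>U z - U y\<bar> < \<eta>"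
      unfolding uniformly_continuous_on_def using \<eta>(1) by (metis dist_real_def)
    \<comment> \<open>Bounds the singular factor of the kernel at distance at least d from y, where
      2 K is the available bound for the oscillation of U.\<close>
    define D where "D = (d\<^sup>2) powr (- (CARD('n) / 2))"
    have D0: "0 \<le> D" by (simp add: D_def)
    define N where "N = 2 * K * D * I"
    have N0: "0 \<le> N" using K D0 I0 by (simp add: N_def)
    \<comment> \<open>Chosen so that |y| > r gives N (1 - |y|^2) <= 2 N (1 - r) <= \<epsilon>/2. The
      other half of \<epsilon> is \<eta> c.\<close>
    define r where "r = 1 - \<epsilon> / (4 * (N + 1))"
    have r: "r < 1" using \<epsilon> N0 by (simp add: r_def)
    have "\<bar>V y - c * U y\<bar> \<le> \<epsilon>" if ry: "r < norm y" and y1: "norm y < 1" for y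
    proof -
      have y: "y \<in> ?B" using y1 by simp
      have yy: "0 \<le> 1 - y \<bullet> y" "1 - y \<bullet> y \<le> 2 * (1 - r)"
      proof -
        have "1 - y \<bullet> y = (1 - norm y) * (1 + norm y)"
          by (simp add: dot_square_norm power2_eq_square algebra_simps)
        then show "0 \<le> 1 - y \<bullet> y" "1 - y \<bullet> y \<le> 2 * (1 - r)"
          using y1 ry mult_mono[of "1 - norm y" "1 - r" "1 + norm y" 2] by auto
      qed
      have eq: "V y - c * U y = (\<integral>w. J w * U (Z w) * poisson y (Z w) - U y * (J w * poisson y (Z w)) \<partial>M)"
        unfolding V_def by (subst Bochner_Integration.integral_diff)
          (use iJUP[OF y] iJP[OF y] norm[OF y] in \<open>auto simp: mult.commute\<close>)
      have "norm (V y - c * U y) \<le> (\<integral>w. \<eta> * (J w * poisson y (Z w)) + (2 * K * (1 - y \<bullet> y) * D) * J w \<partial>M)"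
        unfolding eq
      proof (rule Bochner_Integration.integral_norm_bound_integral)
        fix w assume w: "w \<in> space M"
        note Jw = J(2)[OF w] and Zw = Z(2)[OF w]
        have P0: "0 \<le> poisson y (Z w)" by (rule poisson_nonneg[OF y])
        have "\<bar>U (Z w) - U y\<bar> * poisson y (Z w) \<le> \<eta> * poisson y (Z w) + 2 * K * (1 - y \<bullet> y) * D"
        proof (cases "dist (Z w) y < d")
          case True
          then have "\<bar>U (Z w) - U y\<bar> \<le> \<eta>" using Ud[of y "Z w"] y Zw by auto
          then have "\<bar>U (Z w) - U y\<bar> * poisson y (Z w) \<le> \<eta> * poisson y (Z w)"
            using P0 by (rule mult_right_mono)
          moreover have "0 \<le> 2 * K * (1 - y \<bullet> y) * D" using K yy D0 by simp
          ultimately show ?thesis by linarith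
        next
          case False
          then have "d \<le> norm (y - Z w)" by (simp add: dist_norm norm_minus_commute)
          then have "d\<^sup>2 \<le> (y - Z w) \<bullet> (y - Z w)" using d by (simp add: dot_square_norm power_mono)
          then have "((y - Z w) \<bullet> (y - Z w)) powr (- (CARD('n) / 2)) \<le> D"
            unfolding D_def using d by (intro powr_mono2') auto
          then have "poisson y (Z w) \<le> (1 - y \<bullet> y) * D"
            unfolding poisson_def using yy by (intro mult_left_mono)
          moreover have "\<bar>U (Z w) - U y\<bar> \<le> 2 * K" using K(1)[of y] K(1)[of "Z w"] y Zw by auto
          ultimately have "\<bar>U (Z w) - U y\<bar> * poisson y (Z w) \<le> 2 * K * ((1 - y \<bullet> y) * D)"
            using P0 K by (intro mult_mono) auto
          moreover have "0 \<le> \<eta> * poisson y (Z w)" using \<eta> P0 by simp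
          ultimately show ?thesis by (simp add: mult.assoc)
        qed
        then have "J w * (\<bar>U (Z w) - U y\<bar> * poisson y (Z w)) \<le> J w * (\<eta> * poisson y (Z w) + 2 * K * (1 - y \<bullet> y) * D)"
          using Jw by (rule mult_left_mono)
        moreover have "norm (J w * U (Z w) * poisson y (Z w) - U y * (J w * poisson y (Z w))) = J w * (\<bar>U (Z w) - U y\<bar> * poisson y (Z w))"
        proof -
          have "J w * U (Z w) * poisson y (Z w) - U y * (J w * poisson y (Z w)) = J w * ((U (Z w) - U y) * poisson y (Z w))"
            by (simp add: algebra_simps)
          then show ?thesis using Jw P0 by (simp add: abs_mult)
        qed
        ultimately show "norm (J w * U (Z w) * poisson y (Z w) - U y * (J w * poisson y (Z w))) \<le> \<eta> * (J w * poisson y (Z w)) + (2 * K * (1 - y \<bullet> y) * D) * J w"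
          by (simp add: algebra_simps)
      qed (use iJUP[OF y] iJP[OF y] J in auto)
      also have "\<dots> = \<eta> * c + (2 * K * (1 - y \<bullet> y) * D) * I"
        unfolding I_def using iJP[OF y] J norm[OF y] by simp
      also have "(2 * K * (1 - y \<bullet> y) * D) * I = N * (1 - y \<bullet> y)" by (simp add: N_def)
      also have "N * (1 - y \<bullet> y) \<le> N * (2 * (1 - r))" using yy N0 by (intro mult_left_mono)
      also have "N * (2 * (1 - r)) \<le> \<epsilon> / 2" using \<epsilon> N0 by (simp add: r_def field_simps)
      finally show ?thesis using \<eta> by simp
    qed
    then show ?thesis using r by blast
  qed
  have h1: "harmonic_on ?B (\<lambda>y. 1 * V y + (- c) * U y)" and h2: "harmonic_on ?B (\<lambda>y. (-1) * V y + c * U y)"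
    by (rule harmonic_on_linear_combination[OF open_ball Vh U(1)])+
  have b1: "\<exists>r<1. \<forall>y. r < norm y \<and> norm y < 1 \<longrightarrow> 1 * V y + (- c) * U y \<le> \<epsilon>"
    and b2: "\<exists>r<1. \<forall>y. r < norm y \<and> norm y < 1 \<longrightarrow> (-1) * V y + c * U y \<le> \<epsilon>" if "0 < \<epsilon>" for \<epsilon>
  proof -
    note bd = bound[OF that]
    obtain r where "r < 1" and r: "\<And>y. r < norm y \<Longrightarrow> norm y < 1 \<Longrightarrow> \<bar>V y - c * U y\<bar> \<le> \<epsilon>"
      using bd by blast
    moreover have "1 * V y + (- c) * U y \<le> \<epsilon>" "(-1) * V y + c * U y \<le> \<epsilon>" if "r < norm y" "norm y < 1" for y
      using r[OF that] by (simp_all add: abs_le_iff)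
    ultimately show "\<exists>r<1. \<forall>y. r < norm y \<and> norm y < 1 \<longrightarrow> 1 * V y + (- c) * U y \<le> \<epsilon>"
      "\<exists>r<1. \<forall>y. r < norm y \<and> norm y < 1 \<longrightarrow> (-1) * V y + c * U y \<le> \<epsilon>"
      by blast+
  qed
  have "1 * V y + (- c) * U y \<le> 0" "(-1) * V y + c * U y \<le> 0"
    by (rule harmonic_eq_0[OF h1 b1]; use y in simp) (rule harmonic_eq_0[OF h2 b2]; use y in simp)
  then show ?thesis by (simp add: V_def)
qed

section \<open>Lebesgue measure on the shell and its invariance properties\<close>

definition shell_measure :: "'a::euclidean_space measure" where
  "shell_measure = restrict_space lborel shell"

lemma compact_shell: "compact (shell :: 'a::euclidean_space set)"
proof -
  have "(shell :: 'a set) = cball 0 2 - ball 0 1" by (auto simp: shell_def)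
  moreover have "compact (cball (0::'a) 2 - ball 0 1)" by (intro compact_diff compact_cball open_ball)
  ultimately show ?thesis by simp
qed

lemma shell_borel[measurable]: "shell \<in> sets (borel :: 'a::euclidean_space measure)"
  by (rule borel_compact[OF compact_shell])

lemma space_shell_measure[simp]: "space shell_measure = shell"
  by (simp add: shell_measure_def space_restrict_space)

lemma shell_nonzero: "w \<in> shell \<Longrightarrow> w \<noteq> 0"
  by (auto simp: shell_def)

lemma borel_measurable_shell_measure:
  "continuous_on shell f \<Longrightarrow> f \<in> borel_measurable shell_measure"
  using borel_measurable_continuous_on_restrict[of shell f]
  by (simp add: shell_measure_def measurable_def space_restrict_space sets_restrict_space)

lemma integrable_shell_measure:
  fixes f :: "'a::euclidean_space \<Rightarrow> 'b::euclidean_space"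
  assumes "continuous_on shell f"
  shows "integrable shell_measure f"
  unfolding shell_measure_def
  using borel_integrable_compact[OF compact_shell assms] by (simp add: integrable_restrict_space)

lemma nn_integral_shell_measure:
  fixes f :: "'a::euclidean_space \<Rightarrow> real"
  assumes f: "continuous_on shell f" "\<And>w. w \<in> shell \<Longrightarrow> 0 \<le> f w"
  shows "ennreal (\<integral>w. f w \<partial>shell_measure) = (\<integral>\<^sup>+w. ennreal (f w) * indicator shell w \<partial>lborel)"
proof -
  have "(\<integral>\<^sup>+w. ennreal (f w) \<partial>shell_measure) = ennreal (\<integral>w. f w \<partial>shell_measure)"
    by (rule nn_integral_eq_integral[OF integrable_shell_measure[OF f(1)]]) (rule AE_I2, simp add: f(2))
  then show ?thesis by (simp add: shell_measure_def nn_integral_restrict_space)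
qed

lemma borel_measurable_shell_indicator:
  fixes f :: "'a::euclidean_space \<Rightarrow> real"
  assumes "continuous_on shell f"
  shows "(\<lambda>w. ennreal (f w) * indicator shell w) \<in> borel_measurable borel"
proof -
  have "(\<lambda>w. indicator shell w *\<^sub>R f w) \<in> borel_measurable borel"
    by (rule borel_measurable_continuous_on_indicator[OF shell_borel assms])
  then have "(\<lambda>w. ennreal (indicator shell w *\<^sub>R f w)) \<in> borel_measurable borel"
    by measurable
  then show ?thesis
    by (rule measurable_cong[THEN iffD1, rotated]) (auto simp: indicator_def)
qed

lemma orthogonal_transformation_shell:
  "orthogonal_transformation T \<Longrightarrow> T w \<in> shell \<longleftrightarrow> w \<in> shell"
  by (simp add: shell_def orthogonal_transformation_norm)

lemma integral_shell_measure_orthogonal: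
  fixes f :: "'a::euclidean_space \<Rightarrow> real" and T :: "'a \<Rightarrow> 'a"
  assumes T: "orthogonal_transformation T"
    and f: "continuous_on shell f" "\<And>w. w \<in> shell \<Longrightarrow> 0 \<le> f w"
  shows "(\<integral>w. f (T w) \<partial>shell_measure) = (\<integral>w. f w \<partial>shell_measure)"
proof -
  have fT: "continuous_on shell (\<lambda>w. f (T w))"
    by (rule continuous_on_compose2[OF f(1)])
      (use T in \<open>auto simp: orthogonal_transformation_shell intro!: linear_continuous_on orthogonal_transformation_linear simp flip: linear_conv_bounded_linear\<close>)
  have "ennreal (\<integral>w. f (T w) \<partial>shell_measure) = (\<integral>\<^sup>+w. ennreal (f (T w)) * indicator shell (T w) \<partial>lborel)"
    using nn_integral_shell_measure[OF fT] f(2) orthogonal_transformation_shell[OF T] by (simp add: indicator_def)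
  also have "\<dots> = (\<integral>\<^sup>+w. ennreal (f w) * indicator shell w \<partial>lborel)"
    by (rule nn_integral_lborel_orthogonal[OF T borel_measurable_shell_indicator[OF f(1)]])
  also have "\<dots> = ennreal (\<integral>w. f w \<partial>shell_measure)"
    using nn_integral_shell_measure[OF f] by simp
  finally show ?thesis
    using f orthogonal_transformation_shell[OF T] by (subst (asm) ennreal_inj) (auto intro!: Bochner_Integration.integral_nonneg)
qed

text \<open>The substitution by L moves the shell to the set 1 <= |L w| <= 2, and homogeneity moves
  it back. The factor is the volume ratio of L^(-1) of the unit ball to the unit ball, that is
  1/|det L|. What matters is that one c serves all f.\<close>

lemma integral_shell_measure_homogeneous_linear:
  fixes L :: "'a::euclidean_space \<Rightarrow> 'a"
  assumes L: "linear L" "bij L"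
  obtains c where "\<And>f :: 'a \<Rightarrow> real. continuous_on (- {0}) f \<Longrightarrow> (\<And>w. w \<noteq> 0 \<Longrightarrow> 0 \<le> f w) \<Longrightarrow>
      (\<And>t w. 0 < t \<Longrightarrow> w \<noteq> 0 \<Longrightarrow> f w = t ^ DIM('a) * f (t *\<^sub>R w)) \<Longrightarrow>
      (\<integral>w. f (L w) \<partial>shell_measure) = c * (\<integral>w. f w \<partial>shell_measure)"
proof -
  define v where "v = emeasure lborel (cball (0::'a) 1)"
  define u where "u = emeasure lborel (L -` cball (0::'a) 1)"
  have blL: "bounded_linear L" using L by (simp add: linear_conv_bounded_linear)
  have v: "v \<noteq> 0" "v \<noteq> \<infinity>" unfolding v_def using unit_ball_vol_pos[of "real DIM('a)", OF of_nat_0_le_iff, THEN less_imp_neq, symmetric] by (simp_all add: emeasure_cball)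
  have u: "u \<noteq> \<infinity>"
  proof -
    obtain L' where L': "linear L'" "L' \<circ> L = id"
      using linear_injective_left_inverse[OF L(1) bij_is_inj[OF L(2)]] by blast
    have "L -` cball 0 1 \<subseteq> L' ` cball 0 1"
      using L' by (auto simp: image_iff pointfree_idE intro!: bexI[of _ "L _"])
    moreover have "bounded (L' ` cball 0 1)"
      using L' by (intro bounded_linear_image) (auto simp: linear_conv_bounded_linear)
    ultimately have "bounded (L -` cball 0 1)" by (rule bounded_subset[rotated])
    then show ?thesis unfolding u_def using emeasure_bounded_finite by (metis infinity_ennreal_def less_irrefl)
  qed
  show thesis
  proof (rule that[of "enn2real u / enn2real v"])
    fix f :: "'a \<Rightarrow> real"
    assume fc: "continuous_on (- {0}) f" and f0: "\<And>w. w \<noteq> 0 \<Longrightarrow> 0 \<le> f w"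
      and hom: "\<And>t w. 0 < t \<Longrightarrow> w \<noteq> 0 \<Longrightarrow> f w = t ^ DIM('a) * f (t *\<^sub>R w)"
    have Lz: "L w = 0 \<longleftrightarrow> w = 0" for w
      using linear_injective_0[OF L(1)] linear_0[OF L(1)] bij_is_inj[OF L(2)] by auto
    have fs: "continuous_on shell f" by (rule continuous_on_subset[OF fc]) (auto dest: shell_nonzero)
    have Lc: "continuous_on A L" for A by (rule linear_continuous_on[OF blL])
    have fLs: "continuous_on shell (\<lambda>w. f (L w))"
      by (rule continuous_on_compose2[OF fc Lc]) (auto simp: Lz dest: shell_nonzero)
    \<comment> \<open>The value of f at 0 is arbitrary, but the gauge lemma asks for homogeneity and
      measurability on the whole space, so the integrand is set to 0 there.\<close>
    define G where "G w = ennreal (indicator (- {0}) w * f (L w))" for w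
    have Gm: "G \<in> borel_measurable borel"
    proof -
      have "continuous_on (- {0}) (\<lambda>w. f (L w))"
        by (rule continuous_on_compose2[OF fc Lc]) (auto simp: Lz)
      from borel_measurable_continuous_on_indicator[OF _ this] show ?thesis
        unfolding G_def by (simp add: open_delete borel_open Compl_eq_Diff_UNIV)
    qed
    have Lm: "L \<in> borel_measurable borel" by (rule borel_measurable_continuous_onI[OF Lc])
    have Gh: "G z = ennreal (t ^ DIM('a)) * G (t *\<^sub>R z)" if "0 < t" for t z
      using hom[OF that, of "L z"] that L(1) f0[of "L (t *\<^sub>R z)"] Lz[of z] Lz[of "t *\<^sub>R z"]
      by (cases "z = 0") (auto simp: G_def linear_scale ennreal_mult')
    have GS: "G w * indicator shell w = ennreal (f (L w)) * indicator shell w" for w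
      using shell_nonzero[of w] by (auto simp: G_def indicator_def)
    have GS': "G w * indicator {z. 1 \<le> norm (L z) \<and> norm (L z) \<le> 2} w = ennreal (f (L w)) * indicator shell (L w)" for w
      using L(1) by (auto simp: G_def indicator_def shell_def linear_0)
    have "v * ennreal (\<integral>w. f (L w) \<partial>shell_measure) = v * (\<integral>\<^sup>+w. ennreal (f (L w)) * indicator shell w \<partial>lborel)"
      using fLs f0 Lz by (subst nn_integral_shell_measure) (auto dest: shell_nonzero)
    also have "\<dots> = v * (\<integral>\<^sup>+w. G w * indicator shell w \<partial>lborel)" by (simp add: GS)
    also have "\<dots> = v * (\<integral>\<^sup>+w. G w * indicator {z. 1 \<le> norm (L z) \<and> norm (L z) \<le> 2} w \<partial>lborel)"
      by (subst nn_integral_homogeneous_gauge[OF Gm _ Gh])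
        (use Lm L(1) Lz in \<open>auto simp: linear_scale\<close>)
    also have "\<dots> = v * (\<integral>\<^sup>+w. ennreal (f (L w)) * indicator shell (L w) \<partial>lborel)" by (simp add: GS')
    also have "\<dots> = u * (\<integral>\<^sup>+w. ennreal (f w) * indicator shell w \<partial>lborel)"
      unfolding u_def v_def
      by (rule nn_integral_lborel_linear[OF L borel_measurable_shell_indicator[OF fs], symmetric])
    also have "\<dots> = u * ennreal (\<integral>w. f w \<partial>shell_measure)"
      using fs f0 by (subst nn_integral_shell_measure) (auto dest: shell_nonzero)
    finally have "v * ennreal (\<integral>w. f (L w) \<partial>shell_measure) = u * ennreal (\<integral>w. f w \<partial>shell_measure)" .
    moreover have "0 \<le> (\<integral>w. f (L w) \<partial>shell_measure)"
      by (rule Bochner_Integration.integral_nonneg, rule f0) (simp add: Lz shell_nonzero)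
    moreover have "0 \<le> (\<integral>w. f w \<partial>shell_measure)"
      by (rule Bochner_Integration.integral_nonneg, rule f0) (simp add: shell_nonzero)
    ultimately have "enn2real v * (\<integral>w. f (L w) \<partial>shell_measure) = enn2real u * (\<integral>w. f w \<partial>shell_measure)"
      using enn2real_mult[of v "ennreal (\<integral>w. f (L w) \<partial>shell_measure)"] enn2real_mult[of u "ennreal (\<integral>w. f w \<partial>shell_measure)"]
      by simp
    moreover have "enn2real v \<noteq> 0" using v by (auto simp: enn2real_eq_0_iff)
    ultimately show "(\<integral>w. f (L w) \<partial>shell_measure) = enn2real u / enn2real v * (\<integral>w. f w \<partial>shell_measure)"
      by (simp add: field_simps)
  qed
qed

subsection \<open>Boosts of the sphere\<close>

lemma continuous_on_poisson_slice:
  assumes "y \<in> ball 0 1"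
  shows "continuous_on (sphere 0 1) (poisson y)"
  by (rule continuous_on_compose2[OF continuous_on_poisson, of _ "\<lambda>z. (y, z)", simplified])
    (use assms in \<open>auto intro!: continuous_intros\<close>)

lemma poisson_orthogonal:
  fixes T :: "real ^ 'n::finite \<Rightarrow> real ^ 'n"
  assumes "orthogonal_transformation T"
  shows "poisson (T y) (T z) = poisson y z"
proof -
  have "T y - T z = T (y - z)"
    using orthogonal_transformation_linear[OF assms] by (simp add: linear_diff)
  then show ?thesis
    using assms by (simp add: poisson_def orthogonal_transformation_def)
qed

text \<open>The total mass of the Poisson kernel is a harmonic function that is constant on each sphere, hence
  constant by the maximum principle.\<close>

lemma poisson_uniform_measure_constant:
  obtains c :: real where "\<And>y :: real ^ 'n::finite. y \<in> ball 0 1 \<Longrightarrow>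
    (\<integral>z. norm z powr (- real CARD('n)) * poisson y (z /\<^sub>R norm z) \<partial>shell_measure) = c"
proof -
  let ?J = "\<lambda>z::real^'n. norm z powr (- real CARD('n))" and ?Z = "\<lambda>z::real^'n. z /\<^sub>R norm z"
  define V where "V y = (\<integral>z. ?J z * poisson y (?Z z) \<partial>shell_measure)" for y :: "real^'n"
  have Zc: "continuous_on shell ?Z" and Jc: "continuous_on shell ?J"
    by (auto intro!: continuous_intros dest: shell_nonzero)
  have Z: "?Z \<in> borel_measurable shell_measure" "\<And>w. w \<in> space shell_measure \<Longrightarrow> ?Z w \<in> sphere 0 1"
    using borel_measurable_shell_measure[OF Zc] by (auto dest: shell_nonzero)
  have h: "harmonic_on (ball 0 1) V"
    unfolding V_def by (rule harmonic_on_poisson_integral[OF Z integrable_shell_measure[OF Jc]])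
  have rot: "V u = V y" if u: "norm u = norm y" and y: "y \<in> ball 0 1" for u y
  proof -
    obtain T where T: "orthogonal_transformation T" "T y = u"
      using orthogonal_transformation_exists[of y u] u by auto
    let ?f = "\<lambda>z. ?J z * poisson (T y) (?Z z)"
    have Ty: "T y \<in> ball 0 1" using y u T by simp
    have "continuous_on shell ?f"
      by (intro continuous_on_mult Jc continuous_on_compose2[OF continuous_on_poisson_slice[OF Ty] Zc])
        (auto dest: shell_nonzero)
    moreover have "0 \<le> ?f w" for w by (intro mult_nonneg_nonneg poisson_nonneg Ty) simp
    ultimately have "(\<integral>w. ?f (T w) \<partial>shell_measure) = (\<integral>w. ?f w \<partial>shell_measure)"
      by (intro integral_shell_measure_orthogonal[OF T(1)])
    moreover have "?f (T w) = ?J w * poisson y (?Z w)" for w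
    proof -
      have "?Z (T w) = T (?Z w)"
        using T(1) orthogonal_transformation_linear[OF T(1)] by (simp add: orthogonal_transformation_norm linear_scale)
      then show ?thesis by (simp add: poisson_orthogonal[OF T(1)] orthogonal_transformation_norm[OF T(1)])
    qed
    ultimately show ?thesis by (simp add: V_def T(2))
  qed
  show thesis
  proof (rule that[of "V 0"])
    fix y :: "real^'n" assume y: "y \<in> ball 0 1"
    have y1: "norm y < 1" and y0: "norm (0::real^'n) \<le> norm y" using y by simp_all
    have "V 0 \<le> V y"
      by (rule harmonic_max_principle[OF h y1 _ y0]) (drule rot[OF _ y], simp)
    moreover have "harmonic_on (ball 0 1) (\<lambda>y. (- 1) * V y + 0 * V y)"
      by (rule harmonic_on_linear_combination[OF open_ball h h])
    then have "(- 1) * V 0 + 0 * V 0 \<le> - V y"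
      by (rule harmonic_max_principle[OF _ y1 _ y0]) (drule rot[OF _ y], simp)
    ultimately show "(\<integral>z. ?J z * poisson y (?Z z) \<partial>shell_measure) = V 0"
      by (simp add: V_def)
  qed
qed

text \<open>The conformal automorphism of the sphere that fixes \<open>\<plusminus>e\<close> and extends to the Klein model of hyperbolic
  space as the boost sending \<open>0\<close> to \<open>\<tau>e\<close>.\<close>

definition boost :: "'a::real_inner \<Rightarrow> real \<Rightarrow> 'a \<Rightarrow> 'a" where
  "boost e \<tau> z = ((z \<bullet> e + \<tau>) *\<^sub>R e + sqrt (1 - \<tau>\<^sup>2) *\<^sub>R (z - (z \<bullet> e) *\<^sub>R e)) /\<^sub>R (1 + \<tau> * (z \<bullet> e))"

lemma boost_denominator_pos:
  fixes e z :: "'a::real_inner"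
  assumes "norm e = 1" "norm z = 1" "0 < \<tau>" "\<tau> < 1"
  shows "0 < 1 + \<tau> * (z \<bullet> e)"
proof -
  have "\<bar>z \<bullet> e\<bar> \<le> 1" using Cauchy_Schwarz_ineq2[of z e] assms by simp
  then have "\<tau> * - (z \<bullet> e) \<le> \<tau> * 1" using assms by (intro mult_left_mono) auto
  then show ?thesis using assms by simp
qed

lemma inner_boost:
  fixes e z y :: "'a::real_inner"
  assumes "norm e = 1" "norm z = 1" "0 < \<tau>" "\<tau> < 1"
  shows "(1 + \<tau> * (z \<bullet> e)) * (boost e \<tau> z \<bullet> y)
       = (z \<bullet> e + \<tau>) * (e \<bullet> y) + sqrt (1 - \<tau>\<^sup>2) * (z \<bullet> y - (z \<bullet> e) * (e \<bullet> y))"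
  using boost_denominator_pos[OF assms] by (simp add: boost_def inner_add_left inner_diff_left)

lemma boost_in_sphere:
  fixes e z :: "'a::real_inner"
  assumes e: "norm e = 1" and z: "norm z = 1" and \<tau>: "0 < \<tau>" "\<tau> < 1"
  shows "boost e \<tau> z \<in> sphere 0 1"
proof -
  let ?s = "sqrt (1 - \<tau>\<^sup>2)" and ?t = "z \<bullet> e"
  have s: "?s * ?s = 1 - \<tau>\<^sup>2" using \<tau> by (simp add: power_le_one)
  have ee: "e \<bullet> e = 1" and zz: "z \<bullet> z = 1" using e z by (simp_all add: dot_square_norm)
  let ?v = "(?t + \<tau>) *\<^sub>R e + ?s *\<^sub>R (z - ?t *\<^sub>R e)"
  have "?v \<bullet> ?v = (?t + \<tau>)\<^sup>2 + (?s * ?s) * (1 - ?t\<^sup>2)"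
    by (simp add: inner_simps ee zz inner_commute[of e z] power2_eq_square)
  also have "\<dots> = (1 + \<tau> * ?t)\<^sup>2" unfolding s by (simp add: power2_eq_square algebra_simps)
  finally have "norm ?v = 1 + \<tau> * ?t"
    using boost_denominator_pos[OF assms] by (simp add: norm_eq_sqrt_inner)
  then show ?thesis using boost_denominator_pos[OF assms] by (simp add: boost_def)
qed

text \<open>\<open>y'\<close> is the preimage of \<open>y\<close> under the conformal automorphism of the ball that extends the boost,
  and \<open>z \<mapsto> \<bar>z - c\<bar>\<^bsup>2-n\<^esup>\<close>, which is harmonic in the ball since \<open>\<bar>c\<bar> > 1\<close>, is a multiple of
  \<open>(1 + \<tau> (z \<bullet> e))\<^bsup>1-n/2\<^esup>\<close> on the sphere.\<close>

lemma poisson_boost: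
  fixes e y :: "real ^ 'n::finite" and \<tau> :: real
  defines "s \<equiv> sqrt (1 - \<tau>\<^sup>2)"
  defines "c \<equiv> - ((1 + s) / \<tau>) *\<^sub>R e"
  assumes e: "norm e = 1" and \<tau>: "0 < \<tau>" "\<tau> < 1" and y: "y \<in> ball 0 1"
  obtains y' k where "y' \<in> ball 0 1"
    "k * ((y' - c) \<bullet> (y' - c)) powr (1 - CARD('n) / 2) = (s\<^sup>2) powr (1 - CARD('n) / 2) / s"
    "\<And>z. norm z = 1 \<Longrightarrow> (1 + \<tau> * (z \<bullet> e)) powr (1 - real CARD('n)) * poisson y (boost e \<tau> z)
       = k * (((z - c) \<bullet> (z - c)) powr (1 - CARD('n) / 2) * poisson y' z)"
proof -
  define d where "d = (1 + s) / \<tau>"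
  define Y t where "Y = y \<bullet> y" and "t = y \<bullet> e"
  \<comment> \<open>The factor 1 + \<tau> (z . e) times |y - boost z|^2 equals A + B . z. Matching
    it with C |z - y'|^2 for |z| = 1 requires C (1 + |y'|^2) = A and B = -2 C y', hence a quadratic
    equation for C. Its discriminant is S^2 because |B|^2 = A^2 - S^2, and the larger root gives
    |y'| < 1.\<close>
  define A where "A = 1 + Y - 2 * \<tau> * t"
  define S where "S = s * (1 - Y)"
  define B where "B = (\<tau> * (1 + Y) - 2 * t) *\<^sub>R e - (2 * s) *\<^sub>R (y - t *\<^sub>R e)"
  define C where "C = (A + S) / 2"
  define y' where "y' = (- 1 / (2 * C)) *\<^sub>R B"
  have ee: "e \<bullet> e = 1" using e by (simp add: dot_square_norm)
  have ss: "s\<^sup>2 = 1 - \<tau>\<^sup>2" and s0: "0 < s" unfolding s_def using \<tau> by (simp_all add: power_le_one power_less_one_iff)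
  have Y: "0 \<le> Y" "Y < 1" using y by (simp_all add: Y_def dot_square_norm power_less_one_iff)
  have tY: "t\<^sup>2 \<le> Y" unfolding t_def Y_def using Cauchy_Schwarz_ineq[of y e] ee by simp
  \<comment> \<open>d is the root of \<tau> (1 + d^2) = 2 d that exceeds 1. The equation makes |z -
    c|^2 proportional to 1 + \<tau> (z . e) on the sphere, and the choice of root puts the pole c =
    -d e outside the closed ball.\<close>
  have d: "0 < d" "\<tau> * (1 + d\<^sup>2) = 2 * d" "d\<^sup>2 - 1 = s * (1 + d\<^sup>2)"
  proof -
    show "0 < d" using s0 \<tau> by (simp add: d_def)
    have \<tau>d: "\<tau> * d = 1 + s" using \<tau> by (simp add: d_def)
    have "(\<tau> * d)\<^sup>2 + \<tau>\<^sup>2 = 2 * (1 + s)" unfolding \<tau>d using ss by (simp add: power2_eq_square algebra_simps)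
    moreover have "(\<tau> * d)\<^sup>2 + \<tau>\<^sup>2 = \<tau> * (\<tau> * (1 + d\<^sup>2))" by (simp add: power2_eq_square algebra_simps)
    moreover have "\<tau> * (2 * d) = 2 * (1 + s)" using \<tau>d by simp
    ultimately have "\<tau> * (\<tau> * (1 + d\<^sup>2)) = \<tau> * (2 * d)" by simp
    then show *: "\<tau> * (1 + d\<^sup>2) = 2 * d" using \<tau> by simp
    have "\<tau> * (d\<^sup>2 - 1) = 2 * d - 2 * \<tau>" using * by (simp add: algebra_simps)
    moreover have "\<tau> * (s * (1 + d\<^sup>2)) = s * (2 * d)" using * by (metis mult.left_commute)
    moreover have "\<tau> * (2 * d - 2 * \<tau>) = \<tau> * (s * (2 * d))"
    proof -
      have "\<tau> * (2 * d - 2 * \<tau>) = 2 * (1 + s) - 2 * (1 - s\<^sup>2)" using \<tau>d ss by (simp add: algebra_simps power2_eq_square)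
      also have "\<dots> = 2 * s * (\<tau> * d)" unfolding \<tau>d by (simp add: algebra_simps power2_eq_square)
      finally show ?thesis by (simp add: mult_ac)
    qed
    then have "2 * d - 2 * \<tau> = s * (2 * d)" using \<tau> by simp
    ultimately have "\<tau> * (d\<^sup>2 - 1) = \<tau> * (s * (1 + d\<^sup>2))" by (simp only:)
    then show "d\<^sup>2 - 1 = s * (1 + d\<^sup>2)" using \<tau> by simp
  qed
  have BB: "B \<bullet> B = A\<^sup>2 - S\<^sup>2"
  proof -
    have "B \<bullet> B = (\<tau> * (1 + Y) - 2 * t)\<^sup>2 + 4 * s\<^sup>2 * (Y - t\<^sup>2)"
      unfolding B_def by (simp add: inner_simps ee inner_commute[of e y] flip: Y_def t_def) (simp add: power2_eq_square algebra_simps)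
    also have "\<dots> = A\<^sup>2 - S\<^sup>2"
      unfolding A_def S_def power_mult_distrib ss by (simp add: power2_eq_square algebra_simps)
    finally show ?thesis .
  qed
  have A0: "0 \<le> A"
  proof -
    have "\<tau> * t \<le> \<bar>t\<bar>" using \<tau> by (metis abs_ge_self abs_mult abs_of_pos less_imp_le mult_left_le_one_le abs_ge_zero order_trans)
    moreover have "0 \<le> (1 - \<bar>t\<bar>)\<^sup>2" by simp
    ultimately show ?thesis using tY by (simp add: A_def power2_eq_square algebra_simps)
  qed
  have S0: "0 < S" using s0 Y by (simp add: S_def)
  have C0: "0 < C" using A0 S0 by (simp add: C_def)
  have y'y': "C * (y' \<bullet> y') = (A - S) / 2"
  proof -
    have "C * (y' \<bullet> y') = (A\<^sup>2 - S\<^sup>2) / (4 * C)" using C0 by (simp add: y'_def BB power2_eq_square)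
    also have "A\<^sup>2 - S\<^sup>2 = (A - S) * (2 * C)" by (simp add: C_def power2_eq_square algebra_simps)
    finally show ?thesis using C0 by simp
  qed
  have C1: "C * (1 - y' \<bullet> y') = S" "C * (1 + y' \<bullet> y') = A"
    unfolding distrib_left right_diff_distrib y'y' by (simp_all add: C_def field_simps)
  have y'1: "y' \<in> ball 0 1"
  proof -
    have "0 < 1 - y' \<bullet> y'" using C1(1) S0 C0 by (metis zero_less_mult_pos)
    then show ?thesis by (simp add: dot_square_norm power_less_one_iff abs_square_less_1 power2_less_imp_less)
  qed
  have y'z: "2 * C * (y' \<bullet> z) = - (B \<bullet> z)" for z using C0 by (simp add: y'_def)
  have y'c: "C * ((y' - c) \<bullet> (y' - c)) = 2 * d * s\<^sup>2 / \<tau>"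
  proof -
    have c: "c = - d *\<^sub>R e" by (simp add: c_def d_def)
    have Be: "B \<bullet> e = \<tau> * (1 + Y) - 2 * t" unfolding B_def by (simp add: inner_simps ee flip: t_def)
    have "C * ((y' - c) \<bullet> (y' - c)) = C * (y' \<bullet> y') + d * (2 * C * (y' \<bullet> e)) + C * d\<^sup>2"
      unfolding c by (simp add: inner_simps ee inner_commute[of e y'] power2_eq_square algebra_simps)
    also have "C * (y' \<bullet> y') + d * (2 * C * (y' \<bullet> e)) + C * d\<^sup>2
        = (1 + d\<^sup>2) * A / 2 + (d\<^sup>2 - 1) * S / 2 - d * (\<tau> * (1 + Y) - 2 * t)"
      unfolding y'z y'y' Be by (simp add: C_def algebra_simps add_divide_distrib diff_divide_distrib)
    also have "\<tau> * \<dots> = 2 * d * s\<^sup>2"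
    proof -
      have "\<tau> * ((1 + d\<^sup>2) * A / 2 + (d\<^sup>2 - 1) * S / 2 - d * (\<tau> * (1 + Y) - 2 * t))
         = (\<tau> * (1 + d\<^sup>2)) * A / 2 + s * (\<tau> * (1 + d\<^sup>2)) * S / 2 - \<tau> * d * (\<tau> * (1 + Y) - 2 * t)"
        unfolding d(3) by (simp add: algebra_simps)
      also have "\<dots> = d * (A + s\<^sup>2 * (1 - Y) - \<tau>\<^sup>2 * (1 + Y) + 2 * \<tau> * t)"
        unfolding d(2) S_def by (simp add: power2_eq_square field_simps)
      also have "\<dots> = 2 * d * s\<^sup>2" unfolding A_def ss by (simp add: algebra_simps)
      finally show ?thesis .
    qed
    finally show ?thesis using \<tau> by (simp add: field_simps)
  qed
  define \<alpha> where "\<alpha> = \<tau> / (2 * d)"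
  have \<alpha>: "0 < \<alpha>" using \<tau> d by (simp add: \<alpha>_def)
  define b where "b = 1 - real CARD('n) / 2"
  define k where "k = \<alpha> powr b * C powr b / s"
  show thesis
  proof
    show "y' \<in> ball 0 1" by (rule y'1)
    \<comment> \<open>The factor k depends on y through C, but C |y' - c|^2 does not depend on y, so
      y drops out of this product. The product is what remains when the representation formula is
      applied to |z - c|^(2-n).\<close>
    have "k * ((y' - c) \<bullet> (y' - c)) powr b = (\<alpha> * (C * ((y' - c) \<bullet> (y' - c)))) powr b / s"
      unfolding k_def using \<alpha> C0 by (simp add: powr_mult)
    also have "\<alpha> * (C * ((y' - c) \<bullet> (y' - c))) = s\<^sup>2"
      unfolding y'c \<alpha>_def using \<tau> d by simp
    finally show "k * ((y' - c) \<bullet> (y' - c)) powr (1 - CARD('n) / 2) = (s\<^sup>2) powr (1 - CARD('n) / 2) / s"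
      unfolding b_def .
  next
    fix z :: "real^'n" assume z: "norm z = 1"
    define u where "u = 1 + \<tau> * (z \<bullet> e)"
    have zz: "z \<bullet> z = 1" using z by (simp add: dot_square_norm)
    have u0: "0 < u" unfolding u_def by (rule boost_denominator_pos[OF e z \<tau>])
    define q where "q = (z - y') \<bullet> (z - y')"
    have q0: "0 < q" using y'1 z by (auto simp: q_def)
    have bz: "boost e \<tau> z \<bullet> boost e \<tau> z = 1"
      using boost_in_sphere[OF e z \<tau>] by (simp add: dot_square_norm)
    have "u * ((y - boost e \<tau> z) \<bullet> (y - boost e \<tau> z)) = u * (1 + Y) - 2 * (u * (boost e \<tau> z \<bullet> y))"
      by (simp add: inner_simps inner_commute[of y "boost e \<tau> z"] bz Y_def algebra_simps)
    also have "\<dots> = A + B \<bullet> z"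
      unfolding u_def inner_boost[OF e z \<tau>] A_def B_def s_def[symmetric]
      by (simp add: inner_simps inner_commute[of e z] inner_commute[of y z] inner_commute[of e y] t_def algebra_simps)
    also have "\<dots> = C * q"
    proof -
      have "C * q = C * (1 + y' \<bullet> y') - 2 * C * (y' \<bullet> z)"
        by (simp add: q_def inner_simps inner_commute[of z y'] zz algebra_simps)
      then show ?thesis unfolding C1(2) y'z by simp
    qed
    finally have dist: "(y - boost e \<tau> z) \<bullet> (y - boost e \<tau> z) = C * q / u" using u0 by (simp add: field_simps)
    have zc: "(z - c) \<bullet> (z - c) = u / \<alpha>"
    proof -
      have "\<tau> * ((z - c) \<bullet> (z - c)) = \<tau> * (1 + d\<^sup>2) + 2 * d * (\<tau> * (z \<bullet> e))"
        unfolding c_def d_def[symmetric] by (simp add: inner_simps ee zz inner_commute[of e z] power2_eq_square algebra_simps)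
      also have "\<dots> = 2 * d * u" unfolding d(2) u_def by (simp add: algebra_simps)
      finally show ?thesis using \<tau> d by (simp add: \<alpha>_def field_simps)
    qed
    have Yk: "1 - Y = C * (1 - y' \<bullet> y') / s" unfolding C1(1) S_def using s0 by simp
    have n: "- (real CARD('n) / 2) = b - 1" by (simp add: b_def)
    have "u powr (1 - real CARD('n)) * poisson y (boost e \<tau> z)
        = (1 - y' \<bullet> y') / s * (C * C powr (b - 1)) * q powr (b - 1) * (u powr (2 * b - 1) / u powr (b - 1))"
      unfolding poisson_def dist Y_def[symmetric] Yk n using C0 q0 u0
      by (simp add: powr_mult powr_divide b_def)
    also have "C * C powr (b - 1) = C powr b" using C0 powr_add[of C 1 "b - 1"] by simp
    also have "u powr (2 * b - 1) / u powr (b - 1) = u powr b" using u0 by (simp flip: powr_diff)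
    also have "u powr b = \<alpha> powr b * ((z - c) \<bullet> (z - c)) powr b"
      unfolding zc using u0 \<alpha> by (simp add: powr_divide)
    also have "(1 - y' \<bullet> y') / s * C powr b * q powr (b - 1) * (\<alpha> powr b * ((z - c) \<bullet> (z - c)) powr b)
        = k * (((z - c) \<bullet> (z - c)) powr b * ((1 - y' \<bullet> y') * q powr (b - 1)))"
      by (simp add: k_def)
    also have "(1 - y' \<bullet> y') * q powr (b - 1) = poisson y' z"
      unfolding poisson_def n q_def by (simp add: inner_diff inner_commute[of z y'] algebra_simps)
    finally show "(1 + \<tau> * (z \<bullet> e)) powr (1 - real CARD('n)) * poisson y (boost e \<tau> z)
       = k * (((z - c) \<bullet> (z - c)) powr (1 - CARD('n) / 2) * poisson y' z)"
      unfolding u_def b_def .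
  qed
qed

lemma continuous_on_boost:
  fixes e :: "'a::real_inner"
  assumes "norm e = 1" "0 < \<tau>" "\<tau> < 1"
  shows "continuous_on (sphere 0 1) (boost e \<tau>)"
  unfolding boost_def using boost_denominator_pos[OF assms(1) _ assms(2,3)]
  by (intro continuous_intros) (auto simp: less_imp_neq[THEN not_sym])

text \<open>The factor with exponent 1 - n is, up to a constant, the Jacobian of the boost on the
  sphere, so this integral is one against a uniform measure in disguise.
  \<open>poisson_boost\<close> turns the boosted kernel into k h times the kernel at y', the
  representation formula evaluates this as a constant times k h(y'), and that product is the same
  for all y. The power -n of the norm supplies the homogeneity needed to insert L.\<close>

lemma poisson_boosted_measure_constant:
  fixes e :: "real ^ 'n::finite" and L :: "real ^ 'n \<Rightarrow> real ^ 'n"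
  assumes e: "norm e = 1" and \<tau>: "0 < \<tau>" "\<tau> < 1" and L: "linear L" "bij L"
  obtains c where "\<And>y. y \<in> ball 0 1 \<Longrightarrow>
    (\<integral>w. (norm (L w) powr (- real CARD('n)) * (1 + \<tau> * ((L w /\<^sub>R norm (L w)) \<bullet> e)) powr (1 - real CARD('n)))
       * poisson y (boost e \<tau> (L w /\<^sub>R norm (L w))) \<partial>shell_measure) = c"
proof -
  let ?n = "real CARD('n)"
  define s where "s = sqrt (1 - \<tau>\<^sup>2)"
  define c where "c = - ((1 + s) / \<tau>) *\<^sub>R e"
  define h where "h y = ((y - c) \<bullet> (y - c)) powr (1 - ?n / 2)" for y
  let ?J = "\<lambda>z::real^'n. norm z powr (- ?n)" and ?Z = "\<lambda>z::real^'n. z /\<^sub>R norm z"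
  define F where "F y z = (?J z * (1 + \<tau> * (?Z z \<bullet> e)) powr (1 - ?n)) * poisson y (boost e \<tau> (?Z z))" for y z
  have s0: "0 < s" unfolding s_def using \<tau> by (simp add: power_less_one_iff)
  have nc: "1 < norm c"
  proof -
    have "norm c = (1 + s) / \<tau>" using e s0 \<tau> by (simp add: c_def)
    then show ?thesis using s0 \<tau> by (simp add: less_divide_eq)
  qed
  have hc: "continuous_on (cball 0 1) h"
    unfolding h_def using nc by (intro continuous_intros ballI) auto
  have hh: "harmonic_on (ball 0 1) h"
    unfolding h_def using nc by (intro harmonic_on_dist_powr) auto
  have Zc: "continuous_on (- {0}) ?Z" and Jc: "continuous_on (- {0}) ?J"
    by (auto intro!: continuous_intros)
  have sub: "shell \<subseteq> - {0::real^'n}" by (auto dest: shell_nonzero)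
  have Z: "?Z \<in> borel_measurable shell_measure" "\<And>w. w \<in> space shell_measure \<Longrightarrow> ?Z w \<in> sphere 0 1"
    using borel_measurable_shell_measure[OF continuous_on_subset[OF Zc sub]] by (auto dest: shell_nonzero)
  obtain c0 where c0: "\<And>y::real^'n. y \<in> ball 0 1 \<Longrightarrow> (\<integral>z. ?J z * poisson y (?Z z) \<partial>shell_measure) = c0"
    by (rule poisson_uniform_measure_constant) (rule that; assumption)
  have int: "(\<integral>z. F y z \<partial>shell_measure) = c0 * ((s\<^sup>2) powr (1 - ?n / 2) / s)" if y: "y \<in> ball 0 1" for y
  proof -
    obtain y' k where y': "y' \<in> ball 0 1" and k: "k * h y' = (s\<^sup>2) powr (1 - ?n / 2) / s"
      and P: "\<And>z. norm z = 1 \<Longrightarrow> (1 + \<tau> * (z \<bullet> e)) powr (1 - ?n) * poisson y (boost e \<tau> z) = k * (h z * poisson y' z)"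
      by (rule poisson_boost[OF e \<tau> y, folded s_def, folded c_def, folded h_def]) (rule that; assumption)
    have "(\<integral>z. F y z \<partial>shell_measure) = (\<integral>z. k * (?J z * h (?Z z) * poisson y' (?Z z)) \<partial>shell_measure)"
    proof (rule Bochner_Integration.integral_cong[OF refl])
      fix z :: "real^'n" assume "z \<in> space shell_measure"
      then have "norm (?Z z) = 1" by (auto dest: shell_nonzero)
      from P[OF this] show "F y z = k * (?J z * h (?Z z) * poisson y' (?Z z))"
        by (simp add: F_def mult.assoc)
    qed
    also have "\<dots> = k * (\<integral>z. ?J z * h (?Z z) * poisson y' (?Z z) \<partial>shell_measure)" by simp
    also have "(\<integral>z. ?J z * h (?Z z) * poisson y' (?Z z) \<partial>shell_measure) = c0 * h y'"
      by (rule poisson_representation[OF Z integrable_shell_measure[OF continuous_on_subset[OF Jc sub]] _ c0 hh hc y']) simp_all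
    finally show ?thesis using k by (simp add: mult_ac)
  qed
  show thesis
  proof (rule integral_shell_measure_homogeneous_linear[OF L])
    fix cL assume cL: "\<And>f :: real^'n \<Rightarrow> real. continuous_on (- {0}) f \<Longrightarrow> (\<And>w. w \<noteq> 0 \<Longrightarrow> 0 \<le> f w) \<Longrightarrow>
        (\<And>t w. 0 < t \<Longrightarrow> w \<noteq> 0 \<Longrightarrow> f w = t ^ DIM(real^'n) * f (t *\<^sub>R w)) \<Longrightarrow>
        (\<integral>w. f (L w) \<partial>shell_measure) = cL * (\<integral>w. f w \<partial>shell_measure)"
    show thesis
    proof (rule that[of "cL * (c0 * ((s\<^sup>2) powr (1 - ?n / 2) / s))"])
      fix y :: "real^'n" assume y: "y \<in> ball 0 1"
      have Z1: "norm (?Z w) = 1" if "w \<noteq> 0" for w using that by simp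
      have Fc: "continuous_on (- {0}) (F y)"
      proof -
        have "continuous_on (- {0}) (\<lambda>z. boost e \<tau> (?Z z))"
          by (rule continuous_on_compose2[OF continuous_on_boost[OF e \<tau>] Zc]) (simp add: image_subset_iff)
        then have "continuous_on (- {0}) (\<lambda>z. poisson y (boost e \<tau> (?Z z)))"
          by (rule continuous_on_compose2[OF continuous_on_poisson_slice[OF y]])
            (simp only: image_subset_iff, use boost_in_sphere[OF e Z1 \<tau>] in blast)
        moreover have "continuous_on (- {0}) (\<lambda>z. (1 + \<tau> * (?Z z \<bullet> e)) powr (1 - ?n))"
          by (intro continuous_on_powr continuous_intros Zc ballI)
            (use boost_denominator_pos[OF e Z1 \<tau>] in \<open>force+\<close>)
        ultimately show ?thesis unfolding F_def by (intro continuous_on_mult Jc)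
      qed
      have F0: "0 \<le> F y w" for w
        unfolding F_def by (intro mult_nonneg_nonneg poisson_nonneg[OF y]) auto
      have hom: "F y w = t ^ DIM(real^'n) * F y (t *\<^sub>R w)" if "0 < t" "w \<noteq> 0" for t w
      proof -
        have a: "?Z (t *\<^sub>R w) = ?Z w" using that by simp
        have b: "t ^ DIM(real^'n) * ?J (t *\<^sub>R w) = ?J w"
          using that by (simp add: powr_mult powr_minus powr_realpow)
        show ?thesis by (simp only: F_def a mult.assoc[symmetric] b)
      qed
      show "(\<integral>w. (norm (L w) powr (- ?n) * (1 + \<tau> * (?Z (L w) \<bullet> e)) powr (1 - ?n)) * poisson y (boost e \<tau> (?Z (L w))) \<partial>shell_measure)
          = cL * (c0 * ((s\<^sup>2) powr (1 - ?n / 2) / s))"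
        using cL[OF Fc F0 hom] int[OF y] by (simp add: F_def)
    qed
  qed
qed

subsection \<open>Monotonicity of the symmetrized weight\<close>

text \<open>This is the second derivative of (m + 3/2) ln (1 + z) - (1/2) ln (1 - z) - m ln (1 +
  \<kappa> z), and only its first term is negative. For z <= 0 the last term alone outweighs it,
  since 1 + \<kappa> z <= 1 + z and m \<kappa>^2 >= m + 2 + 1/m. For z > 0 both positive terms are
  combined.\<close>

lemma log_weight_second_derivative_pos:
  fixes m \<kappa> z :: real
  assumes m: "1/2 \<le> m" and \<kappa>: "(m + 1) / m \<le> \<kappa>" and z: "\<bar>z\<bar> < 1" "\<kappa> * \<bar>z\<bar> < 1"
  shows "0 < - (m + 3/2) / (1 + z)\<^sup>2 + (1/2) / (1 - z)\<^sup>2 + m * \<kappa>\<^sup>2 / (1 + \<kappa> * z)\<^sup>2"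
proof -
  have m0: "0 < m" using m by simp
  have \<kappa>1: "1 < \<kappa>" using \<kappa> m0 by (smt (verit) less_divide_eq_1_pos)
  have z1: "0 < 1 + z" "0 < 1 - z" using z by auto
  have "\<bar>\<kappa> * z\<bar> < 1" using z \<kappa>1 by (simp add: abs_mult)
  then have kz: "0 < 1 + \<kappa> * z" by linarith
  show ?thesis
  proof (cases "z \<le> 0")
    case True
    have "1 + \<kappa> * z \<le> 1 + z" using mult_right_mono_neg[of 1 \<kappa> z] True \<kappa>1 by simp
    then have "(1 + \<kappa> * z)\<^sup>2 \<le> (1 + z)\<^sup>2" using kz by (intro power_mono) auto
    then have a: "m * \<kappa>\<^sup>2 / (1 + z)\<^sup>2 \<le> m * \<kappa>\<^sup>2 / (1 + \<kappa> * z)\<^sup>2"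
      using kz m0 by (intro divide_left_mono mult_pos_pos) auto
    have "((m + 1) / m)\<^sup>2 \<le> \<kappa>\<^sup>2" using \<kappa> m0 by (intro power_mono) auto
    then have "m * ((m + 1) / m)\<^sup>2 \<le> m * \<kappa>\<^sup>2" using m0 by simp
    moreover have "m * ((m + 1) / m)\<^sup>2 = m + 2 + 1 / m"
      using m0 by (simp add: field_simps power2_eq_square)
    moreover have "0 < 1/m" using m0 by simp
    ultimately have "m + 3/2 \<le> m * \<kappa>\<^sup>2" by linarith
    then have "(m + 3/2) / (1 + z)\<^sup>2 \<le> m * \<kappa>\<^sup>2 / (1 + z)\<^sup>2"
      by (intro divide_right_mono) auto
    moreover have "0 < (1/2) / (1 - z)\<^sup>2" using z1 by simp
    moreover have "- (m + 3/2) / (1 + z)\<^sup>2 = - ((m + 3/2) / (1 + z)\<^sup>2)" by (simp only: minus_divide_left)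
    ultimately show ?thesis using a by linarith
  next
    case False
    then have z0: "0 < z" by simp
    \<comment> \<open>An upper bound for 1/\<kappa>. For z > 0 the last term equals m / (1/\<kappa>
      + z)^2, so it is smallest when 1/\<kappa> is replaced by k. The assumption m >= 1/2 enters
      here as k >= 1/3.\<close>
    define k where "k = m / (m + 1)"
    have k: "0 < k" "1/3 \<le> k" "1/\<kappa> \<le> k"
      using m m0 \<kappa> \<kappa>1 by (auto simp: k_def field_simps)
    have "m * \<kappa>\<^sup>2 / (1 + \<kappa> * z)\<^sup>2 = m / (1/\<kappa> + z)\<^sup>2"
      using \<kappa>1 kz z0 by (simp add: field_simps power2_eq_square)
    also have "\<dots> \<ge> m / (k + z)\<^sup>2"
      using k z0 m0 \<kappa>1 add_pos_pos[of "1/\<kappa>" z] by (intro divide_left_mono mult_pos_pos power_mono) auto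
    finally have a: "m / (k + z)\<^sup>2 \<le> m * \<kappa>\<^sup>2 / (1 + \<kappa> * z)\<^sup>2" .
    have "(1 + z) / (k + z) = 1 + (1 - k) / (k + z)" using k z0 by (simp add: field_simps)
    then have "((1 + z) / (k + z))\<^sup>2 \<ge> 1 + 2 * ((1 - k) / (k + z))"
      by (simp add: power2_sum)
    then have "m * (1 + 2 * ((1 - k) / (k + z))) \<le> m * ((1 + z) / (k + z))\<^sup>2"
      using m0 by simp
    moreover have "m * (2 * ((1 - k) / (k + z))) \<ge> 2 / (1 + 3 * z)"
    proof -
      have "m * (1 - k) = k" using m0 by (simp add: k_def field_simps)
      then have "m * (2 * ((1 - k) / (k + z))) = 2 * k / (k + z)"
        by (metis mult.assoc mult.left_commute times_divide_eq_right)
      moreover have "2 / (1 + 3 * z) \<le> 2 * k / (k + z)"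
      proof -
        have "1 * z \<le> (3 * k) * z" using k z0 by (intro mult_right_mono) auto
        then have "2 * (k + z) \<le> 2 * k * (1 + 3 * z)" by (simp add: algebra_simps)
        then show ?thesis using k z0 by (simp add: divide_le_eq le_divide_eq frac_le_eq field_simps)
      qed
      ultimately show ?thesis by (simp only:)
    qed
    ultimately have b: "m + 2 / (1 + 3 * z) \<le> m * ((1 + z) / (k + z))\<^sup>2"
      by (simp add: distrib_left)
    have c: "(1/2) * (1 + 4 * z) \<le> (1/2) * ((1 + z) / (1 - z))\<^sup>2"
    proof -
      have "(1 + z)\<^sup>2 - (1 + 4 * z) * (1 - z)\<^sup>2 = 4 * z\<^sup>2 * (2 - z)" by algebra
      moreover have "0 \<le> 4 * z\<^sup>2 * (2 - z)" using z1 by simp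
      ultimately have "(1 + 4 * z) * (1 - z)\<^sup>2 \<le> (1 + z)\<^sup>2" by linarith
      then have "1 + 4 * z \<le> (1 + z)\<^sup>2 / (1 - z)\<^sup>2" using z1 by (simp add: le_divide_eq)
      then show ?thesis by (simp add: power_divide)
    qed
    \<comment> \<open>After multiplication by (1 + z)^2 the two positive terms are at least m + 2 /
      (1 + 3 z) and (1 + 4 z) / 2. Their sum has to exceed m + 3/2, which reduces to 1 - z + 6 z^2 >
      0.\<close>
    have dd: "3/2 < 2 / (1 + 3 * z) + (1/2) * (1 + 4 * z)"
    proof -
      have "2 - (1 - 2 * z) * (1 + 3 * z) = 1 - z + 6 * z\<^sup>2" by algebra
      moreover have "0 < 1 - z + 6 * z\<^sup>2" using z1 by (simp add: add_pos_nonneg)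
      ultimately have "1 - 2 * z < 2 / (1 + 3 * z)" using z0 by (simp add: less_divide_eq)
      moreover have "3/2 < X + (1/2) * (1 + 4 * z)" if "1 - 2 * z < X" for X
        using that by (simp add: field_simps)
      ultimately show ?thesis by blast
    qed
    have "0 < - (m + 3/2) + (1/2) * ((1 + z) / (1 - z))\<^sup>2 + m * ((1 + z) / (k + z))\<^sup>2"
      using b c dd by linarith
    then have "0 < (- (m + 3/2) + (1/2) * ((1 + z) / (1 - z))\<^sup>2 + m * ((1 + z) / (k + z))\<^sup>2) / (1 + z)\<^sup>2"
      using z1 by simp
    also have "\<dots> = - (m + 3/2) / (1 + z)\<^sup>2 + (1/2) / (1 - z)\<^sup>2 + m / (k + z)\<^sup>2"
    proof -
      have "((1 + z) / w)\<^sup>2 / (1 + z)\<^sup>2 = 1 / w\<^sup>2" for w using z1 by (simp add: power_divide)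
      then show ?thesis
        by (simp only: add_divide_distrib times_divide_eq_right[symmetric]) simp
    qed
    finally show ?thesis using a by linarith
  qed
qed

text \<open>exp L is strictly convex, its second derivative being exp L times L'^2 + L''. Its
  derivative f is therefore strictly increasing, and the even part has derivative f z - f (-z) > 0
  for z > 0.\<close>

lemma exp_convex_symmetrization_mono:
  fixes L L' L'' :: "real \<Rightarrow> real"
  assumes L: "\<And>z. \<bar>z\<bar> < b \<Longrightarrow> (L has_real_derivative L' z) (at z)"
    and L': "\<And>z. \<bar>z\<bar> < b \<Longrightarrow> (L' has_real_derivative L'' z) (at z)"
    and pos: "\<And>z. \<bar>z\<bar> < b \<Longrightarrow> 0 < L'' z"
    and st: "0 \<le> s" "s < t" "t < b"
  shows "exp (L s) + exp (L (- s)) < exp (L t) + exp (L (- t))"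
proof (rule DERIV_pos_imp_increasing_open[OF st(2)])
  define f where "f z = exp (L z) * L' z" for z
  have f: "(f has_real_derivative exp (L z) * ((L' z)\<^sup>2 + L'' z)) (at z)" if "\<bar>z\<bar> < b" for z
    unfolding f_def by (auto intro!: derivative_eq_intros L[OF that] L'[OF that] simp: algebra_simps power2_eq_square)
  have finc: "f (- z) < f z" if "0 < z" "z < b" for z
  proof (rule DERIV_pos_imp_increasing[where f = f])
    show "- z < z" using that by simp
    fix x assume "- z \<le> x" "x \<le> z"
    then have x: "\<bar>x\<bar> < b" using that by auto
    show "\<exists>y. (f has_real_derivative y) (at x) \<and> 0 < y"
      by (intro exI conjI, rule f[OF x]) (simp add: add_nonneg_pos pos[OF x])
  qed
  have der: "((\<lambda>z. exp (L z) + exp (L (- z))) has_real_derivative f z - f (- z)) (at z)" if "\<bar>z\<bar> < b" for z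
  proof -
    have "((\<lambda>z. L (- z)) has_real_derivative L' (- z) * (- 1)) (at z)"
      by (rule DERIV_chain2[where g=uminus]) (use that L in \<open>auto intro!: derivative_eq_intros\<close>)
    then show ?thesis
      unfolding f_def by (auto intro!: derivative_eq_intros L[OF that])
  qed
  show "\<exists>y. ((\<lambda>z. exp (L z) + exp (L (- z))) has_real_derivative y) (at x) \<and> 0 < y" if "s < x" "x < t" for x
    using der[of x] finc[of x] that st by (intro exI conjI) auto
  show "continuous_on {s..t} (\<lambda>z. exp (L z) + exp (L (- z)))"
    by (intro continuous_at_imp_continuous_on ballI, rule DERIV_isCont, rule der) (use st in auto)
qed

text \<open>F is the weight in the coordinate z, with m = n/2 - 1 and \<kappa> = \<tau>/p, so the
  bound on \<kappa> reads n / (n - 2) <= \<tau>/p. As \<kappa> > 1, all three bases are positive for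
  |z| < 1/\<kappa>, where F = exp L.\<close>

lemma symmetrized_weight_mono:
  fixes m \<kappa> s t :: real
  defines "F \<equiv> \<lambda>z. (1 + z) powr (m + 3/2) * (1 - z) powr (- 1/2) * (1 + \<kappa> * z) powr (- m)"
  assumes m: "1/2 \<le> m" and \<kappa>: "(m + 1) / m \<le> \<kappa>" and st: "0 \<le> s" "s < t" "\<kappa> * t < 1"
  shows "F s + F (- s) < F t + F (- t)"
proof -
  define L where "L z = (m + 3/2) * ln (1 + z) - (1/2) * ln (1 - z) - m * ln (1 + \<kappa> * z)" for z
  define L' where "L' z = (m + 3/2) / (1 + z) + (1/2) / (1 - z) - m * \<kappa> / (1 + \<kappa> * z)" for z
  have m0: "0 < m" using m by simp
  have \<kappa>1: "1 < \<kappa>" using \<kappa> m0 by (smt (verit) less_divide_eq_1_pos)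
  have bnd: "\<bar>z\<bar> < 1" "\<kappa> * \<bar>z\<bar> < 1" "0 < 1 + z" "0 < 1 - z" "0 < 1 + \<kappa> * z" if "\<bar>z\<bar> < 1/\<kappa>" for z
  proof -
    show kz: "\<kappa> * \<bar>z\<bar> < 1" using that \<kappa>1 by (simp add: field_simps)
    have "\<bar>z\<bar> \<le> \<kappa> * \<bar>z\<bar>" using \<kappa>1 by (simp add: mult_le_cancel_right1)
    then show z1: "\<bar>z\<bar> < 1" using kz by simp
    show "0 < 1 + z" "0 < 1 - z" using z1 by auto
    have "\<bar>\<kappa> * z\<bar> < 1" using kz \<kappa>1 by (simp add: abs_mult)
    then show "0 < 1 + \<kappa> * z" by linarith
  qed
  have FL: "F z = exp (L z)" if "\<bar>z\<bar> < 1/\<kappa>" for z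
    using bnd[OF that] by (simp add: F_def L_def powr_def exp_add[symmetric])
  have "exp (L s) + exp (L (- s)) < exp (L t) + exp (L (- t))"
  proof (rule exp_convex_symmetrization_mono[where b = "1/\<kappa>" and L' = L'])
    show "(L has_real_derivative L' z) (at z)" if "\<bar>z\<bar> < 1/\<kappa>" for z
    proof -
      have ln: "((\<lambda>z. ln (1 + c * z)) has_real_derivative c / (1 + c * z)) (at z)" if "0 < 1 + c * z" for c
        using that by (auto intro!: derivative_eq_intros)
      have "((\<lambda>z. (m + 3/2) * ln (1 + 1 * z) - (1/2) * ln (1 + (- 1) * z) - m * ln (1 + \<kappa> * z)) has_real_derivative
          (m + 3/2) * (1 / (1 + 1 * z)) - (1/2) * ((- 1) / (1 + (- 1) * z)) - m * (\<kappa> / (1 + \<kappa> * z))) (at z)"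
        using bnd[OF that] by (intro DERIV_diff DERIV_cmult ln) auto
      then show ?thesis unfolding L_def L'_def by simp
    qed
    show "(L' has_real_derivative - (m + 3/2) / (1 + z)\<^sup>2 + (1/2) / (1 - z)\<^sup>2 + m * \<kappa>\<^sup>2 / (1 + \<kappa> * z)\<^sup>2) (at z)"
      if "\<bar>z\<bar> < 1/\<kappa>" for z
    proof -
      have inv: "((\<lambda>z. 1 / (1 + c * z)) has_real_derivative - c / (1 + c * z)\<^sup>2) (at z)" if "0 < 1 + c * z" for c
        using that by (auto intro!: derivative_eq_intros simp: power2_eq_square)
      have "((\<lambda>z. (m + 3/2) * (1 / (1 + 1 * z)) + (1/2) * (1 / (1 + (- 1) * z)) - (m * \<kappa>) * (1 / (1 + \<kappa> * z))) has_real_derivative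
          (m + 3/2) * (- 1 / (1 + 1 * z)\<^sup>2) + (1/2) * (- (- 1) / (1 + (- 1) * z)\<^sup>2) - (m * \<kappa>) * (- \<kappa> / (1 + \<kappa> * z)\<^sup>2)) (at z)"
        using bnd[OF that] by (intro DERIV_diff DERIV_add DERIV_cmult inv) auto
      moreover have "(m + 3/2) * (- 1 / (1 + 1 * z)\<^sup>2) + (1/2) * (- (- 1) / (1 + (- 1) * z)\<^sup>2) - (m * \<kappa>) * (- \<kappa> / (1 + \<kappa> * z)\<^sup>2)
          = - (m + 3/2) / (1 + z)\<^sup>2 + (1/2) / (1 - z)\<^sup>2 + m * \<kappa>\<^sup>2 / (1 + \<kappa> * z)\<^sup>2"
        by (simp add: power2_eq_square[of \<kappa>] diff_divide_distrib add_divide_distrib mult.assoc)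
      moreover have "(\<lambda>z. (m + 3/2) * (1 / (1 + 1 * z)) + (1/2) * (1 / (1 + (- 1) * z)) - (m * \<kappa>) * (1 / (1 + \<kappa> * z))) = L'"
        by (simp add: L'_def fun_eq_iff)
      ultimately show ?thesis by (simp only:)
    qed
    show "0 < - (m + 3/2) / (1 + z)\<^sup>2 + (1/2) / (1 - z)\<^sup>2 + m * \<kappa>\<^sup>2 / (1 + \<kappa> * z)\<^sup>2"
      if "\<bar>z\<bar> < 1/\<kappa>" for z
      using log_weight_second_derivative_pos[OF m \<kappa>] bnd[OF that] by blast
  qed (use st \<kappa>1 in \<open>auto simp: field_simps\<close>)
  moreover have "\<bar>s\<bar> < 1/\<kappa>" "\<bar>t\<bar> < 1/\<kappa>" using st \<kappa>1 by (auto simp: field_simps intro: order_le_less_trans[OF mult_left_mono[of s t]])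
  ultimately show ?thesis by (simp add: FL)
qed

subsection \<open>The radial direction maximizes the weighted cosine transform\<close>

lemma integral_shell_measure_pos:
  fixes f :: "'a::euclidean_space \<Rightarrow> real"
  assumes f: "continuous_on shell f" "\<And>w. w \<in> shell \<Longrightarrow> 0 \<le> f w"
    and w: "1 < norm w" "norm w < 2" "0 < f w"
  shows "0 < (\<integral>w. f w \<partial>shell_measure)"
proof -
  define O' where "O' = {w::'a. 1 < norm w} \<inter> {w. norm w < 2}"
  have O': "open O'" "w \<in> O'" "O' \<subseteq> shell"
    unfolding O'_def by (intro open_Int open_Collect_less continuous_intros) (use w in \<open>auto simp: shell_def\<close>)
  have "isCont f w"
    using continuous_on_subset[OF f(1) O'(3)] O' by (simp add: continuous_on_eq_continuous_at)
  then have "\<forall>\<^sub>F v in nhds w. f w / 2 < f v"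
    using w(3) by (intro order_tendstoD(1)[where y = "f w"]) (auto simp: isCont_def tendsto_at_iff_tendsto_nhds)
  then have "\<forall>\<^sub>F v in nhds w. f w / 2 < f v \<and> v \<in> O'"
    using O' by (intro eventually_conj eventually_nhds_in_open)
  then obtain r where r: "0 < r" "\<And>v. v \<in> ball w r \<Longrightarrow> f w / 2 < f v \<and> v \<in> O'"
    unfolding eventually_nhds_metric by (auto simp: dist_commute)
  let ?B = "ball w r"
  have B: "?B \<subseteq> shell" using r(2) O'(3) by blast
  have int1: "integrable shell_measure (\<lambda>w::'a. 1::real)"
    by (intro integrable_shell_measure continuous_intros)
  have Bs: "?B \<in> sets shell_measure"
    unfolding shell_measure_def using B by (auto simp: sets_restrict_space_iff)
  have meas: "measure shell_measure ?B = measure lborel ?B"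
    unfolding shell_measure_def using B by (intro measure_restrict_space) auto
  have "0 < f w / 2 * measure shell_measure ?B"
    unfolding meas using w(3) r(1) by (simp add: content_ball_pos)
  also have "\<dots> = (\<integral>v. f w / 2 * indicator ?B v \<partial>shell_measure)"
    using Bs B by (simp add: Int_absorb1 Int_commute)
  also have "\<dots> \<le> (\<integral>v. f v \<partial>shell_measure)"
  proof (rule integral_mono)
    show "integrable shell_measure (\<lambda>v. f w / 2 * indicator ?B v)"
      using integrable_mult_indicator[OF Bs int1] by simp
    show "integrable shell_measure f" by (rule integrable_shell_measure[OF f(1)])
    show "f w / 2 * indicator ?B v \<le> f v" if "v \<in> space shell_measure" for v
      using r(2)[of v] f(2)[of v] that by (auto simp: indicator_def)
  qed
  finally show ?thesis .
qed

text \<open>The Householder reflection along e - l exchanges the two unit vectors. It is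
  self-adjoint, so the exchange can be stated through inner products.\<close>

lemma reflection_swapping:
  fixes e l :: "'a::euclidean_space"
  assumes "norm e = 1" "norm l = 1" "e \<noteq> l"
  obtains T where "orthogonal_transformation T" "\<And>w. T w \<bullet> e = w \<bullet> l" "\<And>w. T w \<bullet> l = w \<bullet> e"
proof -
  define v where "v = e - l"
  define T where "T w = w - (2 * (w \<bullet> v) / (v \<bullet> v)) *\<^sub>R v" for w
  have ee: "e \<bullet> e = 1" "l \<bullet> l = 1" using assms by (simp_all add: dot_square_norm)
  have vv: "v \<bullet> v \<noteq> 0" using assms by (simp add: v_def)
  have vv2: "v \<bullet> v = 2 * (v \<bullet> e)" "v \<bullet> v = - 2 * (v \<bullet> l)"
    by (simp_all add: v_def inner_diff ee inner_commute[of l e])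
  show thesis
  proof
    show "orthogonal_transformation T"
      unfolding orthogonal_transformation_def
    proof (intro conjI allI)
      show "linear T"
        unfolding T_def by (rule linearI) (simp_all add: inner_add_left add_divide_distrib distrib_left scaleR_add_left algebra_simps)
      show "T a \<bullet> T b = a \<bullet> b" for a b
        unfolding T_def using vv by (simp add: inner_diff inner_commute[of v b] inner_commute[of v a])
    qed
    show "T w \<bullet> e = w \<bullet> l" for w
    proof -
      have "T w \<bullet> e = w \<bullet> e - (w \<bullet> v) * (2 * (v \<bullet> e)) / (v \<bullet> v)" by (simp add: T_def inner_diff_left)
      also have "\<dots> = w \<bullet> l" unfolding vv2(1)[symmetric] using vv by (simp add: v_def inner_diff_right)
      finally show ?thesis .
    qed
    show "T w \<bullet> l = w \<bullet> e" for w
    proof -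
      have "T w \<bullet> l = w \<bullet> l + (w \<bullet> v) * (- 2 * (v \<bullet> l)) / (v \<bullet> v)" by (simp add: T_def inner_diff_left)
      also have "\<dots> = w \<bullet> e" unfolding vv2(2)[symmetric] using vv by (simp add: v_def inner_diff_right)
      finally show ?thesis .
    qed
  qed
qed

text \<open>Averaging the difference of both sides over the reflection that swaps \<open>e\<close> and \<open>l\<close> makes the integrand a
  product of two factors of the same sign.\<close>

lemma cosine_transform_strict_max:
  fixes e l :: "'a::euclidean_space" and W :: "'a \<Rightarrow> real"
  assumes e: "norm e = 1" and l: "norm l = 1" "l \<noteq> e" "l \<noteq> - e"
    and W: "continuous_on shell W" "\<And>w. w \<in> shell \<Longrightarrow> 0 \<le> W w"
    and mono: "\<And>v w. v \<in> shell \<Longrightarrow> norm v = norm w \<Longrightarrow> \<bar>v \<bullet> e\<bar> < \<bar>w \<bullet> e\<bar> \<Longrightarrow> W v + W (- v) < W w + W (- w)"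
  shows "(\<integral>w. \<bar>w \<bullet> l\<bar> * W w \<partial>shell_measure) < (\<integral>w. \<bar>w \<bullet> e\<bar> * W w \<partial>shell_measure)"
proof -
  obtain T where T: "orthogonal_transformation T" and Te: "\<And>w. T w \<bullet> e = w \<bullet> l" and Tl: "\<And>w. T w \<bullet> l = w \<bullet> e"
    using reflection_swapping[OF e l(1)] l(2) by metis
  \<comment> \<open>|w . u| is even in w, so W may be replaced by its symmetrization, which is what
    the hypothesis \<open>mono\<close> controls.\<close>
  define V where "V w = W w + W (- w)" for w
  have ms: "- w \<in> shell \<longleftrightarrow> w \<in> shell" for w :: 'a by (simp add: shell_def)
  have Ts: "T w \<in> shell \<longleftrightarrow> w \<in> shell" for w by (rule orthogonal_transformation_shell[OF T])
  have om: "orthogonal_transformation (uminus :: 'a \<Rightarrow> 'a)"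
    by (simp add: orthogonal_transformation_def linear_uminus)
  have Wm: "continuous_on shell (\<lambda>w. W (- w))"
    by (rule continuous_on_compose2[OF W(1)]) (auto simp: ms intro!: continuous_intros)
  have Vc: "continuous_on shell V" unfolding V_def by (intro continuous_on_add W(1) Wm)
  have V0: "w \<in> shell \<Longrightarrow> 0 \<le> V w" for w using W(2)[of w] W(2)[of "- w"] by (simp add: V_def ms)
  have Tc: "continuous_on A T" for A
    using orthogonal_transformation_linear[OF T] by (intro linear_continuous_on) (simp add: linear_conv_bounded_linear)
  have VTc: "continuous_on shell (\<lambda>w. V (T w))"
    by (rule continuous_on_compose2[OF Vc Tc]) (auto simp: Ts)
  have two: "2 * (\<integral>w. \<bar>w \<bullet> u\<bar> * W w \<partial>shell_measure) = (\<integral>w. \<bar>w \<bullet> u\<bar> * V w \<partial>shell_measure)" for u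
  proof -
    have c: "continuous_on shell (\<lambda>w. \<bar>w \<bullet> u\<bar> * W w)" "continuous_on shell (\<lambda>w. \<bar>w \<bullet> u\<bar> * W (- w))"
      by (intro continuous_intros W Wm)+
    have "(\<integral>w. \<bar>(- w) \<bullet> u\<bar> * W (- w) \<partial>shell_measure) = (\<integral>w. \<bar>w \<bullet> u\<bar> * W w \<partial>shell_measure)"
      by (rule integral_shell_measure_orthogonal[OF om c(1)]) (simp add: W)
    then show ?thesis
      unfolding V_def distrib_left
      by (subst Bochner_Integration.integral_add) (use c in \<open>auto intro!: integrable_shell_measure\<close>)
  qed
  have swap: "(\<integral>w. \<bar>w \<bullet> e\<bar> * V w \<partial>shell_measure) = (\<integral>w. \<bar>w \<bullet> l\<bar> * V (T w) \<partial>shell_measure)"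
    "(\<integral>w. \<bar>w \<bullet> l\<bar> * V w \<partial>shell_measure) = (\<integral>w. \<bar>w \<bullet> e\<bar> * V (T w) \<partial>shell_measure)"
  proof -
    have "(\<integral>w. \<bar>T w \<bullet> u\<bar> * V (T w) \<partial>shell_measure) = (\<integral>w. \<bar>w \<bullet> u\<bar> * V w \<partial>shell_measure)" for u
      by (rule integral_shell_measure_orthogonal[OF T, of "\<lambda>w. \<bar>w \<bullet> u\<bar> * V w"])
        (auto intro!: continuous_intros mult_nonneg_nonneg Vc V0)
    from this[of e] this[of l] show "(\<integral>w. \<bar>w \<bullet> e\<bar> * V w \<partial>shell_measure) = (\<integral>w. \<bar>w \<bullet> l\<bar> * V (T w) \<partial>shell_measure)"
      "(\<integral>w. \<bar>w \<bullet> l\<bar> * V w \<partial>shell_measure) = (\<integral>w. \<bar>w \<bullet> e\<bar> * V (T w) \<partial>shell_measure)"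
      by (simp_all add: Te Tl)
  qed
  \<comment> \<open>The integral of H is four times the difference of the two transforms of W: one
    factor 2 comes from adding the reflected copy, the other from the symmetrization.\<close>
  define H where "H w = (\<bar>w \<bullet> e\<bar> - \<bar>w \<bullet> l\<bar>) * (V w - V (T w))" for w
  have nT: "norm (T w) = norm w" for w by (rule orthogonal_transformation_norm[OF T])
  have Vlt: "\<bar>w \<bullet> l\<bar> < \<bar>w \<bullet> e\<bar> \<Longrightarrow> V (T w) < V w" "\<bar>w \<bullet> e\<bar> < \<bar>w \<bullet> l\<bar> \<Longrightarrow> V w < V (T w)" if "w \<in> shell" for w
    using mono[of "T w" w] mono[of w "T w"] that by (auto simp: V_def Te nT Ts)
  have Hc: "continuous_on shell H" unfolding H_def by (intro continuous_intros Vc VTc)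
  have H0: "0 \<le> H w" if "w \<in> shell" for w
  proof (cases "\<bar>w \<bullet> l\<bar>" "\<bar>w \<bullet> e\<bar>" rule: linorder_cases)
    case less then show ?thesis using Vlt(1)[OF that less] by (simp add: H_def)
  next
    case equal then show ?thesis by (simp add: H_def)
  next
    case greater then show ?thesis using Vlt(2)[OF that greater] by (simp add: H_def mult_nonpos_nonpos)
  qed
  \<comment> \<open>Strictness needs a single point where H > 0 in the open shell. The radius 3/2 is
    interior, and |e . l| < 1 by the equality case of Cauchy-Schwarz.\<close>
  have Hpos: "0 < H ((3/2) *\<^sub>R e)"
  proof -
    have ee: "e \<bullet> e = 1" using e by (simp add: dot_square_norm)
    have "\<bar>e \<bullet> l\<bar> \<noteq> norm e * norm l"
      using l e norm_cauchy_schwarz_abs_eq[of e l] by (auto simp: eq_neg_iff_add_eq_0)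
    then have "\<bar>e \<bullet> l\<bar> < 1" using Cauchy_Schwarz_ineq2[of e l] e l by simp
    then have "\<bar>((3/2) *\<^sub>R e) \<bullet> l\<bar> < \<bar>((3/2) *\<^sub>R e) \<bullet> e\<bar>" by (simp add: abs_mult ee)
    moreover have "(3/2) *\<^sub>R e \<in> shell" using e by (simp add: shell_def)
    ultimately show ?thesis using Vlt(1)[of "(3/2) *\<^sub>R e"] unfolding H_def by (intro mult_pos_pos) auto
  qed
  have "0 < (\<integral>w. H w \<partial>shell_measure)"
    by (rule integral_shell_measure_pos[OF Hc H0 _ _ Hpos]) (use e in auto)
  also have "(\<integral>w. H w \<partial>shell_measure)
      = (\<integral>w. (\<bar>w \<bullet> e\<bar> * V w + \<bar>w \<bullet> l\<bar> * V (T w)) - (\<bar>w \<bullet> l\<bar> * V w + \<bar>w \<bullet> e\<bar> * V (T w)) \<partial>shell_measure)"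
    unfolding H_def by (simp add: algebra_simps)
  also have "\<dots> = ((\<integral>w. \<bar>w \<bullet> e\<bar> * V w \<partial>shell_measure) + (\<integral>w. \<bar>w \<bullet> l\<bar> * V (T w) \<partial>shell_measure))
      - ((\<integral>w. \<bar>w \<bullet> l\<bar> * V w \<partial>shell_measure) + (\<integral>w. \<bar>w \<bullet> e\<bar> * V (T w) \<partial>shell_measure))"
    by (subst Bochner_Integration.integral_diff Bochner_Integration.integral_add;
        (intro integrable_shell_measure continuous_intros Vc VTc)?)+ (rule refl)
  also have "\<dots> = 2 * (2 * (\<integral>w. \<bar>w \<bullet> e\<bar> * W w \<partial>shell_measure)) - 2 * (2 * (\<integral>w. \<bar>w \<bullet> l\<bar> * W w \<partial>shell_measure))"
    unfolding two swap by simp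
  finally show ?thesis by simp
qed

section \<open>The stretch and the explicit form of the weight\<close>

definition stretch :: "'a::real_inner \<Rightarrow> real \<Rightarrow> 'a \<Rightarrow> 'a" where
  "stretch e \<delta> w = (w \<bullet> e) *\<^sub>R e + \<delta> *\<^sub>R (w - (w \<bullet> e) *\<^sub>R e)"

lemma linear_stretch: "linear (stretch e \<delta>)"
  unfolding stretch_def by (rule linearI) (simp_all add: inner_add_left algebra_simps)

lemma stretch_inner:
  assumes "norm e = 1"
  shows "stretch e \<delta> w \<bullet> e = w \<bullet> e"
    and "stretch e \<delta> w \<bullet> l = (w \<bullet> e) * (e \<bullet> l) + \<delta> * (w \<bullet> l - (w \<bullet> e) * (e \<bullet> l))"
    and "stretch e \<delta> w \<bullet> stretch e \<delta> w = \<delta>\<^sup>2 * (w \<bullet> w) + (1 - \<delta>\<^sup>2) * (w \<bullet> e)\<^sup>2"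
proof -
  have ee: "e \<bullet> e = 1" using assms by (simp add: dot_square_norm)
  show "stretch e \<delta> w \<bullet> e = w \<bullet> e"
    and "stretch e \<delta> w \<bullet> l = (w \<bullet> e) * (e \<bullet> l) + \<delta> * (w \<bullet> l - (w \<bullet> e) * (e \<bullet> l))"
    by (simp_all add: stretch_def inner_add_left inner_diff_left ee)
  show "stretch e \<delta> w \<bullet> stretch e \<delta> w = \<delta>\<^sup>2 * (w \<bullet> w) + (1 - \<delta>\<^sup>2) * (w \<bullet> e)\<^sup>2"
    by (simp add: stretch_def inner_add inner_diff ee inner_commute[of e w] power2_eq_square algebra_simps)
qed

lemma stretch_eq_0:
  assumes "norm e = 1" "\<delta> \<noteq> 0"
  shows "stretch e \<delta> w = 0 \<longleftrightarrow> w = 0"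
proof
  assume *: "stretch e \<delta> w = 0"
  then have "w \<bullet> e = 0" using stretch_inner(1)[OF assms(1), of \<delta> w] by simp
  then show "w = 0" using * assms(2) by (simp add: stretch_def)
qed (simp add: stretch_def)

lemma bij_stretch:
  fixes e :: "'a::euclidean_space"
  assumes "norm e = 1" "\<delta> \<noteq> 0"
  shows "bij (stretch e \<delta>)"
proof -
  have "inj (stretch e \<delta>)"
    using stretch_eq_0[OF assms] by (simp add: linear_injective_0[OF linear_stretch])
  then show ?thesis
    using linear_injective_imp_surjective[OF linear_stretch] by (simp add: bij_def)
qed

text \<open>With \<open>n\<close> the dimension, \<open>\<delta>\<^sup>2 = 1 - p\<^sup>2\<close> and \<open>z = p (stretch e \<delta> w \<bullet> e) / \<bar>stretch e \<delta> w\<bar>\<close>, the weight on a sphere is a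
  constant times \<open>(1 + z)\<^bsup>(n+1)/2\<^esup> (1 - z)\<^bsup>-1/2\<^esup> (1 + (\<tau>/p) z)\<^bsup>1-n/2\<^esup>\<close>.\<close>

definition weight :: "real \<Rightarrow> 'a::real_inner \<Rightarrow> real \<Rightarrow> real \<Rightarrow> real \<Rightarrow> 'a \<Rightarrow> real" where
  "weight n e \<delta> p \<tau> w = norm (stretch e \<delta> w) powr (- n - 1)
     * (1 - p * ((stretch e \<delta> w /\<^sub>R norm (stretch e \<delta> w)) \<bullet> e)) powr (- n / 2 - 1)
     * (1 + \<tau> * ((stretch e \<delta> w /\<^sub>R norm (stretch e \<delta> w)) \<bullet> e)) powr (1 - n / 2)"

text \<open>With \<delta>^2 = 1 - p^2 one gets |stretch w|^2 = \<delta>^2 |w|^2 + p^2 (w . e)^2,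
  hence |stretch w|^2 (1 - z^2) = \<delta>^2 |w|^2. This trades the power of the stretched norm for
  powers of 1 + z and 1 - z, so only z varies on a sphere.\<close>

lemma weight_eq:
  fixes e w :: "'a::real_inner"
  assumes e: "norm e = 1" and p: "0 < p" "p < 1" and \<tau>: "0 < \<tau>" "\<tau> < 1" and \<delta>: "0 < \<delta>" "\<delta>\<^sup>2 = 1 - p\<^sup>2" and w: "w \<noteq> 0"
  defines "z \<equiv> p * (w \<bullet> e) / sqrt (\<delta>\<^sup>2 * (w \<bullet> w) + p\<^sup>2 * (w \<bullet> e)\<^sup>2)"
  shows "weight n e \<delta> p \<tau> w = (\<delta> * norm w) powr (- n - 1)
     * ((1 + z) powr ((n / 2 - 1) + 3/2) * (1 - z) powr (- 1/2) * (1 + \<tau> / p * z) powr (- (n / 2 - 1)))"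
    and "\<tau> / p * \<bar>z\<bar> < 1"
proof -
  define G where "G = norm (stretch e \<delta> w)"
  define a where "a = w \<bullet> e"
  have G0: "0 < G" using stretch_eq_0[OF e, of \<delta> w] \<delta> w by (simp add: G_def)
  have GG: "G\<^sup>2 = \<delta>\<^sup>2 * (w \<bullet> w) + p\<^sup>2 * a\<^sup>2"
    unfolding G_def power2_norm_eq_inner stretch_inner(3)[OF e] by (simp add: a_def \<delta>(2))
  have z: "z = p * a / G"
    unfolding z_def a_def[symmetric] GG[symmetric] using G0 by simp
  have ip: "(stretch e \<delta> w /\<^sub>R G) \<bullet> e = a / G"
    by (simp add: stretch_inner(1)[OF e] a_def divide_inverse mult.commute)
  have aG: "\<bar>a / G\<bar> \<le> 1"
  proof -
    have "\<bar>stretch e \<delta> w \<bullet> e\<bar> \<le> G" unfolding G_def using Cauchy_Schwarz_ineq2[of "stretch e \<delta> w" e] e by simp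
    then show ?thesis using G0 by (simp add: stretch_inner(1)[OF e] a_def)
  qed
  have "\<bar>\<tau> * (a / G)\<bar> \<le> \<tau> * 1" unfolding abs_mult using aG \<tau> by (intro mult_mono) auto
  then have \<tau>z: "\<bar>\<tau> * (a / G)\<bar> < 1" using \<tau> by simp
  have "\<bar>p * (a / G)\<bar> \<le> p * 1" unfolding abs_mult using aG p by (intro mult_mono) auto
  then have "\<bar>z\<bar> < 1" using p by (simp add: z)
  then have z1: "0 < 1 + z" "0 < 1 - z" by auto
  have \<kappa>z: "\<tau> / p * z = \<tau> * (a / G)" using p by (simp add: z)
  have "\<tau> / p * \<bar>z\<bar> = \<bar>\<tau> / p * z\<bar>" using p \<tau> by (simp add: abs_mult)
  then show "\<tau> / p * \<bar>z\<bar> < 1" using \<tau>z unfolding \<kappa>z[symmetric] by (simp only:)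
  have "G\<^sup>2 * ((1 + z) * (1 - z)) = G\<^sup>2 - p\<^sup>2 * a\<^sup>2"
    using G0 by (simp add: z power2_eq_square field_simps)
  also have "\<dots> = (\<delta> * norm w)\<^sup>2" unfolding GG by (simp add: power_mult_distrib power2_norm_eq_inner)
  finally have eq: "G\<^sup>2 * ((1 + z) * (1 - z)) = (\<delta> * norm w)\<^sup>2" .
  have sqp: "(y\<^sup>2) powr (- (n + 1) / 2) = y powr (- n - 1)" if "0 < y" for y :: real
  proof -
    have "y powr 2 = y\<^sup>2" using that by (simp add: powr_numeral)
    moreover have "2 * (- (n + 1) / 2) = - n - 1" by simp
    ultimately show ?thesis using powr_powr[of y 2 "- (n + 1) / 2"] by (simp only:)
  qed
  have "G powr (- n - 1) * ((1 + z) powr (- (n + 1) / 2) * (1 - z) powr (- (n + 1) / 2))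
      = (G\<^sup>2 * ((1 + z) * (1 - z))) powr (- (n + 1) / 2)"
    using z1 by (simp only: sqp[OF G0, symmetric] powr_mult[symmetric] less_imp_le mult_nonneg_nonneg zero_le_power2)
  also have "\<dots> = (\<delta> * norm w) powr (- n - 1)"
    unfolding eq using \<delta> w by (intro sqp) simp
  finally have GR: "G powr (- n - 1) * ((1 + z) powr (- (n + 1) / 2) * (1 - z) powr (- (n + 1) / 2)) = (\<delta> * norm w) powr (- n - 1)" .
  have "- (n + 1) / 2 + (n + 1) / 2 = 0" by (simp add: field_simps)
  then have one: "(1 + z) powr (- (n + 1) / 2) * (1 + z) powr ((n + 1) / 2) = 1" "(1 - z) powr (- (n + 1) / 2) * (1 - z) powr ((n + 1) / 2) = 1"
    using z1 by (simp_all only: powr_add[symmetric]) simp_all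
  have "(\<delta> * norm w) powr (- n - 1) * ((1 + z) powr ((n + 1) / 2) * (1 - z) powr ((n + 1) / 2))
      = G powr (- n - 1) * ((1 + z) powr (- (n + 1) / 2) * (1 + z) powr ((n + 1) / 2)) * ((1 - z) powr (- (n + 1) / 2) * (1 - z) powr ((n + 1) / 2))"
    unfolding GR[symmetric] by (simp only: mult_ac)
  then have Gp: "G powr (- n - 1) = (\<delta> * norm w) powr (- n - 1) * ((1 + z) powr ((n + 1) / 2) * (1 - z) powr ((n + 1) / 2))"
    unfolding one by simp
  have zz: "(1 - z) powr ((n + 1) / 2) * (1 - z) powr (- n / 2 - 1) = (1 - z) powr (- 1/2)"
    using z1 by (simp add: field_simps flip: powr_add)
  have n: "(n / 2 - 1) + 3/2 = (n + 1) / 2" "- (n / 2 - 1) = 1 - n / 2" by (simp_all add: field_simps)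
  have "weight n e \<delta> p \<tau> w = G powr (- n - 1) * (1 - z) powr (- n / 2 - 1) * (1 + \<tau> / p * z) powr (1 - n / 2)"
    unfolding weight_def G_def[symmetric] ip \<kappa>z by (simp add: z)
  also have "\<dots> = (\<delta> * norm w) powr (- n - 1) * ((1 + z) powr ((n + 1) / 2) * ((1 - z) powr ((n + 1) / 2) * (1 - z) powr (- n / 2 - 1)) * (1 + \<tau> / p * z) powr (1 - n / 2))"
    unfolding Gp by (simp only: mult_ac)
  finally show "weight n e \<delta> p \<tau> w = (\<delta> * norm w) powr (- n - 1)
     * ((1 + z) powr ((n / 2 - 1) + 3/2) * (1 - z) powr (- 1/2) * (1 + \<tau> / p * z) powr (- (n / 2 - 1)))"
    unfolding zz n .
qed

text \<open>On a fixed sphere the coordinate z is an odd, strictly increasing function \<phi> of w .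
  e, so the comparison of |v . e| and |w . e| carries over to |z|.\<close>

lemma weight_symmetrized_mono:
  fixes e v w :: "'a::real_inner"
  assumes n: "3 \<le> n" and e: "norm e = 1" and p: "0 < p" "p < 1" and \<tau>: "0 < \<tau>" "\<tau> < 1" and \<delta>: "0 < \<delta>" "\<delta>\<^sup>2 = 1 - p\<^sup>2"
    and \<kappa>: "n / (n - 2) \<le> \<tau> / p"
    and vw: "v \<noteq> 0" "norm v = norm w" "\<bar>v \<bullet> e\<bar> < \<bar>w \<bullet> e\<bar>"
  shows "weight n e \<delta> p \<tau> v + weight n e \<delta> p \<tau> (- v) < weight n e \<delta> p \<tau> w + weight n e \<delta> p \<tau> (- w)"
proof -
  define m where "m = n / 2 - 1"
  define F where "F z = (1 + z) powr (m + 3/2) * (1 - z) powr (- 1/2) * (1 + \<tau> / p * z) powr (- m)" for z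
  define R where "R = w \<bullet> w"
  define \<phi> where "\<phi> a = p * a / sqrt (\<delta>\<^sup>2 * R + p\<^sup>2 * a\<^sup>2)" for a
  have w0: "w \<noteq> 0" using vw by auto
  have R0: "0 < R" using w0 by (simp add: R_def)
  have Rv: "v \<bullet> v = R" using vw(2) by (simp add: R_def dot_square_norm)
  have sym: "weight n e \<delta> p \<tau> u + weight n e \<delta> p \<tau> (- u) = (\<delta> * norm w) powr (- n - 1) * (F (\<phi> \<bar>u \<bullet> e\<bar>) + F (- \<phi> \<bar>u \<bullet> e\<bar>))"
    if u: "u \<noteq> 0" "norm u = norm w" for u
  proof -
    have uu: "u \<bullet> u = R" using u(2) by (simp add: R_def dot_square_norm)
    have "weight n e \<delta> p \<tau> u = (\<delta> * norm w) powr (- n - 1) * F (\<phi> (u \<bullet> e))"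
      "weight n e \<delta> p \<tau> (- u) = (\<delta> * norm w) powr (- n - 1) * F (- \<phi> (u \<bullet> e))"
      using weight_eq(1)[OF e p \<tau> \<delta>, of u n] weight_eq(1)[OF e p \<tau> \<delta>, of "- u" n] u
      by (simp_all add: F_def \<phi>_def m_def uu)
    moreover have "\<phi> \<bar>u \<bullet> e\<bar> = \<phi> (u \<bullet> e) \<or> \<phi> \<bar>u \<bullet> e\<bar> = - \<phi> (u \<bullet> e)"
      by (simp add: \<phi>_def abs_if)
    ultimately show ?thesis by (auto simp: distrib_left)
  qed
  have "F (\<phi> \<bar>v \<bullet> e\<bar>) + F (- \<phi> \<bar>v \<bullet> e\<bar>) < F (\<phi> \<bar>w \<bullet> e\<bar>) + F (- \<phi> \<bar>w \<bullet> e\<bar>)"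
    unfolding F_def
  proof (rule symmetrized_weight_mono)
    show "1/2 \<le> m" using n by (simp add: m_def)
    show "(m + 1) / m \<le> \<tau> / p" using \<kappa> n by (simp add: m_def field_simps)
    show "0 \<le> \<phi> \<bar>v \<bullet> e\<bar>" using p R0 by (simp add: \<phi>_def)
    have "\<phi> \<bar>w \<bullet> e\<bar> = \<bar>p * (w \<bullet> e) / sqrt (\<delta>\<^sup>2 * (w \<bullet> w) + p\<^sup>2 * (w \<bullet> e)\<^sup>2)\<bar>"
      using p R0 by (simp add: \<phi>_def abs_mult R_def)
    then show "\<tau> / p * \<phi> \<bar>w \<bullet> e\<bar> < 1"
      using weight_eq(2)[OF e p \<tau> \<delta> w0] by simp
    show "\<phi> \<bar>v \<bullet> e\<bar> < \<phi> \<bar>w \<bullet> e\<bar>"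
    proof -
      define a b where "a = \<bar>v \<bullet> e\<bar>" and "b = \<bar>w \<bullet> e\<bar>"
      have ab: "0 \<le> a" "a < b" using vw by (auto simp: a_def b_def)
      have D: "0 < \<delta>\<^sup>2 * R + p\<^sup>2 * c\<^sup>2" for c using \<delta>(1) R0 by (simp add: add_pos_nonneg)
      have sq: "(\<phi> c)\<^sup>2 = p\<^sup>2 * c\<^sup>2 / (\<delta>\<^sup>2 * R + p\<^sup>2 * c\<^sup>2)" for c
        unfolding \<phi>_def power_divide using D[of c] by (simp add: power_mult_distrib)
      have "a\<^sup>2 < b\<^sup>2" using ab by (intro power_strict_mono) auto
      then have "p\<^sup>2 * a\<^sup>2 * (\<delta>\<^sup>2 * R) < p\<^sup>2 * b\<^sup>2 * (\<delta>\<^sup>2 * R)" using p \<delta>(1) R0 by simp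
      then have "(\<phi> a)\<^sup>2 < (\<phi> b)\<^sup>2"
        unfolding sq using D[of a] D[of b] by (simp add: frac_less_eq divide_less_eq less_divide_eq algebra_simps)
      moreover have "0 \<le> \<phi> b" using p ab D[of b] by (simp add: \<phi>_def)
      ultimately have "\<phi> a < \<phi> b" by (rule power2_less_imp_less)
      then show ?thesis by (simp add: a_def b_def)
    qed
  qed
  moreover have "0 < (\<delta> * norm w) powr (- n - 1)" using \<delta> w0 by simp
  ultimately show ?thesis
    unfolding sym[OF vw(1,2)] sym[OF w0 refl] by simp
qed

subsection \<open>The gradient of the Poisson kernel in boosted coordinates\<close>

text \<open>The relation with \<tau> - \<rho> says that the affine field -2 |x - z|^2 x - n (1 -
  \<rho>^2) (x - z) vanishes at z = \<tau>e, and it determines \<tau>. The relation before it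
  determines p, which comes out as (n - 2) \<rho> / n: the boosted |x - z|^2 is proportional to (1 -
  p (\<eta> . e)) / (1 + \<tau> (\<eta> . e)). The last one says that \<delta> is the ratio of the
  axial to the transverse coefficient of the boosted field. As n / (n - 2) = \<rho>/p, the bound on
  \<tau>/p amounts to \<rho> <= \<tau>.\<close>

lemma boost_parameters:
  fixes n \<rho> :: real
  assumes n: "3 \<le> n" and \<rho>: "0 < \<rho>" "\<rho> < 1"
  obtains \<tau> p \<delta> where "0 < \<tau>" "\<tau> < 1" "0 < p" "p < 1" "0 < \<delta>" "\<delta>\<^sup>2 = 1 - p\<^sup>2" "n / (n - 2) \<le> \<tau> / p"
    "0 < 1 + \<rho>\<^sup>2 - 2 * \<rho> * \<tau>"
    "2 * \<rho> - \<tau> * (1 + \<rho>\<^sup>2) = p * (1 + \<rho>\<^sup>2 - 2 * \<rho> * \<tau>)"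
    "n * (1 - \<rho>\<^sup>2) * (\<tau> - \<rho>) = 2 * \<rho> * (1 + \<rho>\<^sup>2 - 2 * \<rho> * \<tau>)"
    "2 * \<rho> * p * (1 + \<rho>\<^sup>2 - 2 * \<rho> * \<tau>) + n * (1 - \<rho>\<^sup>2) * (1 - \<rho> * \<tau>) = n * (1 - \<rho>\<^sup>2) * sqrt (1 - \<tau>\<^sup>2) * \<delta>"
proof -
  define r where "r = \<rho>\<^sup>2"
  define N where "N = n - (n - 4) * r"
  define \<tau> where "\<tau> = \<rho> * (n + 2 - (n - 2) * r) / N"
  define p where "p = (n - 2) * \<rho> / n"
  define \<delta> where "\<delta> = sqrt (1 - p\<^sup>2)"
  define Q where "Q = 1 + r - 2 * \<rho> * \<tau>"
  have r: "0 < r" "r < 1" unfolding r_def using \<rho> by (simp_all add: power_less_one_iff)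
  have N0: "0 < N"
  proof -
    have "N = n * (1 - r) + 4 * r" by (simp add: N_def algebra_simps)
    then show ?thesis using n r by (simp add: add_pos_pos)
  qed
  have \<tau>N: "\<tau> * N = \<rho> * (n + 2 - (n - 2) * r)" using N0 by (simp add: \<tau>_def)
  have np: "n * p = (n - 2) * \<rho>" using n by (simp add: p_def)
  have p0: "0 < p" using n \<rho> by (simp add: p_def)
  have p1: "p < 1"
  proof -
    have "(n - 2) * \<rho> < n * 1" using n \<rho> by (intro mult_strict_mono) auto
    then show ?thesis using n by (simp add: p_def)
  qed
  have \<delta>0: "0 < \<delta>" "\<delta>\<^sup>2 = 1 - p\<^sup>2"
    unfolding \<delta>_def using p0 p1 by (simp_all add: power_less_one_iff power_le_one)
  have np2: "n\<^sup>2 * p\<^sup>2 = (n - 2)\<^sup>2 * r" by (simp add: r_def np flip: power_mult_distrib)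
  have QN: "Q * N = n * (1 - r)\<^sup>2"
  proof -
    have "Q * N = (1 + r) * N - 2 * \<rho> * (\<tau> * N)" by (simp add: Q_def algebra_simps)
    also have "\<dots> = (1 + r) * N - 2 * r * (n + 2 - (n - 2) * r)" unfolding \<tau>N by (simp add: r_def power2_eq_square)
    also have "\<dots> = n * (1 - r)\<^sup>2" by (simp add: N_def power2_eq_square algebra_simps)
    finally show ?thesis .
  qed
  have pos2: "0 < n + 2 - (n - 2) * r"
  proof -
    have "(n - 2) * r \<le> (n - 2) * 1" using n r by (intro mult_left_mono) auto
    then show ?thesis by simp
  qed
  have \<tau>0: "0 < \<tau>" unfolding \<tau>_def using \<rho> N0 pos2 by simp
  \<comment> \<open>Here sqrt (1 - p^2) reappears inside 1 - \<tau>^2. This makes the coefficient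
    ratio of the last relation agree with \<delta>.\<close>
  have T2: "1 - \<tau>\<^sup>2 = (n * (1 - r) * \<delta> / N)\<^sup>2"
  proof -
    have "(1 - \<tau>\<^sup>2) * N\<^sup>2 = N\<^sup>2 - (\<tau> * N)\<^sup>2" by (simp add: algebra_simps power_mult_distrib)
    also have "\<dots> = N\<^sup>2 - r * (n + 2 - (n - 2) * r)\<^sup>2" unfolding \<tau>N by (simp add: r_def power_mult_distrib)
    also have "\<dots> = (1 - r)\<^sup>2 * (n\<^sup>2 - (n - 2)\<^sup>2 * r)" unfolding N_def by (simp add: power2_eq_square algebra_simps)
    also have "\<dots> = (n * (1 - r))\<^sup>2 * \<delta>\<^sup>2" unfolding \<delta>0(2) np2[symmetric] by algebra
    finally show ?thesis using N0 by (simp add: power_divide power_mult_distrib eq_divide_eq)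
  qed
  have Tpos: "0 < n * (1 - r) * \<delta> / N" using n r \<delta>0 N0 by simp
  have sq: "sqrt (1 - \<tau>\<^sup>2) = n * (1 - r) * \<delta> / N" unfolding T2 by (rule real_sqrt_unique[OF refl less_imp_le[OF Tpos]])
  have "\<tau>\<^sup>2 < 1" using T2 zero_less_power[OF Tpos, of 2] by linarith
  then have \<tau>1: "\<tau> < 1" using \<tau>0 by (simp add: power_less_one_iff)
  show thesis
  proof (rule that[of \<tau> p \<delta>])
    show "n / (n - 2) \<le> \<tau> / p"
    proof -
      have "N \<le> n + 2 - (n - 2) * r" using r by (simp add: N_def algebra_simps)
      then have "\<rho> * N \<le> \<tau> * N" unfolding \<tau>N using \<rho> by simp
      then have "\<rho> \<le> \<tau>" using N0 by simp
      then have "\<rho> / p \<le> \<tau> / p" using p0 by (intro divide_right_mono) auto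
      moreover have "n / (n - 2) = \<rho> / p" using n \<rho> by (simp add: p_def)
      ultimately show ?thesis by simp
    qed
    show "0 < 1 + \<rho>\<^sup>2 - 2 * \<rho> * \<tau>"
    proof -
      have "0 < Q * N" unfolding QN using n r by simp
      then show ?thesis using N0 by (simp add: Q_def r_def zero_less_mult_iff)
    qed
    show "2 * \<rho> - \<tau> * (1 + \<rho>\<^sup>2) = p * (1 + \<rho>\<^sup>2 - 2 * \<rho> * \<tau>)"
    proof -
      have "(2 * \<rho> - \<tau> * (1 + r)) * N = 2 * \<rho> * N - (1 + r) * (\<tau> * N)" by (simp add: algebra_simps)
      also have "\<dots> = (n - 2) * \<rho> * (1 - r)\<^sup>2" unfolding \<tau>N by (simp add: N_def power2_eq_square algebra_simps)
      also have "\<dots> = p * (Q * N)" unfolding QN np[symmetric] by (simp only: mult_ac)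
      also have "\<dots> = p * Q * N" by (simp only: mult_ac)
      finally show ?thesis using N0 by (simp add: Q_def r_def)
    qed
    show "n * (1 - \<rho>\<^sup>2) * (\<tau> - \<rho>) = 2 * \<rho> * (1 + \<rho>\<^sup>2 - 2 * \<rho> * \<tau>)"
    proof -
      have "n * (1 - r) * (\<tau> - \<rho>) * N = n * (1 - r) * (\<tau> * N - \<rho> * N)" by (simp add: algebra_simps)
      also have "\<dots> = 2 * \<rho> * (n * (1 - r)\<^sup>2)" unfolding \<tau>N by (simp add: N_def power2_eq_square algebra_simps)
      also have "\<dots> = 2 * \<rho> * Q * N" by (simp add: QN[symmetric])
      finally show ?thesis using N0 by (simp add: Q_def r_def)
    qed
    show "2 * \<rho> * p * (1 + \<rho>\<^sup>2 - 2 * \<rho> * \<tau>) + n * (1 - \<rho>\<^sup>2) * (1 - \<rho> * \<tau>) = n * (1 - \<rho>\<^sup>2) * sqrt (1 - \<tau>\<^sup>2) * \<delta>"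
    proof -
      have "(2 * \<rho> * p * Q + n * (1 - r) * (1 - \<rho> * \<tau>)) * N
          = 2 * \<rho> * p * (Q * N) + n * (1 - r) * (N - \<rho> * (\<tau> * N))" by (simp add: algebra_simps)
      also have "\<dots> = 2 * \<rho> * (n * p) * (1 - r)\<^sup>2 + n * (1 - r) * (N - \<rho> * \<rho> * (n + 2 - (n - 2) * r))"
        unfolding QN \<tau>N by (simp add: mult_ac)
      also have "\<dots> = (1 - r)\<^sup>2 * (n\<^sup>2 - (n - 2)\<^sup>2 * r)"
        unfolding np N_def r_def by (simp add: power2_eq_square algebra_simps)
      also have "\<dots> = (n * (1 - r))\<^sup>2 * \<delta>\<^sup>2" unfolding np2[symmetric] \<delta>0(2) by algebra
      also have "\<dots> = n * (1 - r) * (n * (1 - r) * \<delta> / N) * \<delta> * N" using N0 by (simp add: power2_eq_square)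
      finally show ?thesis unfolding sq Q_def r_def by (subst (asm) mult_right_cancel) (use N0 in auto)
    qed
  qed (fact \<tau>0 \<tau>1 p0 p1 \<delta>0)+
qed

text \<open>The relations act one by one: the first factors |x - z|^2, the second cancels the
  constant term of the boosted field, and the third makes its axial and transverse parts
  proportional after the stretch. What is left is w . l times a factor free of l.\<close>

lemma poisson_grad_boost:
  fixes e w l :: "real ^ 'n::finite" and \<rho> \<tau> p \<delta> :: real
  defines "n \<equiv> real CARD('n)" and "Q \<equiv> 1 + \<rho>\<^sup>2 - 2 * \<rho> * \<tau>" and "s \<equiv> sqrt (1 - \<tau>\<^sup>2)"
    and "\<eta> \<equiv> stretch e \<delta> w /\<^sub>R norm (stretch e \<delta> w)"
  assumes e: "norm e = 1" and \<tau>: "0 < \<tau>" "\<tau> < 1" and p: "0 < p" "p < 1" and \<delta>: "0 < \<delta>" and Q: "0 < Q"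
    and rel: "2 * \<rho> - \<tau> * (1 + \<rho>\<^sup>2) = p * Q" "n * (1 - \<rho>\<^sup>2) * (\<tau> - \<rho>) = 2 * \<rho> * Q"
      "2 * \<rho> * p * Q + n * (1 - \<rho>\<^sup>2) * (1 - \<rho> * \<tau>) = n * (1 - \<rho>\<^sup>2) * s * \<delta>"
    and w: "w \<noteq> 0"
  shows "(norm (stretch e \<delta> w) powr (- n) * (1 + \<tau> * (\<eta> \<bullet> e)) powr (1 - n)) * (poisson_grad (\<rho> *\<^sub>R e) (boost e \<tau> \<eta>) \<bullet> l)
      = (n * (1 - \<rho>\<^sup>2) * s * \<delta> * Q powr (- n / 2 - 1)) * ((w \<bullet> l) * weight n e \<delta> p \<tau> w)"
proof -
  define G where "G = norm (stretch e \<delta> w)"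
  define u where "u = 1 + \<tau> * (\<eta> \<bullet> e)"
  define v where "v = 1 - p * (\<eta> \<bullet> e)"
  define a b where "a = \<eta> \<bullet> e" and "b = e \<bullet> l"
  define x where "x = \<rho> *\<^sub>R e"
  define z where "z = boost e \<tau> \<eta>"
  define q where "q = (x - z) \<bullet> (x - z)"
  have G0: "0 < G" using stretch_eq_0[OF e, of \<delta> w] \<delta> w by (simp add: G_def)
  have \<eta>1: "norm \<eta> = 1" using G0 by (simp add: \<eta>_def G_def)
  have ee: "e \<bullet> e = 1" using e by (simp add: dot_square_norm)
  have u0: "0 < u" unfolding u_def by (rule boost_denominator_pos[OF e \<eta>1 \<tau>])
  have v0: "0 < v"
    using boost_denominator_pos[of e "- \<eta>" p] e \<eta>1 p by (simp add: v_def)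
  have zz: "z \<bullet> z = 1" unfolding z_def using boost_in_sphere[OF e \<eta>1 \<tau>] by (simp add: dot_square_norm)
  have uz: "u * (z \<bullet> y) = (a + \<tau>) * (e \<bullet> y) + s * (\<eta> \<bullet> y - a * (e \<bullet> y))" for y
    unfolding u_def z_def s_def a_def by (rule inner_boost[OF e \<eta>1 \<tau>])
  have uze: "u * (z \<bullet> e) = a + \<tau>" unfolding uz by (simp add: ee a_def)
  have uq: "u * q = Q * v"
  proof -
    have "u * q = u * (1 + \<rho>\<^sup>2) - 2 * \<rho> * (u * (z \<bullet> e))"
      by (simp add: q_def x_def inner_diff zz ee inner_commute[of e z] power2_eq_square algebra_simps)
    also have "\<dots> = Q - a * (2 * \<rho> - \<tau> * (1 + \<rho>\<^sup>2))"
      unfolding uze by (simp add: u_def Q_def a_def algebra_simps)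
    also have "\<dots> = Q * v" unfolding rel(1) by (simp add: v_def a_def algebra_simps)
    finally show ?thesis .
  qed
  then have q: "q = Q * v / u" using u0 by (simp add: field_simps)
  have q0: "0 < q" unfolding q using Q v0 u0 by simp
  have G\<eta>: "G * (\<eta> \<bullet> y) = stretch e \<delta> w \<bullet> y" for y using G0 by (simp add: \<eta>_def G_def)
  have Ga: "G * a = w \<bullet> e" by (simp add: a_def G\<eta> stretch_inner(1)[OF e])
  \<comment> \<open>The vector part of the gradient, paired with l. Multiplying by u clears the
    denominator of the boost, multiplying by G that of the normalization of the stretched
    vector.\<close>
  have bracket: "- 2 * q * (x \<bullet> l) - n * (1 - \<rho>\<^sup>2) * ((x - z) \<bullet> l) = n * (1 - \<rho>\<^sup>2) * s * \<delta> * (w \<bullet> l) / (G * u)"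
  proof -
    let ?c = "n * (1 - \<rho>\<^sup>2)"
    have "u * (- 2 * q * (x \<bullet> l) - ?c * ((x - z) \<bullet> l)) = - 2 * (u * q) * \<rho> * b - ?c * (\<rho> * u * b) + ?c * (u * (z \<bullet> l))"
      by (simp add: x_def b_def inner_diff_left algebra_simps)
    also have "\<dots> = (?c * (\<tau> - \<rho>) - 2 * \<rho> * Q) * b + (2 * \<rho> * p * Q + ?c * (1 - \<rho> * \<tau>)) * a * b + ?c * s * (\<eta> \<bullet> l - a * b)"
      unfolding uq uz by (simp add: v_def u_def a_def[symmetric] b_def[symmetric] algebra_simps)
    also have "\<dots> = ?c * s * (\<delta> * a * b + (\<eta> \<bullet> l - a * b))"
      unfolding rel(2,3) by (simp add: algebra_simps)
    finally have 1: "u * (- 2 * q * (x \<bullet> l) - ?c * ((x - z) \<bullet> l)) = ?c * s * (\<delta> * a * b + (\<eta> \<bullet> l - a * b))" .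
    have "G * (\<delta> * a * b + (\<eta> \<bullet> l - a * b)) = \<delta> * (G * a) * b + (G * (\<eta> \<bullet> l) - (G * a) * b)" by (simp add: algebra_simps)
    also have "\<dots> = \<delta> * (w \<bullet> l)" unfolding G\<eta> Ga stretch_inner(2)[OF e] b_def by (simp add: algebra_simps)
    finally have 2: "\<delta> * a * b + (\<eta> \<bullet> l - a * b) = \<delta> * (w \<bullet> l) / G" using G0 by (simp add: field_simps)
    show ?thesis using 1 unfolding 2 using u0 G0 by (simp add: field_simps)
  qed
  have "poisson_grad x z \<bullet> l = q powr (- (n / 2) - 1) * (- 2 * q * (x \<bullet> l) - n * (1 - \<rho>\<^sup>2) * ((x - z) \<bullet> l))"
  proof -
    have "q powr (- (n / 2)) = q * q powr (- (n / 2) - 1)" using q0 powr_add[of q 1 "- (n / 2) - 1"] by simp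
    moreover have "x \<bullet> x = \<rho>\<^sup>2" by (simp add: x_def ee power2_eq_square)
    ultimately show ?thesis
      unfolding poisson_grad_def q_def[symmetric] n_def[symmetric] by (simp add: inner_add_left algebra_simps)
  qed
  also have "q powr (- (n / 2) - 1) = Q powr (- n / 2 - 1) * v powr (- n / 2 - 1) / u powr (- n / 2 - 1)"
    unfolding q using Q v0 u0 by (simp add: powr_mult powr_divide)
  finally have pg: "poisson_grad x z \<bullet> l = (n * (1 - \<rho>\<^sup>2) * s * \<delta> * Q powr (- n / 2 - 1)) * ((w \<bullet> l) * (v powr (- n / 2 - 1) / (u powr (- n / 2 - 1) * (G * u))))"
    unfolding bracket by simp
  have "G powr (- n) / G = G powr (- n - 1)" using G0 by (simp add: powr_diff)
  moreover have "u powr (1 - n) / (u powr (- n / 2 - 1) * u) = u powr (1 - n / 2)"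
  proof -
    have "u powr (- n / 2 - 1) * u = u powr (- n / 2)" using u0 powr_add[of u "- n / 2 - 1" 1] by simp
    then show ?thesis using u0 by (simp flip: powr_diff)
  qed
  ultimately have W: "weight n e \<delta> p \<tau> w = (G powr (- n) / G) * v powr (- n / 2 - 1) * (u powr (1 - n) / (u powr (- n / 2 - 1) * u))"
    unfolding weight_def G_def u_def v_def \<eta>_def by simp
  show ?thesis
    unfolding G_def[symmetric] u_def[symmetric] x_def[symmetric] z_def[symmetric] pg W by (simp add: divide_simps)
qed

subsection \<open>The sharp constants\<close>

text \<open>Supplies continuity up to the sphere, which the representation formula requires. The
  factor r in the gradient tends to 1 in the limit.\<close>

lemma harmonic_on_dilation:
  fixes U :: "real ^ 'n::finite \<Rightarrow> real"
  assumes U: "harmonic_on (ball 0 1) U" and r: "0 < r" "r < 1"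
  shows "harmonic_on (ball 0 1) (\<lambda>y. U (r *\<^sub>R y))" "continuous_on (cball 0 1) (\<lambda>y. U (r *\<^sub>R y))"
    and "y \<in> ball 0 1 \<Longrightarrow> grad (\<lambda>y. U (r *\<^sub>R y)) y = r *\<^sub>R grad U (r *\<^sub>R y)"
proof -
  let ?B = "ball (0::real^'n) 1"
  have C: "C2_on ?B U" and lap: "\<And>x. x \<in> ?B \<Longrightarrow> laplacian U x = 0" using U by (auto simp: harmonic_on_def)
  have rB: "r *\<^sub>R y \<in> ?B" if "y \<in> cball 0 1" for y :: "real^'n"
  proof -
    have "r * norm y \<le> r * 1" using that r by (intro mult_left_mono) auto
    then have "r * norm y < 1" using r by linarith
    then show ?thesis using r by simp
  qed
  then have rB': "r *\<^sub>R y \<in> ?B" if "y \<in> ?B" for y :: "real^'n" using that by simp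
  have chain: "((\<lambda>y. f (r *\<^sub>R y)) has_derivative (\<lambda>h. h \<bullet> (r *\<^sub>R v))) (at y)"
    if "(f has_derivative (\<lambda>h. h \<bullet> v)) (at (r *\<^sub>R y))" for f :: "real^'n \<Rightarrow> real" and v y
  proof -
    have "((\<lambda>y. r *\<^sub>R y) has_derivative (\<lambda>h. r *\<^sub>R h)) (at y)" by (auto intro!: derivative_eq_intros)
    from diff_chain_at[OF this that] show ?thesis by (simp add: o_def)
  qed
  let ?g = "\<lambda>y. r *\<^sub>R grad U (r *\<^sub>R y)" and ?H = "\<lambda>i y. r *\<^sub>R (r *\<^sub>R grad (partial i U) (r *\<^sub>R y))"
  have d1: "((\<lambda>y. U (r *\<^sub>R y)) has_derivative (\<lambda>h. h \<bullet> ?g y)) (at y)" if "y \<in> ?B" for y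
    by (rule chain[OF C2_on_has_derivative[OF C rB'[OF that]]])
  have d2: "((\<lambda>y. ?g y $ i) has_derivative (\<lambda>h. h \<bullet> ?H i y)) (at y)" if "y \<in> ?B" for i y
    unfolding vector_scaleR_component real_scaleR_def
    by (rule has_derivative_inner_cmult[OF chain[OF C2_on_grad_has_derivative[OF C rB'[OF that]]]])
  have gc: "continuous_on ?B (grad (partial i U))" for i
    using C unfolding C2_on_def grad_def by (auto intro!: continuous_intros)
  have c2: "continuous_on ?B (?H i)" for i
    by (intro continuous_intros continuous_on_compose2[OF gc]) (use rB' in auto)
  have "laplacian (\<lambda>y. U (r *\<^sub>R y)) y = 0" if y: "y \<in> ?B" for y
  proof -
    have "laplacian (\<lambda>y. U (r *\<^sub>R y)) y = r * (r * laplacian U (r *\<^sub>R y))"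
      by (subst laplacian_eq[OF open_ball d1 d2 c2 y]) (simp_all add: laplacian_def grad_def sum_distrib_left mult.assoc)
    then show ?thesis using lap[OF rB'[OF y]] by simp
  qed
  then show "harmonic_on ?B (\<lambda>y. U (r *\<^sub>R y))"
    unfolding harmonic_on_def using C2_onI[OF open_ball d1 d2 c2] by blast
  show "continuous_on (cball 0 1) (\<lambda>y. U (r *\<^sub>R y))"
    by (rule continuous_on_compose2[OF C2_on_imp_continuous_on[OF C]]) (use rB in \<open>auto intro!: continuous_intros\<close>)
  show "y \<in> ?B \<Longrightarrow> grad (\<lambda>y. U (r *\<^sub>R y)) y = r *\<^sub>R grad U (r *\<^sub>R y)"
    by (rule grad_eq[OF d1])
qed

lemma abs_le_sup_abs:
  assumes "bounded_harmonic U" "y \<in> ball 0 1"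
  shows "\<bar>U y\<bar> \<le> sup_abs U"
proof -
  obtain K where "\<forall>v\<in>U ` ball 0 1. norm v \<le> K"
    using assms(1) unfolding bounded_harmonic_def bounded_iff by blast
  then have "bdd_above ((\<lambda>y. \<bar>U y\<bar>) ` ball 0 1)" by (intro bdd_aboveI2[of _ _ K]) auto
  then show ?thesis unfolding sup_abs_def by (rule cSUP_upper[OF assms(2)])
qed

text \<open>A test function of supremum 1, which shows that an admissible constant is
  nonnegative.\<close>

lemma bounded_harmonic_one: "bounded_harmonic (\<lambda>_ :: real ^ 'n::finite. 1)" "sup_abs (\<lambda>_ :: real ^ 'n. 1) = 1"
proof -
  have "harmonic_on (ball (0::real^'n) 1) (\<lambda>_. 1)"
  proof -
    have "C2_on (ball (0::real^'n) 1) (\<lambda>_. 1)" "\<And>x. x \<in> ball 0 1 \<Longrightarrow> laplacian (\<lambda>_. 1) (x::real^'n) = (\<Sum>i\<in>UNIV. (0::real^'n) $ i)"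
      by (rule C2_onI[where g = "\<lambda>_. 0" and H = "\<lambda>_ _. 0"] laplacian_eq[where g = "\<lambda>_. 0" and H = "\<lambda>_ _. 0" and S = "ball 0 1"]; simp)+
    then show ?thesis by (simp add: harmonic_on_def)
  qed
  then show "bounded_harmonic (\<lambda>_ :: real ^ 'n. 1)" by (auto simp: bounded_harmonic_def bounded_iff)
  show "sup_abs (\<lambda>_ :: real ^ 'n. 1) = 1" unfolding sup_abs_def by simp
qed

text \<open>The lower bound tests with the Poisson integrals of \<open>g / (\<bar>g\<bar> + \<epsilon>)\<close>, where \<open>g\<close> is the directional derivative
  of the kernel; the upper bound applies the representation to the dilations \<open>y \<mapsto> U (r y)\<close>.\<close>

lemma dir_grad_const_poisson:
  fixes M :: "'w::euclidean_space measure" and Z :: "'w \<Rightarrow> real ^ 'n::finite" and x l :: "real ^ 'n"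
  assumes Z: "Z \<in> borel_measurable M" "\<And>w. w \<in> space M \<Longrightarrow> Z w \<in> sphere 0 1"
    and J: "integrable M J" "\<And>w. w \<in> space M \<Longrightarrow> 0 \<le> J w"
    and norm: "\<And>y. y \<in> ball 0 1 \<Longrightarrow> (\<integral>w. J w * poisson y (Z w) \<partial>M) = c" and c: "0 < c"
    and x: "x \<in> ball 0 1"
  defines "D \<equiv> (\<integral>w. \<bar>J w * (poisson_grad x (Z w) \<bullet> l)\<bar> \<partial>M) / c"
  shows "bounded_harmonic U \<Longrightarrow> \<bar>grad U x \<bullet> l\<bar> \<le> D * sup_abs U"
    and "dir_grad_const x l = D"
    and "(\<And>U. bounded_harmonic U \<Longrightarrow> \<bar>grad U x \<bullet> l\<bar> \<le> C * sup_abs U) \<Longrightarrow> D \<le> C"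
proof -
  define g where "g w = poisson_grad x (Z w) \<bullet> l" for w
  have PGc: "continuous_on (sphere 0 1) (poisson_grad x)"
    by (rule continuous_on_compose2[OF continuous_on_poisson_grad, of _ "\<lambda>z. (x, z)", simplified])
      (use x in \<open>auto intro!: continuous_intros\<close>)
  have pi: "integrable M (\<lambda>w. k w *\<^sub>R poisson_grad x (Z w))" if "integrable M k" for k
    by (rule integrable_compact_parameter[OF compact_sphere Z that PGc])
  have gi: "integrable M (\<lambda>w. k w * g w)" if "integrable M k" for k
    using integrable_inner_left[OF pi[OF that], of l] by (simp add: g_def)
  have grad_int: "(\<integral>w. k w *\<^sub>R poisson_grad x (Z w) \<partial>M) \<bullet> l = (\<integral>w. k w * g w \<partial>M)" if "integrable M k" for k
    using integral_inner_left[of l M "\<lambda>w. k w *\<^sub>R poisson_grad x (Z w)"] pi[OF that] by (simp add: g_def)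
  have Dg: "(\<integral>w. \<bar>J w * g w\<bar> \<partial>M) = D * c" using c by (simp add: D_def g_def)
  have gm: "g \<in> borel_measurable M"
  proof -
    have "(\<lambda>z. indicator (sphere 0 1) z *\<^sub>R poisson_grad x z) \<in> borel_measurable borel"
      by (intro borel_measurable_continuous_on_indicator PGc) simp
    then have "(\<lambda>w. (indicator (sphere 0 1) (Z w) *\<^sub>R poisson_grad x (Z w)) \<bullet> l) \<in> borel_measurable M"
      using Z(1) by measurable
    then show ?thesis
      by (rule measurable_cong[THEN iffD1, rotated]) (simp only: Z(2) indicator_simps scaleR_one g_def)
  qed
  have upper: "\<bar>grad U x \<bullet> l\<bar> \<le> D * sup_abs U" if U: "bounded_harmonic U" for U
  proof -
    have Uh: "harmonic_on (ball 0 1) U" using U by (simp add: bounded_harmonic_def)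
    have C: "C2_on (ball 0 1) U" using Uh by (simp add: harmonic_on_def)
    have est: "\<bar>r * (grad U (r *\<^sub>R x) \<bullet> l)\<bar> \<le> D * sup_abs U" if r: "0 < r" "r < 1" for r
    proof -
      let ?V = "\<lambda>y. U (r *\<^sub>R y)" and ?k = "\<lambda>w. J w * U (r *\<^sub>R Z w)"
      note dil = harmonic_on_dilation[OF Uh r]
      have k: "integrable M ?k"
        using integrable_compact_parameter[OF compact_sphere Z J(1) continuous_on_subset[OF dil(2)]] by auto
      have rep: "?V y = (1 / c) * (\<integral>w. ?k w * poisson y (Z w) \<partial>M)" if "y \<in> ball 0 1" for y
        using poisson_representation[OF Z J norm dil(1,2) that] c by simp
      let ?P = "\<lambda>y. \<integral>w. ?k w * poisson y (Z w) \<partial>M"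
      have "(?P has_derivative (\<lambda>h. h \<bullet> grad ?P x)) (at x)"
        using C2_on_has_derivative[OF _ x] harmonic_on_poisson_integral[OF Z k] by (simp add: harmonic_on_def)
      then have "((\<lambda>y. (1 / c) * ?P y) has_derivative (\<lambda>h. h \<bullet> ((1 / c) *\<^sub>R grad ?P x))) (at x)"
        by (rule has_derivative_inner_cmult)
      then have "(?V has_derivative (\<lambda>h. h \<bullet> ((1 / c) *\<^sub>R grad ?P x))) (at x)"
        by (rule has_derivative_transform_within_open[OF _ open_ball x]) (simp add: rep)
      then have "grad ?V x = (1 / c) *\<^sub>R grad ?P x" by (rule grad_eq)
      then have "r *\<^sub>R grad U (r *\<^sub>R x) = (1 / c) *\<^sub>R grad ?P x" unfolding dil(3)[OF x] .
      also have "grad ?P x = (\<integral>w. ?k w *\<^sub>R poisson_grad x (Z w) \<partial>M)"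
        by (rule grad_poisson_integral[OF Z k x])
      finally have "(r *\<^sub>R grad U (r *\<^sub>R x)) \<bullet> l = (1 / c) * (\<integral>w. ?k w * g w \<partial>M)"
        using grad_int[OF k] by simp
      then have "\<bar>r * (grad U (r *\<^sub>R x) \<bullet> l)\<bar> = (1 / c) * \<bar>\<integral>w. ?k w * g w \<partial>M\<bar>"
        using c by (simp add: abs_mult)
      also have "\<bar>\<integral>w. ?k w * g w \<partial>M\<bar> \<le> (\<integral>w. sup_abs U * \<bar>J w * g w\<bar> \<partial>M)"
      proof (rule integral_abs_bound_integral[OF gi[OF k]])
        show "integrable M (\<lambda>w. sup_abs U * \<bar>J w * g w\<bar>)" using gi[OF J(1)] by simp
        fix w assume w: "w \<in> space M"
        have "r *\<^sub>R Z w \<in> ball 0 1" using Z(2)[OF w] r by simp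
        then have "\<bar>U (r *\<^sub>R Z w)\<bar> * \<bar>J w * g w\<bar> \<le> sup_abs U * \<bar>J w * g w\<bar>"
          by (intro mult_right_mono abs_le_sup_abs[OF U]) auto
        then show "\<bar>?k w * g w\<bar> \<le> sup_abs U * \<bar>J w * g w\<bar>" by (simp add: abs_mult mult_ac)
      qed
      also have "(1 / c) * (\<integral>w. sup_abs U * \<bar>J w * g w\<bar> \<partial>M) = D * sup_abs U"
        using Dg c by simp
      finally show ?thesis using c by (simp add: divide_right_mono)
    qed
    have "((\<lambda>r. \<bar>r * (grad U (r *\<^sub>R x) \<bullet> l)\<bar>) \<longlongrightarrow> \<bar>1 * (grad U (1 *\<^sub>R x) \<bullet> l)\<bar>) (at_left 1)"
    proof (intro tendsto_intros)
      have "continuous_on (ball 0 1) (grad U)"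
        unfolding grad_def by (intro continuous_intros C2_on_imp_continuous_on_partial[OF C])
      then have "isCont (grad U) (1 *\<^sub>R x)" using x by (simp add: continuous_on_eq_continuous_at)
      then show "((\<lambda>r. grad U (r *\<^sub>R x)) \<longlongrightarrow> grad U (1 *\<^sub>R x)) (at_left 1)"
        by (rule isCont_tendsto_compose) (intro tendsto_intros)
    qed
    moreover have "\<forall>\<^sub>F r in at_left 1. \<bar>r * (grad U (r *\<^sub>R x) \<bullet> l)\<bar> \<le> D * sup_abs U"
      by (rule eventually_mono[OF eventually_at_left_real[OF zero_less_one]]) (use est in auto)
    ultimately have "\<bar>1 * (grad U (1 *\<^sub>R x) \<bullet> l)\<bar> \<le> D * sup_abs U"
      by (rule tendsto_upperbound) simp
    then show ?thesis by simp
  qed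
  have lower: "D \<le> C" if C: "\<And>U. bounded_harmonic U \<Longrightarrow> \<bar>grad U x \<bullet> l\<bar> \<le> C * sup_abs U" for C
  proof -
    \<comment> \<open>The sign of C is needed to pass from C * \<open>sup_abs V\<close> to C *
      c.\<close>
    have C0: "0 \<le> C" using C[OF bounded_harmonic_one(1)] bounded_harmonic_one(2) by (metis abs_ge_zero mult.right_neutral order_trans)
    define I where "I = (\<integral>w. J w \<partial>M)"
    have I0: "0 \<le> I" unfolding I_def using J(2) by (intro Bochner_Integration.integral_nonneg)
    have est: "D * c \<le> C * c + \<epsilon> * I" if \<epsilon>: "0 < \<epsilon>" for \<epsilon>
    proof -
      define s where "s w = g w / (\<bar>g w\<bar> + \<epsilon>)" for w
      have s1: "\<bar>s w\<bar> \<le> 1" for w using \<epsilon> by (simp add: s_def divide_le_eq)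
      define k where "k w = J w * s w" for w
      have km: "k \<in> borel_measurable M" unfolding k_def s_def using gm J(1) by measurable
      have kJ: "\<bar>k w\<bar> \<le> \<bar>J w\<bar>" for w unfolding k_def abs_mult using s1[of w] by (simp add: mult_left_le)
      have k: "integrable M k"
        by (rule Bochner_Integration.integrable_bound[OF J(1) km]) (use kJ in auto)
      define V where "V y = (\<integral>w. k w * poisson y (Z w) \<partial>M)" for y
      have iP: "integrable M (\<lambda>w. k w * poisson y (Z w))" if "y \<in> ball 0 1" "integrable M k" for y k
        using integrable_compact_parameter[OF compact_sphere Z that(2) continuous_on_poisson_slice[OF that(1)]] by simp
      \<comment> \<open>Since |k| <= J, the test function is dominated by the integral of J against
        the kernel, which is c. This is where the normalization in D arises.\<close>
      have Vc: "\<bar>V y\<bar> \<le> c" if y: "y \<in> ball 0 1" for y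
      proof -
        have "\<bar>V y\<bar> \<le> (\<integral>w. J w * poisson y (Z w) \<partial>M)"
          unfolding V_def
        proof (rule integral_abs_bound_integral[OF iP[OF y k] iP[OF y J(1)]])
          show "\<bar>k w * poisson y (Z w)\<bar> \<le> J w * poisson y (Z w)" if "w \<in> space M" for w
            using kJ[of w] J(2)[OF that] poisson_nonneg[OF y, of "Z w"] by (simp add: abs_mult mult_right_mono)
        qed
        then show ?thesis using norm[OF y] by simp
      qed
      have Vb: "bounded_harmonic V"
        unfolding bounded_harmonic_def
      proof
        show "harmonic_on (ball 0 1) V" unfolding V_def by (rule harmonic_on_poisson_integral[OF Z k])
        show "bounded (V ` ball 0 1)" by (rule boundedI[of _ c]) (use Vc in auto)
      qed
      have "sup_abs V \<le> c" unfolding sup_abs_def using Vc by (intro cSUP_least) auto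
      then have "\<bar>grad V x \<bullet> l\<bar> \<le> C * c" using C[OF Vb] C0 by (meson mult_left_mono order_trans)
      moreover have "grad V x = (\<integral>w. k w *\<^sub>R poisson_grad x (Z w) \<partial>M)"
        unfolding V_def by (rule grad_poisson_integral[OF Z k x])
      then have "grad V x \<bullet> l = (\<integral>w. k w * g w \<partial>M)"
        by (simp only: grad_int[OF k])
      moreover have "D * c - \<epsilon> * I \<le> (\<integral>w. k w * g w \<partial>M)"
      proof -
        have "D * c - \<epsilon> * I = (\<integral>w. \<bar>J w * g w\<bar> - \<epsilon> * J w \<partial>M)"
          unfolding Dg[symmetric] I_def using gi[OF J(1)] J(1) by (subst Bochner_Integration.integral_diff) auto
        also have "\<dots> \<le> (\<integral>w. k w * g w \<partial>M)"
        proof (rule integral_mono)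
          show "integrable M (\<lambda>w. \<bar>J w * g w\<bar> - \<epsilon> * J w)" using gi[OF J(1)] J(1) by auto
          show "integrable M (\<lambda>w. k w * g w)" by (rule gi[OF k])
          fix w assume w: "w \<in> space M"
          have "\<bar>g w\<bar> - \<epsilon> \<le> s w * g w"
          proof -
            have "(\<bar>g w\<bar> - \<epsilon>) * (\<bar>g w\<bar> + \<epsilon>) \<le> g w * g w" by (simp add: algebra_simps)
            then show ?thesis using \<epsilon> by (simp add: s_def le_divide_eq add_nonneg_pos)
          qed
          then have "J w * (\<bar>g w\<bar> - \<epsilon>) \<le> J w * (s w * g w)" using J(2)[OF w] by (rule mult_left_mono)
          then show "\<bar>J w * g w\<bar> - \<epsilon> * J w \<le> k w * g w"
            using J(2)[OF w] by (simp add: k_def abs_mult algebra_simps)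
        qed
        finally show ?thesis .
      qed
      ultimately show ?thesis by linarith
    qed
    have "D * c \<le> C * c"
    proof (rule field_le_epsilon)
      fix \<epsilon> :: real assume \<epsilon>: "0 < \<epsilon>"
      have "D * c \<le> C * c + \<epsilon> / (I + 1) * I" using \<epsilon> I0 by (intro est) simp
      also have "\<epsilon> / (I + 1) * I \<le> \<epsilon>" using \<epsilon> I0 by (simp add: field_simps)
      finally show "D * c \<le> C * c + \<epsilon>" by simp
    qed
    then show ?thesis using c by simp
  qed
  show "bounded_harmonic U \<Longrightarrow> \<bar>grad U x \<bullet> l\<bar> \<le> D * sup_abs U" by (rule upper)
  show "dir_grad_const x l = D"
    unfolding dir_grad_const_def by (rule Least_equality) (use upper lower in blast)+
  show "(\<And>U. bounded_harmonic U \<Longrightarrow> \<bar>grad U x \<bullet> l\<bar> \<le> C * sup_abs U) \<Longrightarrow> D \<le> C" by (rule lower)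
qed

lemma khavinson_radial_extremal:
  fixes x l :: "real ^ 'n::finite"
  assumes n: "CARD('n) \<ge> 3" and x: "x \<noteq> 0" "norm x < 1"
  defines "e \<equiv> x /\<^sub>R norm x"
  shows "grad_const x = dir_grad_const x e"
    and "norm l = 1 \<Longrightarrow> grad_const x = dir_grad_const x l \<longleftrightarrow> l = e \<or> l = - e"
proof -
  define \<rho> where "\<rho> = norm x"
  have \<rho>: "0 < \<rho>" "\<rho> < 1" using x by (simp_all add: \<rho>_def)
  have e: "norm e = 1" and xe: "x = \<rho> *\<^sub>R e" using x by (simp_all add: e_def \<rho>_def)
  have xB: "x \<in> ball 0 1" using x by simp
  let ?n = "real CARD('n)"
  have n3: "3 \<le> ?n" using n by simp
  obtain \<tau> p \<delta> where \<tau>: "0 < \<tau>" "\<tau> < 1" and p: "0 < p" "p < 1" and \<delta>: "0 < \<delta>" "\<delta>\<^sup>2 = 1 - p\<^sup>2"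
    and \<kappa>: "?n / (?n - 2) \<le> \<tau> / p" and Q: "0 < 1 + \<rho>\<^sup>2 - 2 * \<rho> * \<tau>"
    and rel: "2 * \<rho> - \<tau> * (1 + \<rho>\<^sup>2) = p * (1 + \<rho>\<^sup>2 - 2 * \<rho> * \<tau>)"
    "?n * (1 - \<rho>\<^sup>2) * (\<tau> - \<rho>) = 2 * \<rho> * (1 + \<rho>\<^sup>2 - 2 * \<rho> * \<tau>)"
    "2 * \<rho> * p * (1 + \<rho>\<^sup>2 - 2 * \<rho> * \<tau>) + ?n * (1 - \<rho>\<^sup>2) * (1 - \<rho> * \<tau>) = ?n * (1 - \<rho>\<^sup>2) * sqrt (1 - \<tau>\<^sup>2) * \<delta>"
    by (rule boost_parameters[OF n3 \<rho>]) (rule that; assumption)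
  let ?L = "stretch e \<delta>"
  let ?\<eta> = "\<lambda>w. ?L w /\<^sub>R norm (?L w)"
  define Z where "Z w = boost e \<tau> (?\<eta> w)" for w
  define J where "J w = norm (?L w) powr (- ?n) * (1 + \<tau> * (?\<eta> w \<bullet> e)) powr (1 - ?n)" for w
  define W where "W = weight ?n e \<delta> p \<tau>"
  define K0 where "K0 = ?n * (1 - \<rho>\<^sup>2) * sqrt (1 - \<tau>\<^sup>2) * \<delta> * (1 + \<rho>\<^sup>2 - 2 * \<rho> * \<tau>) powr (- ?n / 2 - 1)"
  have K0: "0 < K0"
    unfolding K0_def using n3 \<rho> \<tau> \<delta>(1) Q by (intro mult_pos_pos) (simp_all add: power_less_one_iff)
  have L0: "?L w \<noteq> 0" if "w \<in> shell" for w
    using stretch_eq_0[OF e, of \<delta> w] \<delta>(1) shell_nonzero[OF that] by simp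
  have Lc: "continuous_on A ?L" for A unfolding stretch_def by (intro continuous_intros)
  have \<eta>c: "continuous_on shell ?\<eta>" by (intro continuous_intros Lc) (use L0 in auto)
  have \<eta>1: "norm (?\<eta> w) = 1" if "w \<in> shell" for w using L0[OF that] by simp
  have u: "0 < 1 + \<tau> * (?\<eta> w \<bullet> e)" if "w \<in> shell" for w by (rule boost_denominator_pos[OF e \<eta>1[OF that] \<tau>])
  have v: "0 < 1 - p * (?\<eta> w \<bullet> e)" if "w \<in> shell" for w
    using boost_denominator_pos[of e "- ?\<eta> w" p] e \<eta>1[OF that] p by simp
  have Zs: "Z w \<in> sphere 0 1" if "w \<in> shell" for w
    unfolding Z_def by (rule boost_in_sphere[OF e \<eta>1[OF that] \<tau>])
  have Zc: "continuous_on shell Z"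
    unfolding Z_def by (rule continuous_on_compose2[OF continuous_on_boost[OF e \<tau>] \<eta>c]) (use \<eta>1 in auto)
  have Jc: "continuous_on shell J"
    unfolding J_def by (intro continuous_intros Lc \<eta>c) (use L0 u in force)+
  have Wc: "continuous_on shell W"
    unfolding W_def weight_def by (intro continuous_intros Lc \<eta>c) (use L0 u v in force)+
  have Jpos: "0 < J w" if "w \<in> shell" for w
    unfolding J_def using L0[OF that] u[OF that] by simp
  have W0: "0 \<le> W w" for w unfolding W_def weight_def by simp
  have Zm: "Z \<in> borel_measurable shell_measure" "\<And>w. w \<in> space shell_measure \<Longrightarrow> Z w \<in> sphere 0 1"
    using borel_measurable_shell_measure[OF Zc] Zs by auto
  have Ji: "integrable shell_measure J" "\<And>w. w \<in> space shell_measure \<Longrightarrow> 0 \<le> J w"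
    using integrable_shell_measure[OF Jc] Jpos by (auto intro: less_imp_le)
  have "\<delta> \<noteq> 0" using \<delta>(1) by simp
  obtain c where norm: "\<And>y. y \<in> ball 0 1 \<Longrightarrow> (\<integral>w. J w * poisson y (Z w) \<partial>shell_measure) = c"
    by (rule poisson_boosted_measure_constant[OF e \<tau> linear_stretch bij_stretch[OF e \<open>\<delta> \<noteq> 0\<close>],
          folded J_def Z_def]) (rule that; assumption)
  \<comment> \<open>At y = 0 the kernel equals 1 on the whole sphere, so c is the integral of
    J.\<close>
  have c: "0 < c"
  proof -
    have "c = (\<integral>w. J w \<partial>shell_measure)"
      unfolding norm[of 0, symmetric, simplified]
      by (rule Bochner_Integration.integral_cong[OF refl]) (use Zs in \<open>simp add: poisson_def dot_square_norm\<close>)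
    also have "\<dots> > 0"
      by (rule integral_shell_measure_pos[OF Jc, of "(3/2) *\<^sub>R e"])
        (use Jpos e in \<open>auto intro: less_imp_le simp: shell_def\<close>)
    finally show ?thesis .
  qed
  define \<Phi> where "\<Phi> l = (\<integral>w. \<bar>w \<bullet> l\<bar> * W w \<partial>shell_measure)" for l
  have D: "(\<integral>w. \<bar>J w * (poisson_grad x (Z w) \<bullet> l)\<bar> \<partial>shell_measure) / c = K0 * \<Phi> l / c" for l
  proof -
    have "(\<integral>w. \<bar>J w * (poisson_grad x (Z w) \<bullet> l)\<bar> \<partial>shell_measure) = (\<integral>w. K0 * (\<bar>w \<bullet> l\<bar> * W w) \<partial>shell_measure)"
    proof (rule Bochner_Integration.integral_cong[OF refl])
      fix w :: "real^'n" assume "w \<in> space shell_measure"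
      then have "w \<noteq> 0" by (auto dest: shell_nonzero)
      have "J w * (poisson_grad x (Z w) \<bullet> l) = K0 * ((w \<bullet> l) * W w)"
        unfolding J_def Z_def W_def K0_def xe
        by (rule poisson_grad_boost[OF e \<tau> p \<delta>(1) Q rel \<open>w \<noteq> 0\<close>])
      then show "\<bar>J w * (poisson_grad x (Z w) \<bullet> l)\<bar> = K0 * (\<bar>w \<bullet> l\<bar> * W w)"
        using K0 W0[of w] by (simp add: abs_mult)
    qed
    then show ?thesis by (simp add: \<Phi>_def)
  qed
  have dgc1: "\<bar>grad U x \<bullet> l\<bar> \<le> K0 * \<Phi> l / c * sup_abs U" if "bounded_harmonic U" for U l
    by (rule dir_grad_const_poisson(1)[OF Zm Ji norm c xB that, unfolded D])
  have dgc2: "dir_grad_const x l = K0 * \<Phi> l / c" for l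
    by (rule dir_grad_const_poisson(2)[OF Zm Ji norm c xB, unfolded D])
  have dgc3: "K0 * \<Phi> l / c \<le> C" if "\<And>U. bounded_harmonic U \<Longrightarrow> \<bar>grad U x \<bullet> l\<bar> \<le> C * sup_abs U" for l C
    by (rule dir_grad_const_poisson(3)[OF Zm Ji norm c xB that, unfolded D])
  have lt: "\<Phi> l < \<Phi> e" if "norm l = 1" "l \<noteq> e" "l \<noteq> - e" for l
    unfolding \<Phi>_def
  proof (rule cosine_transform_strict_max[OF e that Wc W0])
    fix v w :: "real^'n" assume "v \<in> shell" "norm v = norm w" "\<bar>v \<bullet> e\<bar> < \<bar>w \<bullet> e\<bar>"
    then show "W v + W (- v) < W w + W (- w)"
      unfolding W_def by (intro weight_symmetrized_mono[OF n3 e p \<tau> \<delta> \<kappa>] shell_nonzero)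
  qed
  have \<Phi>m: "\<Phi> (- l) = \<Phi> l" for l by (simp add: \<Phi>_def)
  have le: "\<Phi> l \<le> \<Phi> e" if "norm l = 1" for l
    using lt[OF that] \<Phi>m[of e] by (cases "l = e \<or> l = - e") auto
  have gc: "grad_const x = K0 * \<Phi> e / c"
    unfolding grad_const_def
  proof (rule Least_equality)
    show "\<forall>U. bounded_harmonic U \<longrightarrow> norm (grad U x) \<le> K0 * \<Phi> e / c * sup_abs U"
    proof (intro allI impI)
      fix U :: "real^'n \<Rightarrow> real" assume U: "bounded_harmonic U"
      have s0: "0 \<le> sup_abs U" using abs_le_sup_abs[OF U xB] by linarith
      have \<Phi>0: "0 \<le> \<Phi> e" unfolding \<Phi>_def by (intro Bochner_Integration.integral_nonneg mult_nonneg_nonneg W0) simp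
      show "norm (grad U x) \<le> K0 * \<Phi> e / c * sup_abs U"
      proof (cases "grad U x = 0")
        case True then show ?thesis using s0 \<Phi>0 K0 c by simp
      next
        case False
        \<comment> \<open>The norm of the gradient is its component in its own direction, which
          varies with U. The directional bound for this l is then dominated by the one for
          e.\<close>
        define l where "l = grad U x /\<^sub>R norm (grad U x)"
        have l: "norm l = 1" using False by (simp add: l_def)
        have "norm (grad U x) = \<bar>grad U x \<bullet> l\<bar>"
          using False by (simp add: l_def dot_square_norm power2_eq_square)
        also have "\<dots> \<le> K0 * \<Phi> l / c * sup_abs U" by (rule dgc1[OF U])
        also have "\<dots> \<le> K0 * \<Phi> e / c * sup_abs U"
          using le[OF l] K0 c s0 by (intro mult_right_mono divide_right_mono mult_left_mono) auto
        finally show ?thesis .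
      qed
    qed
    fix C assume C: "\<forall>U::real^'n \<Rightarrow> real. bounded_harmonic U \<longrightarrow> norm (grad U x) \<le> C * sup_abs U"
    show "K0 * \<Phi> e / c \<le> C"
    \<comment> \<open>A constant admissible for the full gradient is admissible for its component
      along e, so minimality of the radial constant applies.\<close>
    proof (rule dgc3)
      fix U :: "real^'n \<Rightarrow> real" assume "bounded_harmonic U"
      then have "norm (grad U x) \<le> C * sup_abs U" using C by blast
      moreover have "\<bar>grad U x \<bullet> e\<bar> \<le> norm (grad U x)"
        using Cauchy_Schwarz_ineq2[of "grad U x" e] e by simp
      ultimately show "\<bar>grad U x \<bullet> e\<bar> \<le> C * sup_abs U" by linarith
    qed
  qed
  show "grad_const x = dir_grad_const x e" unfolding gc dgc2 ..
  show "grad_const x = dir_grad_const x l \<longleftrightarrow> l = e \<or> l = - e" if "norm l = 1"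
  proof -
    have "\<Phi> e = \<Phi> l \<longleftrightarrow> l = e \<or> l = - e"
    proof (cases "l = e \<or> l = - e")
      case True
      then show ?thesis using \<Phi>m[of e] by auto
    next
      case False
      then show ?thesis using lt[OF that] by auto
    qed
    moreover have "K0 * \<Phi> e / c = K0 * \<Phi> l / c \<longleftrightarrow> \<Phi> e = \<Phi> l" using K0 c by simp
    ultimately show ?thesis unfolding gc dgc2 by (simp only:)
  qed
qed

theorem mainTheorem1:
  assumes "CARD('n::finite) \<ge> 3"
  shows "\<exists>\<rho>\<^sub>0::real. 0 < \<rho>\<^sub>0 \<and> \<rho>\<^sub>0 < 1 \<and>
    (\<forall>x::real ^ 'n. \<rho>\<^sub>0 < norm x \<and> norm x < 1 \<longrightarrow>
       grad_const x = dir_grad_const x (x /\<^sub>R norm x) \<and>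
       (\<forall>l::real ^ 'n. norm l = 1 \<longrightarrow>
          (grad_const x = dir_grad_const x l \<longleftrightarrow>
             l = x /\<^sub>R norm x \<or> l = - (x /\<^sub>R norm x))))"
proof (intro exI[of _ "1/2"] conjI allI impI)
  fix x l :: "real ^ 'n" assume x: "1/2 < norm x \<and> norm x < 1"
  then have x0: "x \<noteq> 0" "norm x < 1" by auto
  show "grad_const x = dir_grad_const x (x /\<^sub>R norm x)"
    by (rule khavinson_radial_extremal(1)[OF assms x0])
  show "grad_const x = dir_grad_const x l \<longleftrightarrow> l = x /\<^sub>R norm x \<or> l = - (x /\<^sub>R norm x)" if "norm l = 1"
    by (rule khavinson_radial_extremal(2)[OF assms x0 that])
qed simp_all

end
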